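(* For any Lip-normed operator systems $(X,L_X)$ and $(Y,L_Y)$ we have $\mathrm{dist}_{\mathrm{op}}(X,Y)=\mathrm{dist}_{\mathrm s}(X,Y)$.
   Context: Operator systems are not assumed complete; $X_{\mathrm{sa}}$ denotes the self-adjoint part of an operator system $X$ and $S(X)$ its state space. A unital complete order embedding is a unital completely positive map that is isometric with completely positive inverse on its image (equivalently, a unital complete isometry). A Lip-norm on $X_{\mathrm{sa}}$ is a seminorm $L:X_{\mathrm{sa}}\to[0,+\infty]$ (value $+\infty$ allowed) with $L=0$ on $\mathbb R 1$ such that $\rho_L(\sigma,\omega)=\sup\{|\sigma(a)-\omega(a)|: a\in X_{\mathrm{sa}},\ L(a)\le 1\}$ is a metric on $S(X)$ inducing the weak$^*$ topology. A Lip-normed operator system is a pair $(X,L)$ with $X$ an operator system and $L$ a Lip-norm on $X_{\mathrm{sa}}$. Put $\mathcal E(X)=\{x\in X_{\mathrm{sa}}: L(x)\le 1\}$. Operator Gromov-Hausdorff distance: $\mathrm{dist}_{\mathrm{op}}(X,Y)=\inf\mathrm{dist}_{\mathrm H}(h_X(\mathcal E(X)),h_Y(\mathcal E(Y)))$, with $\mathrm{dist}_{\mathrm H}$ the Hausdorff distance for the norm, and the infimum over all triples $(V,h_X,h_Y)$ with $V$ an operator system and $h_X:X\to V$, $h_Y:Y\to V$ unital complete order embeddings. Complete distance: let $S_n(X)$ be the set of unital completely positive maps $X\to M_n$, with metric $\rho_{L,n}(\varphi,\psi)=\sup\{\|\varphi(x)-\psi(x)\|: x\in X_{\mathrm{sa}},\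 L(x)\le 1\}$. A Lip-norm $L$ on $(X\oplus Y)_{\mathrm{sa}}$ ($X\oplus Y$ the operator system direct sum) is admissible if the quotient seminorms it induces on $X_{\mathrm{sa}}$ and $Y_{\mathrm{sa}}$ via the coordinate projections are $L_X$ and $L_Y$. Then $\mathrm{dist}_{\mathrm s}(X,Y)=\inf_L\sup_{n\in\mathbb N}\mathrm{dist}_{\mathrm H}^{\rho_{L,n}}(S_n(X),S_n(Y))$, the infimum being over all admissible $L$, where $S_n(X)$ and $S_n(Y)$ are viewed as subsets of $S_n(X\oplus Y)$ by composing with the coordinate projections, and $\mathrm{dist}_{\mathrm H}^{\rho}$ is Hausdorff distance for the metric $\rho$. *)

theory Defs
  imports "HOL-Analysis.Analysis" "Jordan_Normal_Form.Matrix"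
begin

section \<open>Complex vector spaces\<close>

class complex_vector = real_vector +
  fixes scaleC :: "complex \<Rightarrow> 'a \<Rightarrow> 'a"  (infixr "*\<^sub>C" 75)
  assumes scaleC_add_right: "c *\<^sub>C (x + y) = c *\<^sub>C x + c *\<^sub>C y"
    and scaleC_add_left: "(c + d) *\<^sub>C x = c *\<^sub>C x + d *\<^sub>C x"
    and scaleC_scaleC: "c *\<^sub>C d *\<^sub>C x = (c * d) *\<^sub>C x"
    and scaleC_one: "1 *\<^sub>C x = x"
    and scaleR_scaleC: "r *\<^sub>R x = complex_of_real r *\<^sub>C x"

lemma vector_space_scaleC:
  "vector_space (scaleC :: complex \<Rightarrow> 'a \<Rightarrow> 'a :: complex_vector)"
  by unfold_locales (simp_all add: scaleC_add_right scaleC_add_left scaleC_scaleC scaleC_one)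

instantiation prod :: (complex_vector, complex_vector) complex_vector
begin

definition "c *\<^sub>C z = (c *\<^sub>C fst z, c *\<^sub>C snd z)"

instance
  by standard
    (simp_all add: scaleC_prod_def scaleC_add_right scaleC_add_left scaleC_scaleC
      scaleC_one scaleR_prod_def scaleR_scaleC)

end

section \<open>Operator systems\<close>

text \<open>
  Operator systems are taken in the abstract sense of Choi and Effros: a complex
  \<open>*\<close>-vector space \<open>X\<close> with cones \<open>os_cone X n\<close> in \<open>M\<^sub>n(X)\<close> for which \<open>os_unit X\<close> is an
  Archimedean matrix order unit. The underlying space is a complex linear subspace of the
  ambient type; the values of \<open>os_star\<close> outside it are irrelevant. No completeness is required.
\<close>

record 'a op_system =
  os_space :: "'a set"
  os_star :: "'a \<Rightarrow> 'a"
  os_unit :: 'a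
  os_cone :: "nat \<Rightarrow> 'a mat set"

definition os_mats :: "'a op_system \<Rightarrow> nat \<Rightarrow> 'a mat set" where
  "os_mats X n = {A \<in> carrier_mat n n. elements_mat A \<subseteq> os_space X}"

definition os_adjoint :: "'a op_system \<Rightarrow> 'a mat \<Rightarrow> 'a mat" where
  "os_adjoint X A = Matrix.mat (dim_col A) (dim_row A) (\<lambda>(i, j). os_star X (A $$ (j, i)))"

definition os_mats_sa :: "'a op_system \<Rightarrow> nat \<Rightarrow> 'a mat set" where
  "os_mats_sa X n = {A \<in> os_mats X n. os_adjoint X A = A}"

definition os_scalar :: "'a::complex_vector op_system \<Rightarrow> nat \<Rightarrow> real \<Rightarrow> 'a mat" where
  "os_scalar X n r = Matrix.mat n n (\<lambda>(i, j). if i = j then r *\<^sub>R os_unit X else 0)"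

text \<open>The compression \<open>\<alpha>\<^sup>* A \<alpha>\<close> of \<open>A \<in> M\<^sub>n(X)\<close> by a scalar \<open>n \<times> m\<close> matrix \<open>\<alpha>\<close>.\<close>

definition compress :: "complex mat \<Rightarrow> 'a::complex_vector mat \<Rightarrow> 'a mat" where
  "compress \<alpha> A = Matrix.mat (dim_col \<alpha>) (dim_col \<alpha>)
     (\<lambda>(i, j). \<Sum>k<dim_row \<alpha>. \<Sum>l<dim_row \<alpha>. (cnj (\<alpha> $$ (k, i)) * \<alpha> $$ (l, j)) *\<^sub>C A $$ (k, l))"

locale operator_system =
  fixes X :: "'a::complex_vector op_system"
  assumes subspace: "module.subspace scaleC (os_space X)"
    and star_closed: "x \<in> os_space X \<Longrightarrow> os_star X x \<in> os_space X"
    and star_star: "x \<in> os_space X \<Longrightarrow> os_star X (os_star X x) = x"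
    and star_add: "\<lbrakk>x \<in> os_space X; y \<in> os_space X\<rbrakk> \<Longrightarrow>
        os_star X (x + y) = os_star X x + os_star X y"
    and star_scaleC: "x \<in> os_space X \<Longrightarrow> os_star X (c *\<^sub>C x) = cnj c *\<^sub>C os_star X x"
    and unit_closed: "os_unit X \<in> os_space X"
    and star_unit: "os_star X (os_unit X) = os_unit X"
    and cone_sa: "os_cone X n \<subseteq> os_mats_sa X n"
    and cone_add: "\<lbrakk>A \<in> os_cone X n; B \<in> os_cone X n\<rbrakk> \<Longrightarrow> A + B \<in> os_cone X n"
    and cone_scaleR: "\<lbrakk>A \<in> os_cone X n; r \<ge> 0\<rbrakk> \<Longrightarrow> map_mat (scaleR r) A \<in> os_cone X n"
    and cone_proper: "\<lbrakk>A \<in> os_cone X n; - A \<in> os_cone X n\<rbrakk> \<Longrightarrow> A = 0\<^sub>m n n"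
    and cone_compress: "\<lbrakk>A \<in> os_cone X n; \<alpha> \<in> carrier_mat n m\<rbrakk> \<Longrightarrow>
        compress \<alpha> A \<in> os_cone X m"
    and order_unit: "A \<in> os_mats_sa X n \<Longrightarrow> \<exists>r>0. os_scalar X n r + A \<in> os_cone X n"
    and archimedean: "\<lbrakk>A \<in> os_mats_sa X n; \<And>r. r > 0 \<Longrightarrow> os_scalar X n r + A \<in> os_cone X n\<rbrakk>
        \<Longrightarrow> A \<in> os_cone X n"

definition os_sa :: "'a op_system \<Rightarrow> 'a set" where
  "os_sa X = {x \<in> os_space X. os_star X x = x}"

definition os_pos :: "'a op_system \<Rightarrow> 'a set" where
  "os_pos X = {x. Matrix.mat 1 1 (\<lambda>_. x) \<in> os_cone X 1}"

text \<open>The norm of an operator system: \<open>\<parallel>x\<parallel> \<le> t\<close> iff the matrix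
  with rows \<open>(t1, x)\<close> and \<open>(x\<^sup>*, t1)\<close> is positive in \<open>M\<^sub>2(X)\<close>.\<close>

definition os_norm :: "'a::complex_vector op_system \<Rightarrow> 'a \<Rightarrow> real" where
  "os_norm X x = Inf {t. t \<ge> 0 \<and>
     mat_of_rows_list 2 [[t *\<^sub>R os_unit X, x], [os_star X x, t *\<^sub>R os_unit X]] \<in> os_cone X 2}"

definition os_sub :: "'a op_system \<Rightarrow> 'a set \<Rightarrow> 'a op_system" where
  "os_sub X S = X\<lparr>os_space := S, os_cone := (\<lambda>n. {A \<in> os_cone X n. elements_mat A \<subseteq> S})\<rparr>"

definition os_sum :: "'a op_system \<Rightarrow> 'b op_system \<Rightarrow> ('a \<times> 'b) op_system" where
  "os_sum X Y =
    \<lparr>os_space = os_space X \<times> os_space Y,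
     os_star = map_prod (os_star X) (os_star Y),
     os_unit = (os_unit X, os_unit Y),
     os_cone = (\<lambda>n. {A. map_mat fst A \<in> os_cone X n \<and> map_mat snd A \<in> os_cone Y n})\<rparr>"

section \<open>Completely positive maps\<close>

definition completely_positive ::
    "'a::complex_vector op_system \<Rightarrow> 'b::complex_vector op_system \<Rightarrow> ('a \<Rightarrow> 'b) \<Rightarrow> bool" where
  "completely_positive X Y h \<longleftrightarrow>
     h ` os_space X \<subseteq> os_space Y \<and>
     (\<forall>x\<in>os_space X. \<forall>y\<in>os_space X. h (x + y) = h x + h y) \<and>
     (\<forall>c. \<forall>x\<in>os_space X. h (c *\<^sub>C x) = c *\<^sub>C h x) \<and>
     (\<forall>n. \<forall>A\<in>os_cone X n. map_mat h A \<in> os_cone Y n)"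

definition complete_order_embedding ::
    "'a::complex_vector op_system \<Rightarrow> 'b::complex_vector op_system \<Rightarrow> ('a \<Rightarrow> 'b) \<Rightarrow> bool" where
  "complete_order_embedding X Y h \<longleftrightarrow>
     completely_positive X Y h \<and>
     h (os_unit X) = os_unit Y \<and>
     (\<forall>x\<in>os_space X. os_norm Y (h x) = os_norm X x) \<and>
     inj_on h (os_space X) \<and>
     completely_positive (os_sub Y (h ` os_space X)) X (inv_into (os_space X) h)"

section \<open>Matrix state spaces\<close>

definition psd :: "complex mat \<Rightarrow> bool" where
  "psd A \<longleftrightarrow> square_mat A \<and> (\<forall>v\<in>carrier_vec (dim_row A). (A *\<^sub>v v) \<bullet>c v \<ge> 0)"

definition vnorm :: "complex Matrix.vec \<Rightarrow> real" where
  "vnorm v = sqrt (\<Sum>i<dim_vec v. (cmod (vec_index v i))\<^sup>2)"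

definition op_norm :: "complex mat \<Rightarrow> real" where
  "op_norm A = (SUP v\<in>{v \<in> carrier_vec (dim_col A). vnorm v \<le> 1}. vnorm (A *\<^sub>v v))"

text \<open>The identification \<open>M\<^sub>k(M\<^sub>n) = M\<^sub>k\<^sub>n\<close> by erasing the inner brackets.\<close>

definition flatten :: "nat \<Rightarrow> nat \<Rightarrow> complex mat mat \<Rightarrow> complex mat" where
  "flatten k n A = Matrix.mat (k * n) (k * n)
     (\<lambda>(i, j). A $$ (i div n, j div n) $$ (i mod n, j mod n))"

text \<open>\<open>S\<^sub>n(X)\<close>: unital completely positive maps \<open>X \<rightarrow> M\<^sub>n\<close>. They are taken to be
  \<open>undefined\<close> outside \<open>os_space X\<close>, so that equality of maps is equality on \<open>X\<close>;
  likewise for states.\<close>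

definition matrix_states :: "'a::complex_vector op_system \<Rightarrow> nat \<Rightarrow> ('a \<Rightarrow> complex mat) set" where
  "matrix_states X n = {\<phi> \<in> os_space X \<rightarrow>\<^sub>E carrier_mat n n.
     (\<forall>x\<in>os_space X. \<forall>y\<in>os_space X. \<phi> (x + y) = \<phi> x + \<phi> y) \<and>
     (\<forall>c. \<forall>x\<in>os_space X. \<phi> (c *\<^sub>C x) = c \<cdot>\<^sub>m \<phi> x) \<and>
     \<phi> (os_unit X) = 1\<^sub>m n \<and>
     (\<forall>k. \<forall>A\<in>os_cone X k. psd (flatten k n (map_mat \<phi> A)))}"

definition state_space :: "'a::complex_vector op_system \<Rightarrow> ('a \<Rightarrow> complex) set" where
  "state_space X = {\<sigma> \<in> os_space X \<rightarrow>\<^sub>E UNIV.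
     (\<forall>x\<in>os_space X. \<forall>y\<in>os_space X. \<sigma> (x + y) = \<sigma> x + \<sigma> y) \<and>
     (\<forall>c. \<forall>x\<in>os_space X. \<sigma> (c *\<^sub>C x) = c * \<sigma> x) \<and>
     \<sigma> (os_unit X) = 1 \<and>
     (\<forall>x\<in>os_pos X. \<sigma> x \<ge> 0)}"

text \<open>The weak* topology: pointwise convergence on \<open>X\<close>.\<close>

definition weak_star :: "'a::complex_vector op_system \<Rightarrow> ('a \<Rightarrow> complex) topology" where
  "weak_star X = subtopology (product_topology (\<lambda>_. euclidean) (os_space X)) (state_space X)"

section \<open>Lip-norms\<close>

text \<open>A seminorm on \<open>X\<^sub>s\<^sub>a\<close> with values in \<open>[0, \<infinity>]\<close> is a function into
  \<^typ>\<open>ennreal\<close>; only its values on \<open>os_sa X\<close> matter.\<close>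

definition lip_ball :: "'a op_system \<Rightarrow> ('a \<Rightarrow> ennreal) \<Rightarrow> 'a set" where
  "lip_ball X L = {x \<in> os_sa X. L x \<le> 1}"

definition lip_dist ::
    "'a op_system \<Rightarrow> ('a \<Rightarrow> ennreal) \<Rightarrow> ('a \<Rightarrow> complex) \<Rightarrow> ('a \<Rightarrow> complex) \<Rightarrow> ennreal" where
  "lip_dist X L \<sigma> \<omega> = (SUP a\<in>lip_ball X L. ennreal (cmod (\<sigma> a - \<omega> a)))"

definition lip_norm :: "'a::complex_vector op_system \<Rightarrow> ('a \<Rightarrow> ennreal) \<Rightarrow> bool" where
  "lip_norm X L \<longleftrightarrow>
     (\<forall>x\<in>os_sa X. \<forall>y\<in>os_sa X. L (x + y) \<le> L x + L y) \<and>
     (\<forall>r. \<forall>x\<in>os_sa X. L (r *\<^sub>R x) = ennreal \<bar>r\<bar> * L x) \<and>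
     (\<forall>r. L (r *\<^sub>R os_unit X) = 0) \<and>
     (\<forall>\<sigma>\<in>state_space X. \<forall>\<omega>\<in>state_space X. lip_dist X L \<sigma> \<omega> < \<infinity>) \<and>
     Metric_space (state_space X) (\<lambda>\<sigma> \<omega>. enn2real (lip_dist X L \<sigma> \<omega>)) \<and>
     Metric_space.mtopology (state_space X) (\<lambda>\<sigma> \<omega>. enn2real (lip_dist X L \<sigma> \<omega>)) = weak_star X"

definition lip_normed_op_system :: "'a::complex_vector op_system \<Rightarrow> ('a \<Rightarrow> ennreal) \<Rightarrow> bool" where
  "lip_normed_op_system X L \<longleftrightarrow> operator_system X \<and> lip_norm X L"

section \<open>The two distances\<close>

definition hausdorff :: "('a \<Rightarrow> 'a \<Rightarrow> ennreal) \<Rightarrow> 'a set \<Rightarrow> 'a set \<Rightarrow> ennreal" where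
  "hausdorff d A B = max (SUP a\<in>A. INF b\<in>B. d a b) (SUP b\<in>B. INF a\<in>A. d a b)"

text \<open>
  The infimum below is over operator systems \<open>V\<close> whose underlying space is a subspace of
  \<^typ>\<open>'x \<times> 'y \<times> 'v\<close>, where \<^typ>\<open>'v\<close> is a parameter. Every \<open>V\<close> in \<^typ>\<open>'v\<close> is included, by
  means of \<open>v \<mapsto> (0, 0, v)\<close>. The factor \<^typ>\<open>'x \<times> 'y\<close> makes room for all triples whatever
  \<^typ>\<open>'v\<close> is: in a triple \<open>(V, h\<^sub>X, h\<^sub>Y)\<close> one may replace \<open>V\<close> by the operator subsystem
  \<open>h\<^sub>X(X) + h\<^sub>Y(Y)\<close>, whose vector space is a quotient of \<open>X \<oplus> Y\<close> and hence isomorphic to a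
  subspace of it.
\<close>

definition dist_op ::
    "'v::complex_vector itself \<Rightarrow>
     'x::complex_vector op_system \<Rightarrow> ('x \<Rightarrow> ennreal) \<Rightarrow>
     'y::complex_vector op_system \<Rightarrow> ('y \<Rightarrow> ennreal) \<Rightarrow> ennreal" where
  "dist_op _ X LX Y LY =
    (INF (V, hX, hY) \<in> {(V :: ('x \<times> 'y \<times> 'v) op_system, hX, hY).
        operator_system V \<and> complete_order_embedding X V hX \<and> complete_order_embedding Y V hY}.
      hausdorff (\<lambda>v w. ennreal (os_norm V (v - w))) (hX ` lip_ball X LX) (hY ` lip_ball Y LY))"

definition lip_mat_dist ::
    "'a op_system \<Rightarrow> ('a \<Rightarrow> ennreal) \<Rightarrow> ('a \<Rightarrow> complex mat) \<Rightarrow> ('a \<Rightarrow> complex mat) \<Rightarrow> ennreal" where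
  "lip_mat_dist X L \<phi> \<psi> = (SUP x\<in>lip_ball X L. ennreal (op_norm (\<phi> x - \<psi> x)))"

definition admissible ::
    "'x::complex_vector op_system \<Rightarrow> ('x \<Rightarrow> ennreal) \<Rightarrow>
     'y::complex_vector op_system \<Rightarrow> ('y \<Rightarrow> ennreal) \<Rightarrow> ('x \<times> 'y \<Rightarrow> ennreal) \<Rightarrow> bool" where
  "admissible X LX Y LY L \<longleftrightarrow>
     lip_norm (os_sum X Y) L \<and>
     (\<forall>x\<in>os_sa X. LX x = (INF z\<in>{z \<in> os_sa (os_sum X Y). fst z = x}. L z)) \<and>
     (\<forall>y\<in>os_sa Y. LY y = (INF z\<in>{z \<in> os_sa (os_sum X Y). snd z = y}. L z))"

definition dist_s ::
    "'x::complex_vector op_system \<Rightarrow> ('x \<Rightarrow> ennreal) \<Rightarrow>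
     'y::complex_vector op_system \<Rightarrow> ('y \<Rightarrow> ennreal) \<Rightarrow> ennreal" where
  "dist_s X LX Y LY =
    (INF L\<in>{L. admissible X LX Y LY L}. SUP n\<in>{1..}.
      hausdorff (lip_mat_dist (os_sum X Y) L)
        ((\<lambda>\<phi>. restrict (\<phi> \<circ> fst) (os_space (os_sum X Y))) ` matrix_states X n)
        ((\<lambda>\<psi>. restrict (\<psi> \<circ> snd) (os_space (os_sum X Y))) ` matrix_states Y n))"

end

theory Submission
  imports Defs "HOL-Library.Function_Algebras" "Jordan_Normal_Form.Determinant"
begin

text \<open>
  Let \<open>h\<^sub>X\<close>, \<open>h\<^sub>Y\<close> embed \<open>X\<close> and \<open>Y\<close> in \<open>V\<close> so that the images of the Lip-balls have Hausdorff distance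
  less than \<open>\<epsilon>\<close>. Then \<open>L(x, y) = max (L\<^sub>X x, L\<^sub>Y y, \<parallel>h\<^sub>X x - h\<^sub>Y y\<parallel> / \<epsilon>)\<close> is admissible, and by Arveson's
  theorem a unital completely positive \<open>\<phi> : X \<rightarrow> M\<^sub>n\<close> extends to \<open>\<Phi> : V \<rightarrow> M\<^sub>n\<close>; its restriction to \<open>Y\<close> is at
  distance at most \<open>\<epsilon>\<close> from \<open>\<phi>\<close>. Arveson's theorem is needed for matrix algebras only, where it is Krein's
  extension theorem for positive functionals on \<open>M\<^sub>n(V)\<close>.

  Conversely, for an admissible \<open>L\<close>, the pairs \<open>(\<phi>, \<psi>)\<close> of unital completely positive maps into
  \<open>M\<^sub>n\<close> at distance at most \<open>\<epsilon>\<close> define an operator system structure on \<open>X \<oplus> Y\<close> modulo \<open>(1, -1)\<close>, by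
  evaluating \<open>\<phi>(x) + \<psi>(y)\<close>. If every \<open>\<phi>\<close> and every \<open>\<psi>\<close> occurs in some pair, then \<open>X\<close> and \<open>Y\<close> embed into
  it, because matrix states determine the order; and \<open>L(x, y) \<le> 1\<close> forces the images of \<open>x\<close> and \<open>y\<close> to be
  within \<open>\<epsilon>\<close>.
\<close>

section \<open>Extension of positive functionals\<close>

text \<open>Neither infimum need be attained, so each inequality is proved for an arbitrary
  \<epsilon> above the given distance. In the direction from embeddings to Lip-norms, the work lies
  in showing that \<open>L\<close> is a Lip-norm. A state of X \<oplus> Y restricts to each summand
  only as a multiple of a state, with a weight that may tend to 0, and the elements of a Lip-ball
  are bounded only modulo scalars. Scalars are therefore split off both coordinates. The two scalars
  stay at bounded distance from each other because a single state of \<open>V\<close> sees both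
  coordinates. In the opposite direction the delicate axiom is properness of the cones: an element
  on which all close pairs vanish must be 0. An arbitrary pair of states of X and Y has finite
  distance for the metric of \<open>L\<close>, so a small proportion of it can be mixed into a close
  pair; enough equations result to separate the points of both systems.\<close>

instantiation "fun" :: (type, real_vector) real_vector
begin

definition "r *\<^sub>R f = (\<lambda>x. r *\<^sub>R f x)"

instance
  by standard (simp_all add: scaleR_fun_def fun_eq_iff algebra_simps)

end

text \<open>Functionals are represented by their graphs. Positivity at \<open>0\<close> already makes a subspace
  of \<open>E \<times> \<real>\<close> single-valued.\<close>

definition positive_graph :: "'a::real_vector set \<Rightarrow> ('a \<times> real) set \<Rightarrow> bool" where
  "positive_graph C G \<longleftrightarrow> subspace G \<and> (\<forall>x r. (x, r) \<in> G \<longrightarrow> x \<in> C \<longrightarrow> 0 \<le> r)"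

text \<open>By homogeneity, positivity at y + t v has to be tested only for t = 1 and t = -1: divide
  by the modulus of t. These are the hypotheses \<open>lower\<close> and
  \<open>upper\<close>.\<close>

lemma positive_graph_step:
  fixes C :: "'a::real_vector set"
  assumes G: "positive_graph C G"
    and scale: "\<And>x r. x \<in> C \<Longrightarrow> 0 \<le> r \<Longrightarrow> r *\<^sub>R x \<in> C"
    and lower: "\<And>y s. (y, s) \<in> G \<Longrightarrow> y + v \<in> C \<Longrightarrow> 0 \<le> s + c"
    and upper: "\<And>y s. (y, s) \<in> G \<Longrightarrow> y - v \<in> C \<Longrightarrow> 0 \<le> s - c"
  shows "positive_graph C {g + h | g h. g \<in> G \<and> h \<in> span {(v, c)}}"
  unfolding positive_graph_def
proof (intro conjI allI impI)
  have sub: "subspace G" using G by (simp add: positive_graph_def)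
  show "subspace {g + h | g h. g \<in> G \<and> h \<in> span {(v, c)}}"
    by (rule subspace_sums[OF sub subspace_span])
  fix x r assume "(x, r) \<in> {g + h | g h. g \<in> G \<and> h \<in> span {(v, c)}}" and xC: "x \<in> C"
  then obtain y s t where ys: "(y, s) \<in> G" and z: "x = y + t *\<^sub>R v" "r = s + t * c"
    by (auto simp: span_singleton)
  have "0 \<le> s + t * c" if C: "y + t *\<^sub>R v \<in> C"
  proof (cases "t = 0")
    case True
    then show ?thesis using G ys C by (auto simp: positive_graph_def)
  next
    case False
    define q where "q = 1 / \<bar>t\<bar>"
    have q: "q > 0" using False by (simp add: q_def)
    have ys': "(q *\<^sub>R y, q * s) \<in> G"
      using subspace_scale[OF sub ys, of q] by simp
    have qC: "q *\<^sub>R y + (q * t) *\<^sub>R v \<in> C"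
      using scale[OF C, of q] q by (simp add: scaleR_add_right)
    show ?thesis
    proof (cases "t > 0")
      case True
      then have "q * t = 1" by (simp add: q_def)
      with lower[OF ys'] qC have "0 \<le> q * s + c" by simp
      then have "0 \<le> t * (q * s + c)" using True by simp
      also have "\<dots> = (q * t) * s + t * c" by (simp add: algebra_simps)
      also have "\<dots> = s + t * c" using \<open>q * t = 1\<close> by simp
      finally show ?thesis .
    next
      case t: False
      then have "q * t = -1" using False by (simp add: q_def)
      with upper[OF ys'] qC have "0 \<le> q * s - c" by simp
      then have "0 \<le> (-t) * (q * s - c)" using t by (intro mult_nonneg_nonneg) auto
      also have "\<dots> = -(q * t) * s + t * c" by (simp add: algebra_simps)
      also have "\<dots> = s + t * c" using \<open>q * t = -1\<close> by simp
      finally show ?thesis .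
    qed
  qed
  then show "0 \<le> r" using z xC by simp
qed

text \<open>Zorn's lemma gives a maximal positive graph. Cofinality bounds the admissible values at
  a further vector from both sides, so an extension by one dimension is always possible and
  maximality forces the domain to be all of \<open>S\<close>.\<close>

theorem krein_extension:
  fixes C S :: "'a::real_vector set"
  assumes S: "subspace S" and zero: "0 \<in> C"
    and add: "\<And>x y. x \<in> C \<Longrightarrow> y \<in> C \<Longrightarrow> x + y \<in> C"
    and scale: "\<And>x r. x \<in> C \<Longrightarrow> 0 \<le> r \<Longrightarrow> r *\<^sub>R x \<in> C"
    and G0: "positive_graph C G0" "fst ` G0 \<subseteq> S"
    and cofinal: "\<And>x. x \<in> S \<Longrightarrow> \<exists>(y, s)\<in>G0. y + x \<in> C"
  obtains f :: "'a \<Rightarrow> real"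
  where "\<And>x y. x \<in> S \<Longrightarrow> y \<in> S \<Longrightarrow> f (x + y) = f x + f y"
    and "\<And>x r. x \<in> S \<Longrightarrow> f (r *\<^sub>R x) = r * f x"
    and "\<And>x. x \<in> S \<Longrightarrow> x \<in> C \<Longrightarrow> 0 \<le> f x"
    and "\<And>x r. (x, r) \<in> G0 \<Longrightarrow> f x = r"
proof -
  define \<A> where "\<A> = {G. positive_graph C G \<and> G0 \<subseteq> G \<and> fst ` G \<subseteq> S}"
  have "\<exists>M\<in>\<A>. \<forall>G\<in>\<A>. M \<subseteq> G \<longrightarrow> G = M"
  proof (rule subset_Zorn_nonempty)
    show "\<A> \<noteq> {}" using G0 by (auto simp: \<A>_def)
    fix \<C> assume ne: "\<C> \<noteq> {}" and ch: "subset.chain \<A> \<C>"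
    have sub: "\<And>G. G \<in> \<C> \<Longrightarrow> G \<in> \<A>" using ch by (auto simp: subset_chain_def)
    have sp: "\<And>G. G \<in> \<C> \<Longrightarrow> subspace G" and pos: "\<And>G x r. G \<in> \<C> \<Longrightarrow> (x, r) \<in> G \<Longrightarrow> x \<in> C \<Longrightarrow> 0 \<le> r"
      and lo: "\<And>G. G \<in> \<C> \<Longrightarrow> G0 \<subseteq> G" and hi: "\<And>G. G \<in> \<C> \<Longrightarrow> fst ` G \<subseteq> S"
      using sub unfolding \<A>_def positive_graph_def by blast+
    have "subspace (\<Union>\<C>)"
      unfolding real_vector.subspace_def
    proof (intro conjI ballI allI)
      show "0 \<in> \<Union>\<C>" using ne subspace_0[OF sp] by auto
      show "r *\<^sub>R x \<in> \<Union>\<C>" if "x \<in> \<Union>\<C>" for r x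
        using that subspace_scale[OF sp] by blast
      fix x y assume "x \<in> \<Union>\<C>" "y \<in> \<Union>\<C>"
      then obtain G H where GH: "G \<in> \<C>" "H \<in> \<C>" "x \<in> G" "y \<in> H" by auto
      then obtain K where K: "K \<in> \<C>" "x \<in> K" "y \<in> K"
        using ch unfolding subset_chain_def by blast
      then have "x + y \<in> K" using subspace_add[OF sp] by blast
      then show "x + y \<in> \<Union>\<C>" using K by auto
    qed
    moreover have "\<forall>x r. (x, r) \<in> \<Union>\<C> \<longrightarrow> x \<in> C \<longrightarrow> 0 \<le> r" using pos by blast
    moreover have "G0 \<subseteq> \<Union>\<C>" using ne lo by blast
    moreover have "fst ` \<Union>\<C> \<subseteq> S" using hi by blast
    ultimately show "\<Union>\<C> \<in> \<A>" by (simp add: \<A>_def positive_graph_def)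
  qed
  then obtain M where M: "positive_graph C M" "G0 \<subseteq> M" "fst ` M \<subseteq> S"
    and max: "\<And>G. G \<in> \<A> \<Longrightarrow> M \<subseteq> G \<Longrightarrow> G = M"
    by (auto simp: \<A>_def)
  have subM: "subspace M" and pos: "\<And>x r. (x, r) \<in> M \<Longrightarrow> x \<in> C \<Longrightarrow> 0 \<le> r"
    using M by (auto simp: positive_graph_def)
  have total: "\<exists>r. (v, r) \<in> M" if v: "v \<in> S" for v
  proof -
    \<comment> \<open>The lower bounds that positivity imposes on the value at \<open>v\<close>.
      Elements y' - v of the cone impose upper bounds, and adding y + v and y' - v shows that no
      lower bound exceeds an upper one.\<close>
    define A where "A = {- s | y s. (y, s) \<in> M \<and> y + v \<in> C}"
    have ub: "a \<le> s'" if "a \<in> A" "(y', s') \<in> M" "y' - v \<in> C" for a y' s'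
    proof -
      obtain y s where ys: "a = - s" "(y, s) \<in> M" "y + v \<in> C" using \<open>a \<in> A\<close> by (auto simp: A_def)
      have "(y + y', s + s') \<in> M" using subspace_add[OF subM ys(2) that(2)] by simp
      moreover have "y + y' \<in> C" using add[OF ys(3) that(3)] by (simp add: algebra_simps)
      ultimately show ?thesis using pos ys(1) by fastforce
    qed
    have "- v \<in> S" using v S by (rule subspace_neg[rotated])
    then obtain y' s' where y': "(y', s') \<in> M" "y' - v \<in> C" using cofinal M(2) by fastforce
    have ne: "A \<noteq> {}" using cofinal[OF v] M(2) by (auto simp: A_def)
    have bdd: "bdd_above A" using ub y' by (auto simp: bdd_above_def)
    define c where "c = Sup A"
    let ?H = "{g + h | g h. g \<in> M \<and> h \<in> span {(v, c)}}"
    have "positive_graph C ?H"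
    proof (rule positive_graph_step[OF M(1) scale])
      show "0 \<le> s + c" if "(y, s) \<in> M" "y + v \<in> C" for y s
        using cSup_upper[OF _ bdd, of "- s"] that by (fastforce simp: A_def c_def)
      show "0 \<le> s - c" if "(y, s) \<in> M" "y - v \<in> C" for y s
        using cSup_least[OF ne, of s] ub that by (fastforce simp: c_def)
    qed auto
    moreover have MH: "M \<subseteq> ?H" using span_zero[of "{(v, c)}"] by (metis (mono_tags, lifting) add.right_neutral mem_Collect_eq subsetI)
    moreover have "fst ` ?H \<subseteq> S"
      using M(3) v S by (force simp: span_singleton intro!: subspace_add subspace_scale)
    ultimately have "?H = M" using max[of ?H] M(2) by (auto simp: \<A>_def)
    moreover have "(v, c) \<in> ?H"
      using subspace_0[OF subM] span_base[of "(v, c)" "{(v, c)}"]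
      by (metis (mono_tags, lifting) add.left_neutral mem_Collect_eq singletonI)
    ultimately show ?thesis by auto
  qed
  have uniq: "r = s" if "(x, r) \<in> M" "(x, s) \<in> M" for x r s
    using pos[OF _ zero, of "r - s"] pos[OF _ zero, of "s - r"]
      subspace_diff[OF subM that] subspace_diff[OF subM that(2,1)] by simp
  define f where "f x = (THE r. (x, r) \<in> M)" for x
  have f: "f x = r" if "(x, r) \<in> M" for x r
    unfolding f_def using that uniq by blast
  have fM: "(x, f x) \<in> M" if "x \<in> S" for x using total[OF that] f by auto
  show thesis
  proof (rule that)
    show "f (x + y) = f x + f y" if "x \<in> S" "y \<in> S" for x y
      using f subspace_add[OF subM fM fM, OF that] by simp
    show "f (r *\<^sub>R x) = r * f x" if "x \<in> S" for x r
      using f subspace_scale[OF subM fM, OF that, of r] by simp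
    show "0 \<le> f x" if "x \<in> S" "x \<in> C" for x using pos[OF fM] that by simp
    show "f x = r" if "(x, r) \<in> G0" for x r using f M(2) that by blast
  qed
qed

text \<open>The value at \<open>v\<close> is the smallest one compatible with positivity.\<close>

theorem krein_separation:
  fixes C S :: "'a::real_vector set"
  assumes S: "subspace S" and zero: "0 \<in> C" "e \<in> C" "e \<in> S" "v \<in> S"
    and add: "\<And>x y. x \<in> C \<Longrightarrow> y \<in> C \<Longrightarrow> x + y \<in> C"
    and scale: "\<And>x r. x \<in> C \<Longrightarrow> 0 \<le> r \<Longrightarrow> r *\<^sub>R x \<in> C"
    and unit: "\<And>x. x \<in> S \<Longrightarrow> \<exists>r. r *\<^sub>R e + x \<in> C"
    and d: "d > 0" "d *\<^sub>R e + v \<notin> C"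
  obtains f :: "'a \<Rightarrow> real"
  where "\<And>x y. x \<in> S \<Longrightarrow> y \<in> S \<Longrightarrow> f (x + y) = f x + f y"
    and "\<And>x r. x \<in> S \<Longrightarrow> f (r *\<^sub>R x) = r * f x"
    and "\<And>x. x \<in> S \<Longrightarrow> x \<in> C \<Longrightarrow> 0 \<le> f x"
    and "f e = 1" and "f v < 0"
proof -
  define G where "G = span {(e, 1::real)}"
  have G: "z \<in> G \<longleftrightarrow> (\<exists>r. z = (r *\<^sub>R e, r))" for z
    by (auto simp: G_def span_singleton)
  have up: "r' *\<^sub>R e + x \<in> C" if "r *\<^sub>R e + x \<in> C" "r \<le> r'" for r r' x
    using add[OF that(1) scale[OF zero(2), of "r' - r"]] that(2) by (simp add: algebra_simps)
  have nonneg: "0 \<le> r" if "r *\<^sub>R e \<in> C" for r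
  proof (rule ccontr)
    assume "\<not> 0 \<le> r"
    obtain s where s: "s *\<^sub>R e + v \<in> C" using unit zero by auto
    \<comment> \<open>Adding \<open>q\<close> times the negative multiple of \<open>e\<close> lowers
      the coefficient \<open>s\<close> to at most -1, hence below \<open>d\<close>.\<close>
    define q where "q = (\<bar>s\<bar> + 1) / (- r)"
    have "q \<ge> 0" using \<open>\<not> 0 \<le> r\<close> unfolding q_def by (intro divide_nonneg_pos) auto
    have qr: "q * r = - (\<bar>s\<bar> + 1)" using \<open>\<not> 0 \<le> r\<close> by (simp add: q_def)
    have "(q * r) *\<^sub>R e \<in> C" using scale[OF that \<open>q \<ge> 0\<close>] by simp
    from add[OF this s] have "(s + q * r) *\<^sub>R e + v \<in> C" by (simp add: algebra_simps)
    moreover have "s + q * r \<le> d" using qr d(1) by linarith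
    ultimately show False using up d(2) by blast
  qed
  define A where "A = {r. r *\<^sub>R e + v \<in> C}"
  have ne: "A \<noteq> {}" using unit zero(4) by (auto simp: A_def)
  have lb: "d \<le> r" if "r \<in> A" for r using up[of r v d] d(2) that by (cases "d \<le> r") (auto simp: A_def)
  have bdd: "bdd_below A" using lb by (auto simp: bdd_below_def)
  have dm: "d \<le> Inf A" using cInf_greatest[OF ne lb] .
  let ?H = "{g + h | g h. g \<in> G \<and> h \<in> span {(v, - Inf A)}}"
  have H: "positive_graph C ?H"
  proof (rule positive_graph_step[OF _ scale])
    show "positive_graph C G"
      using nonneg by (auto simp: positive_graph_def G G_def[symmetric]) (simp add: G_def)
    show "0 \<le> s + - Inf A" if "(y, s) \<in> G" "y + v \<in> C" for y s
      using cInf_lower[OF _ bdd, of s] that by (auto simp: G A_def)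
    show "0 \<le> s - - Inf A" if "(y, s) \<in> G" "y - v \<in> C" for y s
    proof -
      have y: "y = s *\<^sub>R e" using that by (auto simp: G)
      have "- s \<le> r" if "r \<in> A" for r
        using nonneg[of "r + s"] add[of "r *\<^sub>R e + v" "s *\<^sub>R e - v"] that \<open>y - v \<in> C\<close> y
        by (simp add: A_def algebra_simps)
      from cInf_greatest[OF ne this] show ?thesis by simp
    qed
  qed auto
  have GH: "G \<subseteq> ?H" using span_zero[of "{(v, - Inf A)}"] by (metis (mono_tags, lifting) add.right_neutral mem_Collect_eq subsetI)
  have eH: "(e, 1) \<in> ?H" by (rule subsetD[OF GH]) (simp add: G)
  have vH: "(v, - Inf A) \<in> ?H"
    using span_zero[of "{(e, 1)}"] span_base[of "(v, - Inf A)" "{(v, - Inf A)}"]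
    unfolding G_def by (metis (mono_tags, lifting) add.left_neutral mem_Collect_eq singletonI)
  have HS: "fst ` ?H \<subseteq> S"
    using zero S by (auto simp: G span_singleton intro!: subspace_add subspace_scale subspace_neg)
  have cof: "\<exists>(y, s)\<in>?H. y + x \<in> C" if "x \<in> S" for x
  proof -
    obtain r where "r *\<^sub>R e + x \<in> C" using unit[OF \<open>x \<in> S\<close>] by auto
    moreover have "(r *\<^sub>R e, r) \<in> ?H" by (rule subsetD[OF GH]) (simp add: G)
    ultimately show ?thesis by blast
  qed
  obtain f :: "'a \<Rightarrow> real" where f: "\<And>x y. x \<in> S \<Longrightarrow> y \<in> S \<Longrightarrow> f (x + y) = f x + f y"
    "\<And>x r. x \<in> S \<Longrightarrow> f (r *\<^sub>R x) = r * f x" "\<And>x. x \<in> S \<Longrightarrow> x \<in> C \<Longrightarrow> 0 \<le> f x"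
    "\<And>x r. (x, r) \<in> ?H \<Longrightarrow> f x = r"
  proof -
    note t = that
    show ?thesis
    proof (rule krein_extension[OF S zero(1) _ _ H HS])
      show "\<exists>(y, s)\<in>?H. y + x \<in> C" if "x \<in> S" for x by (rule cof[OF that])
      show thesis if "\<And>x y. x \<in> S \<Longrightarrow> y \<in> S \<Longrightarrow> f (x + y) = f x + f y"
        "\<And>x r. x \<in> S \<Longrightarrow> f (r *\<^sub>R x) = r * f x" "\<And>x. x \<in> S \<Longrightarrow> x \<in> C \<Longrightarrow> 0 \<le> f x"
        "\<And>x r. (x, r) \<in> ?H \<Longrightarrow> f x = r" for f
        by (rule t[of f]) (fact that)+
    qed (fact add scale)+
  qed
  show thesis using that[of f] f(1-3) f(4)[OF eH] f(4)[OF vH] dm d(1) by simp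
qed

section \<open>Matrices over an operator system\<close>

interpretation cv: vector_space "scaleC :: complex \<Rightarrow> 'a \<Rightarrow> 'a::complex_vector"
  by (rule vector_space_scaleC)

lemma mat_fun_add: "Matrix.mat n n f + Matrix.mat n n g = Matrix.mat n n (\<lambda>z. f z + g z)"
  by (rule eq_matI) auto

lemma map_mat_fun: "map_mat h (Matrix.mat n n f) = Matrix.mat n n (\<lambda>z. h (f z))"
  by (rule eq_matI) auto

lemma mat_fun_eq: "A \<in> carrier_mat n n \<Longrightarrow> Matrix.mat n n (\<lambda>z. A $$ z) = A"
  by (rule eq_matI) auto

lemma mat_fun_cong: "(\<And>i j. i < n \<Longrightarrow> j < n \<Longrightarrow> f (i, j) = g (i, j)) \<Longrightarrow>
    Matrix.mat n n f = Matrix.mat n n g"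
  by (rule eq_matI) auto

lemma mat_fun_eq_iff: "Matrix.mat n n f = Matrix.mat n n g \<longleftrightarrow>
    (\<forall>i<n. \<forall>j<n. f (i, j) = g (i, j))"
proof
  assume e: "Matrix.mat n n f = Matrix.mat n n g"
  show "\<forall>i<n. \<forall>j<n. f (i, j) = g (i, j)"
  proof (intro allI impI)
    fix i j assume "i < n" "j < n"
    then show "f (i, j) = g (i, j)" using arg_cong[OF e, of "\<lambda>A. A $$ (i, j)"] by simp
  qed
qed (blast intro: mat_fun_cong)

text \<open>Matrices are handled as functions on all index pairs, of which only the entries below
  \<open>n\<close> count. With pointwise operations these functions form a real vector space, to
  which the extension theorems apply directly.\<close>

definition mpos :: "'a op_system \<Rightarrow> nat \<Rightarrow> (nat \<times> nat \<Rightarrow> 'a) \<Rightarrow> bool" where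
  "mpos X n f \<longleftrightarrow> Matrix.mat n n f \<in> os_cone X n"

definition msa :: "'a op_system \<Rightarrow> nat \<Rightarrow> (nat \<times> nat \<Rightarrow> 'a) \<Rightarrow> bool" where
  "msa X n f \<longleftrightarrow> (\<forall>i<n. \<forall>j<n. f (i, j) \<in> os_space X \<and> os_star X (f (j, i)) = f (i, j))"

definition munit :: "'a::complex_vector op_system \<Rightarrow> nat \<times> nat \<Rightarrow> 'a" where
  "munit X = (\<lambda>(i, j). if i = j then os_unit X else 0)"

text \<open>The congruence of \<open>f\<close> by the scalar matrix \<open>a\<close> with
  \<open>n\<close> rows. The number of columns is left open, since entries are produced for all
  index pairs.\<close>

definition mcompress ::
    "nat \<Rightarrow> (nat \<Rightarrow> nat \<Rightarrow> complex) \<Rightarrow> (nat \<times> nat \<Rightarrow> 'a::complex_vector) \<Rightarrow> nat \<times> nat \<Rightarrow> 'a" where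
  "mcompress n a f = (\<lambda>(i, j). \<Sum>k<n. \<Sum>l<n. (cnj (a k i) * a l j) *\<^sub>C f (k, l))"

lemma mpos_cong:
  assumes "mpos X n f" and "\<And>i j. i < n \<Longrightarrow> j < n \<Longrightarrow> f (i, j) = g (i, j)"
  shows "mpos X n g"
  using assms mat_fun_cong[of n f g] by (simp add: mpos_def)

lemma msa_cong:
  assumes "msa X n f" and "\<And>i j. i < n \<Longrightarrow> j < n \<Longrightarrow> f (i, j) = g (i, j)"
  shows "msa X n g"
  using assms by (simp add: msa_def)

lemma msa_iff: "Matrix.mat n n f \<in> os_mats_sa X n \<longleftrightarrow> msa X n f"
proof -
  have "Matrix.mat n n f \<in> os_mats X n \<longleftrightarrow> (\<forall>i<n. \<forall>j<n. f (i, j) \<in> os_space X)"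
    by (force simp: os_mats_def elements_mat_def)
  moreover have "os_adjoint X (Matrix.mat n n f) = Matrix.mat n n (\<lambda>(i, j). os_star X (f (j, i)))"
    by (rule eq_matI) (simp_all add: os_adjoint_def)
  then have "os_adjoint X (Matrix.mat n n f) = Matrix.mat n n f \<longleftrightarrow>
      (\<forall>i<n. \<forall>j<n. os_star X (f (j, i)) = f (i, j))"
    by (simp add: mat_fun_eq_iff)
  ultimately show ?thesis unfolding os_mats_sa_def msa_def by blast
qed

context operator_system
begin

lemma space_zero: "0 \<in> os_space X"
  and space_add: "x \<in> os_space X \<Longrightarrow> y \<in> os_space X \<Longrightarrow> x + y \<in> os_space X"
  and space_scaleC: "x \<in> os_space X \<Longrightarrow> c *\<^sub>C x \<in> os_space X"
  using cv.subspace_0[OF subspace] cv.subspace_add[OF subspace] cv.subspace_scale[OF subspace]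
  by blast+

lemma space_scaleR: "x \<in> os_space X \<Longrightarrow> r *\<^sub>R x \<in> os_space X"
  by (simp add: scaleR_scaleC space_scaleC)

lemma space_minus: "x \<in> os_space X \<Longrightarrow> - x \<in> os_space X"
  using space_scaleR[of x "-1"] by simp

lemma space_diff: "x \<in> os_space X \<Longrightarrow> y \<in> os_space X \<Longrightarrow> x - y \<in> os_space X"
  using space_add[of x "- y"] space_minus by simp

lemma space_sum: "(\<And>i. i \<in> I \<Longrightarrow> f i \<in> os_space X) \<Longrightarrow> sum f I \<in> os_space X"
  by (rule cv.subspace_sum[OF subspace])

lemma star_scaleR: "x \<in> os_space X \<Longrightarrow> os_star X (r *\<^sub>R x) = r *\<^sub>R os_star X x"
  by (simp add: scaleR_scaleC star_scaleC)

lemma star_zero: "os_star X 0 = 0"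
  using star_scaleR[OF space_zero, of 0] by simp

lemma star_minus: "x \<in> os_space X \<Longrightarrow> os_star X (- x) = - os_star X x"
  using star_scaleR[of x "-1"] by simp

lemma star_diff: "x \<in> os_space X \<Longrightarrow> y \<in> os_space X \<Longrightarrow>
    os_star X (x - y) = os_star X x - os_star X y"
  using star_add[of x "- y"] star_minus[of y] space_minus[of y] by simp

lemma sa_space: "x \<in> os_sa X \<Longrightarrow> x \<in> os_space X"
  and sa_star: "x \<in> os_sa X \<Longrightarrow> os_star X x = x"
  by (simp_all add: os_sa_def)

lemma sa_zero: "0 \<in> os_sa X"
  by (simp add: os_sa_def space_zero star_zero)

lemma sa_unit: "os_unit X \<in> os_sa X"
  by (simp add: os_sa_def unit_closed star_unit)

lemma sa_add: "x \<in> os_sa X \<Longrightarrow> y \<in> os_sa X \<Longrightarrow> x + y \<in> os_sa X"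
  by (simp add: os_sa_def space_add star_add)

lemma sa_scaleR: "x \<in> os_sa X \<Longrightarrow> r *\<^sub>R x \<in> os_sa X"
  by (simp add: os_sa_def space_scaleR star_scaleR)

lemma sa_minus: "x \<in> os_sa X \<Longrightarrow> - x \<in> os_sa X"
  using sa_scaleR[of x "-1"] by simp

lemma sa_diff: "x \<in> os_sa X \<Longrightarrow> y \<in> os_sa X \<Longrightarrow> x - y \<in> os_sa X"
  using sa_add[of x "- y"] sa_minus by simp

lemma cartesian_decomposition:
  assumes "x \<in> os_space X"
  obtains a b where "a \<in> os_sa X" "b \<in> os_sa X" "x = a + \<i> *\<^sub>C b"
proof -
  define a where "a = (1/2) *\<^sub>C (x + os_star X x)"
  define b where "b = (- \<i>/2) *\<^sub>C (x - os_star X x)"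
  have "a \<in> os_sa X" "b \<in> os_sa X"
    using assms by (auto simp: a_def b_def os_sa_def space_scaleC space_add space_diff star_closed
        star_scaleC star_add star_diff star_star add.commute
        simp flip: cv.scale_minus_right)
  moreover have "a + \<i> *\<^sub>C b = x"
  proof -
    have "a + \<i> *\<^sub>C b = (1/2 + 1/2) *\<^sub>C x + (1/2 - 1/2) *\<^sub>C os_star X x"
      unfolding scaleC_add_left cv.scale_left_diff_distrib
      by (simp add: a_def b_def scaleC_add_right cv.scale_right_diff_distrib scaleC_scaleC)
    then show ?thesis by simp
  qed
  ultimately show thesis using that by metis
qed

lemma mpos_msa: "mpos X n f \<Longrightarrow> msa X n f"
  using cone_sa[of n] msa_iff[of n f X] by (auto simp: mpos_def)

lemma mpos_add: "mpos X n f \<Longrightarrow> mpos X n g \<Longrightarrow> mpos X n (\<lambda>z. f z + g z)"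
  using cone_add[of "Matrix.mat n n f" n "Matrix.mat n n g"] by (simp add: mpos_def mat_fun_add)

lemma mpos_scaleR: "mpos X n f \<Longrightarrow> 0 \<le> r \<Longrightarrow> mpos X n (\<lambda>z. r *\<^sub>R f z)"
  using cone_scaleR[of "Matrix.mat n n f" n r] by (simp add: mpos_def map_mat_fun)

lemma mpos_proper:
  assumes "mpos X n f" "mpos X n (\<lambda>z. - f z)" "i < n" "j < n"
  shows "f (i, j) = 0"
proof -
  have "Matrix.mat n n (\<lambda>z. - f z) = - Matrix.mat n n f"
    by (rule eq_matI) auto
  then have "Matrix.mat n n f = 0\<^sub>m n n"
    using cone_proper[of "Matrix.mat n n f" n] assms(1,2) by (simp add: mpos_def)
  then show ?thesis using assms(3,4) by (metis index_mat(1) index_zero_mat(1))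
qed

lemma mpos_compress: "mpos X n f \<Longrightarrow> mpos X m (mcompress n a f)"
proof -
  assume f: "mpos X n f"
  let ?\<alpha> = "Matrix.mat n m (\<lambda>(k, i). a k i)"
  have "compress ?\<alpha> (Matrix.mat n n f) = Matrix.mat m m (mcompress n a f)"
    by (rule eq_matI) (auto simp: compress_def mcompress_def intro!: sum.cong)
  then show ?thesis using f cone_compress[of "Matrix.mat n n f" n ?\<alpha> m] by (simp add: mpos_def)
qed

lemma mat_scalar: "os_scalar X n r + Matrix.mat n n f = Matrix.mat n n (\<lambda>z. r *\<^sub>R munit X z + f z)"
  by (rule eq_matI) (auto simp: os_scalar_def munit_def)

lemma mpos_order_unit: "msa X n f \<Longrightarrow> \<exists>r>0. mpos X n (\<lambda>z. r *\<^sub>R munit X z + f z)"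
  using order_unit[of "Matrix.mat n n f" n] by (simp add: msa_iff mpos_def mat_scalar)

lemma mpos_archimedean:
  "msa X n f \<Longrightarrow> (\<And>r. r > 0 \<Longrightarrow> mpos X n (\<lambda>z. r *\<^sub>R munit X z + f z)) \<Longrightarrow> mpos X n f"
  using archimedean[of "Matrix.mat n n f" n] by (simp add: msa_iff mpos_def mat_scalar)

lemma msa_zero: "msa X n (\<lambda>_. 0)"
  by (simp add: msa_def space_zero star_zero)

lemma msa_add: "msa X n f \<Longrightarrow> msa X n g \<Longrightarrow> msa X n (\<lambda>z. f z + g z)"
  by (simp add: msa_def space_add star_add)

lemma msa_scaleR: "msa X n f \<Longrightarrow> msa X n (\<lambda>z. r *\<^sub>R f z)"
  by (simp add: msa_def space_scaleR star_scaleR)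

lemma msa_munit: "msa X n (munit X)"
  by (simp add: msa_def munit_def unit_closed space_zero star_unit star_zero)

lemma mpos_munit: "mpos X n (munit X)"
proof -
  obtain r where r: "r > 0" "mpos X n (\<lambda>z. r *\<^sub>R munit X z)"
    using mpos_order_unit[OF msa_zero] by auto
  then show ?thesis using mpos_scaleR[OF r(2), of "1/r"] by simp
qed

lemma mpos_zero: "mpos X n (\<lambda>_. 0)"
  using mpos_scaleR[OF mpos_munit, of 0] by simp

lemma pos_iff: "x \<in> os_pos X \<longleftrightarrow> mpos X 1 (\<lambda>_. x)"
  by (simp add: os_pos_def mpos_def)

lemma pos_sa: "x \<in> os_pos X \<Longrightarrow> x \<in> os_sa X"
  using mpos_msa[of 1 "\<lambda>_. x"] by (simp add: pos_iff msa_def os_sa_def)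

lemma pos_add: "x \<in> os_pos X \<Longrightarrow> y \<in> os_pos X \<Longrightarrow> x + y \<in> os_pos X"
  unfolding pos_iff by (rule mpos_add)

lemma pos_scaleR: "x \<in> os_pos X \<Longrightarrow> 0 \<le> r \<Longrightarrow> r *\<^sub>R x \<in> os_pos X"
  unfolding pos_iff by (rule mpos_scaleR)

lemma pos_proper: "x \<in> os_pos X \<Longrightarrow> - x \<in> os_pos X \<Longrightarrow> x = 0"
  unfolding pos_iff using mpos_proper[of 1 "\<lambda>_. x" 0 0] by simp

lemma pos_unit: "os_unit X \<in> os_pos X"
  unfolding pos_iff by (rule mpos_cong[OF mpos_munit]) (simp add: munit_def)

lemma pos_order_unit: "x \<in> os_sa X \<Longrightarrow> \<exists>r>0. r *\<^sub>R os_unit X + x \<in> os_pos X"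
proof -
  assume "x \<in> os_sa X"
  then have "msa X 1 (\<lambda>_. x)" by (simp add: msa_def os_sa_def)
  from mpos_order_unit[OF this] obtain r where
    "r > 0" "mpos X 1 (\<lambda>z. r *\<^sub>R munit X z + x)" by auto
  then show ?thesis unfolding pos_iff
    by (intro exI[of _ r] conjI mpos_cong[OF \<open>mpos X 1 _\<close>]) (auto simp: munit_def)
qed

lemma pos_archimedean:
  assumes x: "x \<in> os_sa X" and r: "\<And>r. r > 0 \<Longrightarrow> r *\<^sub>R os_unit X + x \<in> os_pos X"
  shows "x \<in> os_pos X"
  unfolding pos_iff
proof (rule mpos_archimedean)
  show "msa X 1 (\<lambda>_. x)" using x by (simp add: msa_def os_sa_def)
  show "mpos X 1 (\<lambda>z. r *\<^sub>R munit X z + x)" if "r > 0" for r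
    by (rule mpos_cong[OF r[OF that, unfolded pos_iff]]) (simp add: munit_def)
qed

lemma pos_mono_unit:
  assumes "r *\<^sub>R os_unit X + x \<in> os_pos X" "r \<le> s"
  shows "s *\<^sub>R os_unit X + x \<in> os_pos X"
  using pos_add[OF assms(1) pos_scaleR[OF pos_unit, of "s - r"]] assms(2)
  by (simp add: algebra_simps)

lemma pos_scalar_iff:
  assumes "os_unit X \<noteq> 0" shows "r *\<^sub>R os_unit X \<in> os_pos X \<longleftrightarrow> 0 \<le> r"
proof
  assume a: "r *\<^sub>R os_unit X \<in> os_pos X"
  show "0 \<le> r"
  proof (rule ccontr)
    assume "\<not> 0 \<le> r"
    then have "- (r *\<^sub>R os_unit X) \<in> os_pos X"
      using pos_scaleR[OF pos_unit, of "- r"] by simp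
    from pos_proper[OF a this] show False using \<open>\<not> 0 \<le> r\<close> assms by simp
  qed
qed (simp add: pos_scaleR pos_unit)

text \<open>If the order unit is 0, then every self-adjoint element and its negative are positive,
  hence 0 by properness.\<close>

lemma trivial_space: "os_unit X = 0 \<Longrightarrow> os_space X = {0}"
proof -
  assume u: "os_unit X = 0"
  have sa: "x = 0" if x: "x \<in> os_sa X" for x
    using pos_order_unit[OF x] pos_order_unit[OF sa_minus[OF x]] pos_proper[of x] u by auto
  have "x = 0" if "x \<in> os_space X" for x
    using that by (rule cartesian_decomposition) (auto dest!: sa)
  then show ?thesis using space_zero by auto
qed

section \<open>The order norm on self-adjoint elements\<close>

definition bounded_by :: "real \<Rightarrow> 'a \<Rightarrow> bool" where
  "bounded_by t x \<longleftrightarrow> t *\<^sub>R os_unit X + x \<in> os_pos X \<and> t *\<^sub>R os_unit X - x \<in> os_pos X"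

text \<open>Compressing the 2 by 2 matrix by the columns (1, 1) and (1, -1) gives twice t1 + x and
  t1 - x. Conversely the matrix is half the sum of the congruences of t1 + x and t1 - x by the rows
  (1, 1) and (1, -1).\<close>

lemma norm_matrix_iff:
  assumes x: "x \<in> os_sa X"
  shows "mat_of_rows_list 2 [[t *\<^sub>R os_unit X, x], [os_star X x, t *\<^sub>R os_unit X]] \<in> os_cone X 2
    \<longleftrightarrow> bounded_by t x"
proof -
  define f where "f = (\<lambda>(i::nat, j::nat). if i = j then t *\<^sub>R os_unit X else x)"
  have "mat_of_rows_list 2 [[t *\<^sub>R os_unit X, x], [os_star X x, t *\<^sub>R os_unit X]] = Matrix.mat 2 2 f"
    by (rule eq_matI) (auto simp: mat_of_rows_list_def f_def less_2_cases_iff sa_star[OF x])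
  then have "mat_of_rows_list 2 [[t *\<^sub>R os_unit X, x], [os_star X x, t *\<^sub>R os_unit X]] \<in> os_cone X 2
      \<longleftrightarrow> mpos X 2 f" by (simp add: mpos_def)
  also have "\<dots> \<longleftrightarrow> bounded_by t x"
  proof
    assume f: "mpos X 2 f"
    have "t *\<^sub>R os_unit X + e *\<^sub>R x \<in> os_pos X" if e: "e = 1 \<or> e = - 1" for e :: real
    proof -
      define a where "a = (\<lambda>(k::nat) (i::nat). if k = 0 then 1 else complex_of_real e)"
      have "mcompress 2 a f (0, 0) = (t *\<^sub>R os_unit X + e *\<^sub>R x) + (t *\<^sub>R os_unit X + e *\<^sub>R x)"
        using e by (auto simp: mcompress_def a_def f_def numeral_2_eq_2 scaleC_one algebra_simps)
      then have "mcompress 2 a f (0, 0) = 2 *\<^sub>R (t *\<^sub>R os_unit X + e *\<^sub>R x)"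
        by (simp add: scaleR_2)
      then have "2 *\<^sub>R (t *\<^sub>R os_unit X + e *\<^sub>R x) \<in> os_pos X"
        unfolding pos_iff by (intro mpos_cong[OF mpos_compress[OF f]]) auto
      from pos_scaleR[OF this, of "1/2"] show ?thesis by simp
    qed
    from this[of 1] this[of "-1"] show "bounded_by t x" by (simp add: bounded_by_def)
  next
    assume b: "bounded_by t x"
    define a where "a = (\<lambda>(e::real) (k::nat) (i::nat). if i = 0 then 1 else complex_of_real e)"
    have p: "mpos X 2 (mcompress 1 (a 1) (\<lambda>_. t *\<^sub>R os_unit X + x))"
      "mpos X 2 (mcompress 1 (a (-1)) (\<lambda>_. t *\<^sub>R os_unit X - x))"
      using b by (auto intro!: mpos_compress simp: bounded_by_def pos_iff)
    show "mpos X 2 f"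
    proof (rule mpos_cong[OF mpos_scaleR[OF mpos_add[OF p], of "1/2"]])
      fix i j :: nat assume "i < 2" "j < 2"
      then have "i = 0 \<or> i = 1" "j = 0 \<or> j = 1" by auto
      then have "mcompress 1 (a 1) (\<lambda>_. t *\<^sub>R os_unit X + x) (i, j)
          + mcompress 1 (a (-1)) (\<lambda>_. t *\<^sub>R os_unit X - x) (i, j) = f (i, j) + f (i, j)"
        by (auto simp: mcompress_def a_def f_def scaleC_one)
      then show "(1/2) *\<^sub>R (mcompress 1 (a 1) (\<lambda>_. t *\<^sub>R os_unit X + x) (i, j)
          + mcompress 1 (a (-1)) (\<lambda>_. t *\<^sub>R os_unit X - x) (i, j)) = f (i, j)"
        by simp
    qed simp
  qed
  finally show ?thesis .
qed

lemma os_norm_sa: "x \<in> os_sa X \<Longrightarrow> os_norm X x = Inf {t. 0 \<le> t \<and> bounded_by t x}"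
  unfolding os_norm_def using norm_matrix_iff by simp

lemma bounded_by_mono: "bounded_by s x \<Longrightarrow> s \<le> t \<Longrightarrow> bounded_by t x"
  using pos_mono_unit[of s x t] pos_mono_unit[of s "- x" t] by (simp add: bounded_by_def)

lemma bounded_by_exists: "x \<in> os_sa X \<Longrightarrow> \<exists>t\<ge>0. bounded_by t x"
proof -
  assume x: "x \<in> os_sa X"
  obtain r s where r: "r > 0" "r *\<^sub>R os_unit X + x \<in> os_pos X"
    and s: "s > 0" "s *\<^sub>R os_unit X + - x \<in> os_pos X"
    using pos_order_unit[OF x] pos_order_unit[OF sa_minus[OF x]] by auto
  then have "bounded_by (max r s) x"
    using pos_mono_unit[OF r(2), of "max r s"] pos_mono_unit[OF s(2), of "max r s"]
    by (simp add: bounded_by_def)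
  then show ?thesis using r(1) by (intro exI[of _ "max r s"]) auto
qed

lemma os_norm_le: "x \<in> os_sa X \<Longrightarrow> 0 \<le> t \<Longrightarrow> bounded_by t x \<Longrightarrow> os_norm X x \<le> t"
  unfolding os_norm_sa by (rule cInf_lower) (auto simp: bdd_below_def)

lemma os_norm_nonneg: "x \<in> os_sa X \<Longrightarrow> 0 \<le> os_norm X x"
  unfolding os_norm_sa using bounded_by_exists by (intro cInf_greatest) auto

text \<open>The infimum that defines the norm is attained; this is where the Archimedean property
  enters.\<close>

lemma bounded_by_norm:
  assumes x: "x \<in> os_sa X" and t: "os_norm X x \<le> t"
  shows "bounded_by t x"
proof -
  have *: "bounded_by s x" if s: "t < s" for s
  proof -
    have "Inf {t. 0 \<le> t \<and> bounded_by t x} < s" using t s os_norm_sa[OF x] by simp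
    then obtain r where "bounded_by r x" "r < s"
      using cInf_lessD[of "{t. 0 \<le> t \<and> bounded_by t x}" s] bounded_by_exists[OF x] by auto
    then show ?thesis using bounded_by_mono by auto
  qed
  have "t *\<^sub>R os_unit X + y \<in> os_pos X" if y: "y \<in> os_sa X" "\<And>s. t < s \<Longrightarrow> s *\<^sub>R os_unit X + y \<in> os_pos X" for y
  proof (rule pos_archimedean)
    show "t *\<^sub>R os_unit X + y \<in> os_sa X" using y(1) by (intro sa_add sa_scaleR sa_unit)
    show "r *\<^sub>R os_unit X + (t *\<^sub>R os_unit X + y) \<in> os_pos X" if "r > 0" for r
      using y(2)[of "r + t"] that by (simp add: algebra_simps)
  qed
  from this[of x] this[of "- x"] * x sa_minus[OF x] show ?thesis by (simp add: bounded_by_def)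
qed

lemma os_norm_triangle:
  assumes "x \<in> os_sa X" "y \<in> os_sa X" shows "os_norm X (x + y) \<le> os_norm X x + os_norm X y"
proof (rule os_norm_le)
  have "bounded_by (os_norm X x) x" "bounded_by (os_norm X y) y" using assms bounded_by_norm by auto
  then show "bounded_by (os_norm X x + os_norm X y) (x + y)"
    using pos_add[of "os_norm X x *\<^sub>R os_unit X + x" "os_norm X y *\<^sub>R os_unit X + y"]
      pos_add[of "os_norm X x *\<^sub>R os_unit X - x" "os_norm X y *\<^sub>R os_unit X - y"]
    by (simp add: bounded_by_def algebra_simps)
qed (use assms in \<open>auto intro: sa_add add_nonneg_nonneg os_norm_nonneg\<close>)

lemma os_norm_scaleR_le:
  assumes x: "x \<in> os_sa X" shows "os_norm X (r *\<^sub>R x) \<le> \<bar>r\<bar> * os_norm X x"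
proof (rule os_norm_le)
  have b: "bounded_by (os_norm X x) x" using x bounded_by_norm by auto
  then show "bounded_by (\<bar>r\<bar> * os_norm X x) (r *\<^sub>R x)"
    using pos_scaleR[of "os_norm X x *\<^sub>R os_unit X + x" "\<bar>r\<bar>"]
      pos_scaleR[of "os_norm X x *\<^sub>R os_unit X - x" "\<bar>r\<bar>"]
    by (cases "r \<ge> 0") (auto simp: bounded_by_def scaleR_add_right scaleR_diff_right)
qed (use x os_norm_nonneg in \<open>auto intro: sa_scaleR\<close>)

lemma os_norm_scaleR:
  assumes x: "x \<in> os_sa X" shows "os_norm X (r *\<^sub>R x) = \<bar>r\<bar> * os_norm X x"
proof (cases "r = 0")
  case True
  have "os_norm X 0 = 0"
    using os_norm_scaleR_le[OF sa_zero, of 0] os_norm_nonneg[OF sa_zero] by simp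
  then show ?thesis using True by simp
next
  case False
  have "os_norm X x \<le> \<bar>1 / r\<bar> * os_norm X (r *\<^sub>R x)"
    using os_norm_scaleR_le[OF sa_scaleR[OF x, of r], of "1/r"] False by simp
  then have "\<bar>r\<bar> * os_norm X x \<le> os_norm X (r *\<^sub>R x)"
    using False by (simp add: field_simps abs_divide)
  then show ?thesis using os_norm_scaleR_le[OF x, of r] by simp
qed

lemma os_norm_zero: "os_norm X 0 = 0"
  using os_norm_scaleR[OF sa_zero, of 0] by simp

lemma os_norm_minus: "x \<in> os_sa X \<Longrightarrow> os_norm X (- x) = os_norm X x"
  using os_norm_scaleR[of x "-1"] by simp

end

section \<open>Sesquilinear forms\<close>

definition sform :: "nat \<Rightarrow> (nat \<Rightarrow> nat \<Rightarrow> complex) \<Rightarrow> (nat \<Rightarrow> complex) \<Rightarrow> (nat \<Rightarrow> complex) \<Rightarrow> complex" where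
  "sform n M u w = (\<Sum>i<n. \<Sum>j<n. cnj (u i) * w j * M i j)"

lemma sform_add_left: "sform n M (\<lambda>i. u i + u' i) w = sform n M u w + sform n M u' w"
  by (simp add: sform_def algebra_simps sum.distrib)

lemma sform_add_right: "sform n M u (\<lambda>i. w i + w' i) = sform n M u w + sform n M u w'"
  by (simp add: sform_def algebra_simps sum.distrib)

lemma sform_scale_left: "sform n M (\<lambda>i. c * u i) w = cnj c * sform n M u w"
  by (simp add: sform_def sum_distrib_left mult.assoc)

lemma sform_scale_right: "sform n M u (\<lambda>i. c * w i) = c * sform n M u w"
  by (simp add: sform_def sum_distrib_left mult.assoc mult.left_commute)

lemma sform_sum_left: "sform n M (\<lambda>i. \<Sum>a\<in>A. F a i) w = (\<Sum>a\<in>A. sform n M (F a) w)"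
proof (induction A rule: infinite_finite_induct)
  case (insert a A)
  then show ?case using sform_add_left[of n M "F a"] by simp
qed (simp_all add: sform_def)

lemma sform_sum_right: "sform n M u (\<lambda>i. \<Sum>a\<in>A. F a i) = (\<Sum>a\<in>A. sform n M u (F a))"
proof (induction A rule: infinite_finite_induct)
  case (insert a A)
  then show ?case using sform_add_right[of n M u "F a"] by simp
qed (simp_all add: sform_def)

definition std :: "nat \<Rightarrow> nat \<Rightarrow> complex" where
  "std i = (\<lambda>l. if l = i then 1 else 0)"

lemma sform_std_right: "j < n \<Longrightarrow> sform n M u (std j) = (\<Sum>i<n. cnj (u i) * M i j)"
  unfolding sform_def std_def by (intro sum.cong refl) (subst sum.remove[of _ j], auto)

lemma sform_std: "i < n \<Longrightarrow> j < n \<Longrightarrow> sform n M (std i) (std j) = M i j"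
  by (simp add: sform_std_right) (subst sum.remove[of _ i], auto simp: std_def)

text \<open>Polarisation: reality of the form at u + w controls the imaginary part, and at u + \<i>
  w the real part.\<close>

lemma sform_hermitian:
  assumes "\<And>u. Im (sform n M u u) = 0"
  shows "sform n M w u = cnj (sform n M u w)"
proof -
  have "Im (sform n M u w + sform n M w u) = 0"
    using assms[of "\<lambda>i. u i + w i"] assms[of u] assms[of w]
    by (simp add: sform_add_left sform_add_right)
  moreover have "Re (sform n M u w - sform n M w u) = 0"
    using assms[of "\<lambda>i. u i + \<i> * w i"] assms[of u] assms[of w]
    by (simp add: sform_add_left sform_add_right sform_scale_left sform_scale_right)
  ultimately show ?thesis by (simp add: complex_eq_iff)
qed

text \<open>Gram-Schmidt for the form \<open>M\<close>. The vectors are triangular, so that the next basis vector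
  is never in their span.\<close>

lemma gram_schmidt_form:
  assumes pos: "\<And>u. 0 \<le> sform n M u u"
    and def: "\<And>u. sform n M u u = 0 \<Longrightarrow> \<forall>i<n. u i = 0"
    and m: "m \<le> n"
  shows "\<exists>d. \<forall>i<m. (\<forall>k. i < k \<longrightarrow> d i k = 0) \<and>
    (\<forall>j<m. sform n M (d i) (d j) = (if i = j then 1 else 0))"
  using m
proof (induction m)
  case (Suc m)
  then obtain d where d0: "\<And>i k. i < m \<Longrightarrow> i < k \<Longrightarrow> d i k = 0"
    and d: "\<And>i j. i < m \<Longrightarrow> j < m \<Longrightarrow> sform n M (d i) (d j) = (if i = j then 1 else 0)"
    by auto
  have herm: "sform n M w u = cnj (sform n M u w)" for u w
    by (rule sform_hermitian) (use pos in \<open>simp add: less_eq_complex_def\<close>)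
  define b where "b i = sform n M (d i) (std m)" for i
  define v where "v = (\<lambda>k. std m k + (\<Sum>i<m. - b i * d i k))"
  have orth: "sform n M (d j) v = 0" if "j < m" for j
  proof -
    have "sform n M (d j) v = b j + (\<Sum>i<m. - b i * sform n M (d j) (d i))"
      unfolding v_def sform_add_right sform_sum_right sform_scale_right b_def ..
    also have "(\<Sum>i<m. - b i * sform n M (d j) (d i)) = (\<Sum>i<m. if i = j then - b i else 0)"
      using that d by (intro sum.cong) auto
    finally show ?thesis using that by simp
  qed
  have vm: "v m = 1" using d0 by (simp add: v_def std_def)
  have v0: "v k = 0" if "m < k" for k using d0 that by (simp add: v_def std_def)
  define N where "N = Re (sform n M v v)"
  have N: "sform n M v v = of_real N" using pos[of v] by (simp add: N_def complex_eq_iff less_eq_complex_def)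
  have "sform n M v v \<noteq> 0" using def[of v] vm Suc.prems by force
  then have Npos: "N > 0" using pos[of v] N by (simp add: less_eq_complex_def)
  define s where "s = complex_of_real (1 / sqrt N)"
  have s: "cnj s * (s * of_real N) = 1"
    using Npos by (simp add: s_def flip: of_real_mult)
  define d' where "d' = d(m := (\<lambda>k. s * v k))"
  have "sform n M (d' i) (d' j) = (if i = j then 1 else 0)" if "i < Suc m" "j < Suc m" for i j
    using that d orth herm[of v "d i"] herm[of v "d j"] s N
    by (auto simp: d'_def less_Suc_eq sform_scale_left sform_scale_right)
  moreover have "d' i k = 0" if "i < Suc m" "i < k" for i k
    using that d0 v0 by (auto simp: d'_def less_Suc_eq)
  ultimately show ?case by blast
qed simp

text \<open>Let D be the matrix whose columns are the orthonormal vectors \<open>d i\<close>, and E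
  the product of its adjoint with \<open>M\<close>. Orthonormality says E D = 1, and for square
  matrices this gives D E = 1. The second conclusion thus expands the standard basis in the vectors
  \<open>d i\<close>.\<close>

lemma positive_definite_congruence:
  assumes pos: "\<And>u. 0 \<le> sform n M u u"
    and def: "\<And>u. sform n M u u = 0 \<Longrightarrow> \<forall>i<n. u i = 0"
  obtains d e where "\<And>i j. i < n \<Longrightarrow> j < n \<Longrightarrow> sform n M (d i) (d j) = (if i = j then 1 else 0)"
    and "\<And>a p. a < n \<Longrightarrow> p < n \<Longrightarrow> (\<Sum>i<n. d i a * e i p) = (if a = p then 1 else (0::complex))"
proof -
  obtain d where d: "\<And>i j. i < n \<Longrightarrow> j < n \<Longrightarrow> sform n M (d i) (d j) = (if i = j then 1 else 0)"
    using gram_schmidt_form[OF pos def order_refl] by blast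
  define e where "e i p = (\<Sum>b<n. cnj (d i b) * M b p)" for i p
  define D where "D = Matrix.mat n n (\<lambda>(a, i). d i a)"
  define E where "E = Matrix.mat n n (\<lambda>(i, p). e i p)"
  have "E * D = 1\<^sub>m n"
  proof (rule eq_matI)
    fix i j assume "i < dim_row (1\<^sub>m n :: complex mat)" "j < dim_col (1\<^sub>m n :: complex mat)"
    then have ij: "i < n" "j < n" by auto
    have "(E * D) $$ (i, j) = (\<Sum>a<n. (\<Sum>b<n. cnj (d i b) * M b a) * d j a)"
      using ij by (simp add: E_def D_def scalar_prod_def e_def atLeast0LessThan)
    also have "\<dots> = sform n M (d i) (d j)"
      unfolding sform_def sum_distrib_right by (subst sum.swap) (simp add: mult_ac)
    finally show "(E * D) $$ (i, j) = 1\<^sub>m n $$ (i, j)" using d ij by simp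
  qed (auto simp: E_def D_def)
  then have DE: "D * E = 1\<^sub>m n"
    by (rule mat_mult_left_right_inverse[rotated 2]) (auto simp: E_def D_def)
  have "(\<Sum>i<n. d i a * e i p) = (if a = p then 1 else 0)" if "a < n" "p < n" for a p
    using arg_cong[OF DE, of "\<lambda>A. A $$ (a, p)"] that
    by (simp add: E_def D_def scalar_prod_def atLeast0LessThan)
  with d show thesis using that by blast
qed

lemma sum_div_mod: "(\<Sum>a<k * n. g (a div n) (a mod n)) = (\<Sum>p<k. \<Sum>i<n. g p (i::nat))"
proof -
  have "(\<Sum>a<k * n. g (a div n) (a mod n)) = (\<Sum>p<k. \<Sum>a\<in>{p * n..<p * n + n}. g (a div n) (a mod n))"
    by (rule sum.nat_group[symmetric])
  also have "\<dots> = (\<Sum>p<k. \<Sum>i<n. g p i)"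
  proof (rule sum.cong[OF refl])
    fix p
    have "(\<Sum>a\<in>{p * n..<p * n + n}. g (a div n) (a mod n))
        = (\<Sum>i\<in>{0..<n}. g ((i + p * n) div n) ((i + p * n) mod n))"
      using sum.shift_bounds_nat_ivl[of "\<lambda>a. g (a div n) (a mod n)" 0 "p * n" n]
      by (simp add: add.commute)
    also have "\<dots> = (\<Sum>i<n. g p i)"
      by (intro sum.cong) (auto simp: atLeast0LessThan)
    finally show "(\<Sum>a\<in>{p * n..<p * n + n}. g (a div n) (a mod n)) = (\<Sum>i<n. g p i)" .
  qed
  finally show ?thesis .
qed

section \<open>Completely positive maps into matrix algebras\<close>

text \<open>The quadratic form of the block matrix with blocks \<open>\<phi> (f (p, q))\<close>, at
  the vector with blocks \<open>v p\<close>.\<close>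

definition mform ::
    "nat \<Rightarrow> nat \<Rightarrow> ('a \<Rightarrow> complex mat) \<Rightarrow> (nat \<times> nat \<Rightarrow> 'a) \<Rightarrow> (nat \<Rightarrow> nat \<Rightarrow> complex) \<Rightarrow> complex" where
  "mform k n \<phi> f v = (\<Sum>p<k. \<Sum>q<k. \<Sum>i<n. \<Sum>j<n. cnj (v p i) * v q j * \<phi> (f (p, q)) $$ (i, j))"

text \<open>A flat index a stands for the pair (a div n, a mod n). The lemma removes this coding
  once and for all: complete positivity is expressed by \<open>mform\<close> from here on.\<close>

lemma psd_flatten_iff:
  "psd (flatten k n (map_mat \<phi> (Matrix.mat k k f))) \<longleftrightarrow> (\<forall>v. 0 \<le> mform k n \<phi> f v)"
proof -
  define A where "A = flatten k n (map_mat \<phi> (Matrix.mat k k f))"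
  have A: "A \<in> carrier_mat (k * n) (k * n)" by (simp add: A_def flatten_def)
  have form: "(A *\<^sub>v w) \<bullet>c w = mform k n \<phi> f v"
    if w: "w \<in> carrier_vec (k * n)" and v: "\<And>a. a < k * n \<Longrightarrow> vec_index w a = v (a div n) (a mod n)" for w v
  proof -
    have "(A *\<^sub>v w) \<bullet>c w = (\<Sum>a<k * n. (\<Sum>b<k * n. A $$ (a, b) * vec_index w b) * cnj (vec_index w a))"
      using A w by (simp add: scalar_prod_def atLeast0LessThan row_def)
    also have "\<dots> = (\<Sum>a<k * n. \<Sum>b<k * n. cnj (v (a div n) (a mod n)) * v (b div n) (b mod n)
        * \<phi> (f (a div n, b div n)) $$ (a mod n, b mod n))"
    proof (intro sum.cong refl)
      fix a assume a: "a \<in> {..<k * n}"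
      have "A $$ (a, b) = \<phi> (f (a div n, b div n)) $$ (a mod n, b mod n)" if "b < k * n" for b
        using a that by (simp add: A_def flatten_def less_mult_imp_div_less)
      then show "(\<Sum>b<k * n. A $$ (a, b) * vec_index w b) * cnj (vec_index w a) = (\<Sum>b<k * n. cnj (v (a div n) (a mod n)) * v (b div n) (b mod n)
        * \<phi> (f (a div n, b div n)) $$ (a mod n, b mod n))"
        using a v by (simp add: sum_distrib_left sum_distrib_right mult_ac)
    qed
    also have "\<dots> = (\<Sum>p<k. \<Sum>i<n. \<Sum>b<k * n. cnj (v p i) * v (b div n) (b mod n)
        * \<phi> (f (p, b div n)) $$ (i, b mod n))"
      by (rule sum_div_mod[where g = "\<lambda>p i. \<Sum>b<k * n. cnj (v p i) * v (b div n) (b mod n)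
        * \<phi> (f (p, b div n)) $$ (i, b mod n)"])
    also have "\<dots> = (\<Sum>p<k. \<Sum>i<n. \<Sum>q<k. \<Sum>j<n. cnj (v p i) * v q j * \<phi> (f (p, q)) $$ (i, j))"
    proof (rule sum.cong[OF refl], rule sum.cong[OF refl])
      fix p i
      show "(\<Sum>b<k * n. cnj (v p i) * v (b div n) (b mod n) * \<phi> (f (p, b div n)) $$ (i, b mod n))
          = (\<Sum>q<k. \<Sum>j<n. cnj (v p i) * v q j * \<phi> (f (p, q)) $$ (i, j))"
        by (rule sum_div_mod[where g = "\<lambda>q j. cnj (v p i) * v q j * \<phi> (f (p, q)) $$ (i, j)"])
    qed
    also have "\<dots> = mform k n \<phi> f v"
      unfolding mform_def by (rule sum.cong[OF refl], rule sum.swap)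
    finally show ?thesis .
  qed
  show ?thesis unfolding A_def[symmetric]
  proof
    assume psd: "psd A"
    show "\<forall>v. 0 \<le> mform k n \<phi> f v"
    proof
      fix v :: "nat \<Rightarrow> nat \<Rightarrow> complex"
      define w where "w = Matrix.vec (k * n) (\<lambda>a. v (a div n) (a mod n))"
      have w: "w \<in> carrier_vec (k * n)" by (simp add: w_def)
      have "(A *\<^sub>v w) \<bullet>c w = mform k n \<phi> f v" by (rule form[OF w]) (simp add: w_def)
      then show "0 \<le> mform k n \<phi> f v" using psd A w by (auto simp: psd_def)
    qed
  next
    assume v: "\<forall>v. 0 \<le> mform k n \<phi> f v"
    have "0 \<le> (A *\<^sub>v w) \<bullet>c w" if w: "w \<in> carrier_vec (k * n)" for w :: "complex Matrix.vec"
      using v form[OF w, of "\<lambda>p i. vec_index w (p * n + i)"] by simp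
    then show "psd A" using A by (auto simp: psd_def)
  qed
qed

text \<open>Unitality and the value \<open>undefined\<close> outside the space are left out, because
  the maps built from functionals satisfy neither before they are normalised and restricted.\<close>

definition cp_map :: "'a::complex_vector op_system \<Rightarrow> nat \<Rightarrow> ('a \<Rightarrow> complex mat) \<Rightarrow> bool" where
  "cp_map X n \<phi> \<longleftrightarrow>
     (\<forall>x\<in>os_space X. \<phi> x \<in> carrier_mat n n) \<and>
     (\<forall>x\<in>os_space X. \<forall>y\<in>os_space X. \<phi> (x + y) = \<phi> x + \<phi> y) \<and>
     (\<forall>c. \<forall>x\<in>os_space X. \<phi> (c *\<^sub>C x) = c \<cdot>\<^sub>m \<phi> x) \<and>
     (\<forall>k f v. mpos X k f \<longrightarrow> 0 \<le> mform k n \<phi> f v)"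

definition entrywise_linear :: "'a::complex_vector op_system \<Rightarrow> nat \<Rightarrow> ('a \<Rightarrow> complex mat) \<Rightarrow> bool" where
  "entrywise_linear X n \<phi> \<longleftrightarrow> (\<forall>i<n. \<forall>j<n.
     (\<forall>x\<in>os_space X. \<forall>y\<in>os_space X. \<phi> (x + y) $$ (i, j) = \<phi> x $$ (i, j) + \<phi> y $$ (i, j)) \<and>
     (\<forall>c. \<forall>x\<in>os_space X. \<phi> (c *\<^sub>C x) $$ (i, j) = c * \<phi> x $$ (i, j)))"

lemma carrier_mat_eq_iff:
  assumes "A \<in> carrier_mat n n" "B \<in> carrier_mat n n"
  shows "A = B \<longleftrightarrow> (\<forall>i<n. \<forall>j<n. A $$ (i, j) = B $$ (i, j))"
  using assms eq_matI[of B A] by auto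

lemma cp_map_iff:
  "cp_map X n \<phi> \<longleftrightarrow> (\<forall>x\<in>os_space X. \<phi> x \<in> carrier_mat n n) \<and> entrywise_linear X n \<phi> \<and>
     (\<forall>k f v. mpos X k f \<longrightarrow> 0 \<le> mform k n \<phi> f v)" if "operator_system X"
proof -
  interpret operator_system X by fact
  have 1: "\<phi> (x + y) = \<phi> x + \<phi> y \<longleftrightarrow> (\<forall>i<n. \<forall>j<n. \<phi> (x + y) $$ (i, j) = \<phi> x $$ (i, j) + \<phi> y $$ (i, j))"
    if "\<forall>x\<in>os_space X. \<phi> x \<in> carrier_mat n n" "x \<in> os_space X" "y \<in> os_space X" for x y
    using that space_add[of x y] carrier_mat_eq_iff[of "\<phi> (x + y)" n "\<phi> x + \<phi> y"] by auto
  have 2: "\<phi> (c *\<^sub>C x) = c \<cdot>\<^sub>m \<phi> x \<longleftrightarrow> (\<forall>i<n. \<forall>j<n. \<phi> (c *\<^sub>C x) $$ (i, j) = c * \<phi> x $$ (i, j))"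
    if "\<forall>x\<in>os_space X. \<phi> x \<in> carrier_mat n n" "x \<in> os_space X" for c x
    using that space_scaleC[of x c] carrier_mat_eq_iff[of "\<phi> (c *\<^sub>C x)" n "c \<cdot>\<^sub>m \<phi> x"] by auto
  show ?thesis
    unfolding cp_map_def entrywise_linear_def using 1 2 by (safe; metis)
qed

text \<open>The functional that the Choi correspondence attaches to \<open>\<phi>\<close>.\<close>

definition tform :: "nat \<Rightarrow> ('a \<Rightarrow> complex mat) \<Rightarrow> (nat \<times> nat \<Rightarrow> 'a) \<Rightarrow> complex" where
  "tform n \<phi> f = (\<Sum>i<n. \<Sum>j<n. \<phi> (f (i, j)) $$ (i, j))"

text \<open>As a quadratic form it is evaluated at the sum of the vectors
  \<open>e_i \<otimes> e_i\<close>.\<close>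

lemma tform_eq_mform: "tform n \<phi> f = mform n n \<phi> f std"
proof -
  have "(\<Sum>i<n. \<Sum>j<n. cnj (std p i) * std q j * \<phi> (f (p, q)) $$ (i, j)) = \<phi> (f (p, q)) $$ (p, q)"
    if "p < n" "q < n" for p q
    using sform_std[OF that, of "\<lambda>i j. \<phi> (f (p, q)) $$ (i, j)"] by (simp add: sform_def)
  then show ?thesis by (simp add: tform_def mform_def)
qed

context operator_system
begin

lemma entrywise_linear_zero: "entrywise_linear X n \<phi> \<Longrightarrow> i < n \<Longrightarrow> j < n \<Longrightarrow> \<phi> 0 $$ (i, j) = 0"
  unfolding entrywise_linear_def using space_zero cv.scale_zero_left[of 0] by (metis mult_zero_left)

lemma entrywise_linear_sum:
  assumes "entrywise_linear X n \<phi>" "i < n" "j < n" "\<And>a. a \<in> A \<Longrightarrow> F a \<in> os_space X"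
  shows "\<phi> (\<Sum>a\<in>A. F a) $$ (i, j) = (\<Sum>a\<in>A. \<phi> (F a) $$ (i, j))"
  using assms(4)
proof (induction A rule: infinite_finite_induct)
  case (insert a A)
  then show ?case using assms(1-3) by (simp add: entrywise_linear_def space_sum)
qed (simp_all add: entrywise_linear_zero[OF assms(1-3)])

text \<open>The test vector is absorbed into the matrix: read as a k by n scalar matrix,
  \<open>v\<close> compresses \<open>f\<close> to an n by n matrix, on which the single functional
  \<open>tform\<close> is evaluated.\<close>

lemma mform_compress:
  assumes \<phi>: "entrywise_linear X n \<phi>" and f: "msa X k f"
  shows "mform k n \<phi> f v = tform n \<phi> (mcompress k v f)"
proof -
  have fs: "f (p, q) \<in> os_space X" if "p < k" "q < k" for p q using f that by (simp add: msa_def)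
  have "tform n \<phi> (mcompress k v f) = (\<Sum>i<n. \<Sum>j<n. \<Sum>p<k. \<Sum>q<k. cnj (v p i) * v q j * \<phi> (f (p, q)) $$ (i, j))"
    unfolding tform_def
  proof (intro sum.cong refl)
    fix i j assume "i \<in> {..<n}" "j \<in> {..<n}"
    then have ij: "i < n" "j < n" by auto
    have "\<phi> (mcompress k v f (i, j)) $$ (i, j)
        = (\<Sum>p<k. \<phi> (\<Sum>q<k. (cnj (v p i) * v q j) *\<^sub>C f (p, q)) $$ (i, j))"
      unfolding mcompress_def prod.case
      by (rule entrywise_linear_sum[OF \<phi> ij]) (auto intro!: space_sum space_scaleC fs)
    also have "\<dots> = (\<Sum>p<k. \<Sum>q<k. \<phi> ((cnj (v p i) * v q j) *\<^sub>C f (p, q)) $$ (i, j))"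
      by (intro sum.cong refl entrywise_linear_sum[OF \<phi> ij]) (auto intro!: space_scaleC fs)
    also have "\<dots> = (\<Sum>p<k. \<Sum>q<k. cnj (v p i) * v q j * \<phi> (f (p, q)) $$ (i, j))"
      using \<phi> ij fs by (intro sum.cong refl) (simp add: entrywise_linear_def)
    finally show "\<phi> (mcompress k v f (i, j)) $$ (i, j)
      = (\<Sum>p<k. \<Sum>q<k. cnj (v p i) * v q j * \<phi> (f (p, q)) $$ (i, j))" .
  qed
  also have "\<dots> = (\<Sum>i<n. \<Sum>p<k. \<Sum>q<k. \<Sum>j<n. cnj (v p i) * v q j * \<phi> (f (p, q)) $$ (i, j))"
    by (rule sum.cong[OF refl], rule trans[OF sum.swap], rule sum.cong[OF refl], rule sum.swap)
  also have "\<dots> = mform k n \<phi> f v"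
    unfolding mform_def by (rule trans[OF sum.swap], rule sum.cong[OF refl], rule sum.swap)
  finally show ?thesis ..
qed

text \<open>The cones are stable under compression, so positivity of one functional on the n by n
  matrices gives positivity at every level k.\<close>

lemma cp_mapI:
  assumes "\<And>x. x \<in> os_space X \<Longrightarrow> \<phi> x \<in> carrier_mat n n" and lin: "entrywise_linear X n \<phi>"
    and t: "\<And>f. mpos X n f \<Longrightarrow> 0 \<le> tform n \<phi> f"
  shows "cp_map X n \<phi>"
  unfolding cp_map_iff[OF operator_system_axioms]
  using assms(1) lin t mform_compress[OF lin mpos_msa] mpos_compress by auto

lemma cp_map_cong:
  assumes "cp_map X n \<phi>" and e: "\<And>x. x \<in> os_space X \<Longrightarrow> \<psi> x = \<phi> x"
  shows "cp_map X n \<psi>"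
proof -
  have "mform k n \<psi> f v = mform k n \<phi> f v" if "mpos X k f" for k f v
    unfolding mform_def using mpos_msa[OF that] e by (intro sum.cong refl) (simp add: msa_def)
  then show ?thesis using assms space_add space_scaleC by (simp add: cp_map_def)
qed

lemma matrix_states_iff:
  "\<phi> \<in> matrix_states X n \<longleftrightarrow>
    cp_map X n \<phi> \<and> \<phi> (os_unit X) = 1\<^sub>m n \<and> \<phi> \<in> extensional (os_space X)"
proof -
  have "(\<forall>A\<in>os_cone X k. psd (flatten k n (map_mat \<phi> A))) \<longleftrightarrow>
      (\<forall>f v. mpos X k f \<longrightarrow> 0 \<le> mform k n \<phi> f v)" for k
  proof
    assume l: "\<forall>A\<in>os_cone X k. psd (flatten k n (map_mat \<phi> A))"
    then show "\<forall>f v. mpos X k f \<longrightarrow> 0 \<le> mform k n \<phi> f v"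
      unfolding mpos_def using psd_flatten_iff by blast
  next
    assume r: "\<forall>f v. mpos X k f \<longrightarrow> 0 \<le> mform k n \<phi> f v"
    show "\<forall>A\<in>os_cone X k. psd (flatten k n (map_mat \<phi> A))"
    proof
      fix A assume A: "A \<in> os_cone X k"
      then have "Matrix.mat k k (\<lambda>z. A $$ z) = A"
        using cone_sa[of k] by (intro mat_fun_eq) (auto simp: os_mats_sa_def os_mats_def)
      then show "psd (flatten k n (map_mat \<phi> A))"
        using r A psd_flatten_iff[of k n \<phi> "\<lambda>z. A $$ z"] by (auto simp: mpos_def)
    qed
  qed
  then show ?thesis
    unfolding matrix_states_def cp_map_def by (auto simp: PiE_def Pi_def)
qed

lemma restrict_matrix_state:
  assumes "cp_map X n \<phi>" "\<phi> (os_unit X) = 1\<^sub>m n"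
  shows "restrict \<phi> (os_space X) \<in> matrix_states X n"
  using assms cp_map_cong[OF assms(1), of "restrict \<phi> (os_space X)"]
  by (simp add: matrix_states_iff unit_closed)

lemma cp_map_linear: "cp_map X n \<phi> \<Longrightarrow> entrywise_linear X n \<phi>"
  using cp_map_iff[OF operator_system_axioms] by blast

lemma cp_map_form:
  assumes "cp_map X n \<phi>" "x \<in> os_pos X"
  shows "0 \<le> sform n (\<lambda>i j. \<phi> x $$ (i, j)) u u"
proof -
  have "0 \<le> mform 1 n \<phi> (\<lambda>_. x) (\<lambda>_. u)"
    using assms by (simp add: cp_map_def pos_iff)
  then show ?thesis by (simp add: mform_def sform_def)
qed

text \<open>Positive elements have hermitian images, since a form with real values is hermitian. A
  self-adjoint element is a positive one minus a multiple of the unit, and the general case follows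
  by the cartesian decomposition.\<close>

lemma cp_map_star:
  assumes \<phi>: "cp_map X n \<phi>" and x: "x \<in> os_space X" and ij: "i < n" "j < n"
  shows "\<phi> (os_star X x) $$ (i, j) = cnj (\<phi> x $$ (j, i))"
proof -
  note lin = cp_map_linear[OF \<phi>, unfolded entrywise_linear_def]
  have pos: "\<phi> y $$ (i, j) = cnj (\<phi> y $$ (j, i))" if "y \<in> os_pos X" for y
    using sform_hermitian[of n "\<lambda>i j. \<phi> y $$ (i, j)" "std i" "std j"] cp_map_form[OF \<phi> that] ij
    by (simp add: sform_std less_eq_complex_def)
  have sa: "\<phi> y $$ (i, j) = cnj (\<phi> y $$ (j, i))" if y: "y \<in> os_sa X" for y
  proof -
    obtain r where r: "r > 0" "r *\<^sub>R os_unit X + y \<in> os_pos X" using pos_order_unit[OF y] by auto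
    have eq: "\<phi> (r *\<^sub>R os_unit X + y) $$ (i, j) = \<phi> (r *\<^sub>R os_unit X) $$ (i, j) + \<phi> y $$ (i, j)"
      if "i < n" "j < n" for i j
      using lin that y unit_closed space_scaleR sa_space by blast
    have "r *\<^sub>R os_unit X \<in> os_pos X" using pos_scaleR[OF pos_unit] r by auto
    from pos[OF r(2)] pos[OF this] eq[OF ij] eq[OF ij(2,1)] show ?thesis by simp
  qed
  obtain a b where ab: "a \<in> os_sa X" "b \<in> os_sa X" "x = a + \<i> *\<^sub>C b"
    using cartesian_decomposition[OF x] .
  have "os_star X x = a + (- \<i>) *\<^sub>C b"
    using ab by (simp add: star_add star_scaleC sa_space sa_star space_scaleC)
  then show ?thesis
    using ab sa[OF ab(1)] sa[OF ab(2)] lin ij by (simp add: sa_space space_scaleC del: cv.scale_minus_left)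
qed

end

section \<open>Maps from functionals\<close>

text \<open>Positive functionals on \<open>M\<^sub>n(X)\<close> and completely positive maps \<open>X \<rightarrow> M\<^sub>n\<close> correspond through
  \<open>g(A) = \<Sum>\<^sub>i\<^sub>j \<phi>(A\<^sub>i\<^sub>j)\<^sub>i\<^sub>j\<close>. Since \<open>g\<close> is given on self-adjoint matrices only, \<open>\<phi>\<close> is recovered
  from the symmetrised elementary matrices.\<close>

definition pos_functional ::
    "'a::complex_vector op_system \<Rightarrow> nat \<Rightarrow> ((nat \<times> nat \<Rightarrow> 'a) \<Rightarrow> real) \<Rightarrow> bool" where
  "pos_functional X n g \<longleftrightarrow>
     (\<forall>f h. msa X n f \<longrightarrow> msa X n h \<longrightarrow> g (\<lambda>z. f z + h z) = g f + g h) \<and>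
     (\<forall>r f. msa X n f \<longrightarrow> g (\<lambda>z. r *\<^sub>R f z) = r * g f) \<and>
     (\<forall>f. mpos X n f \<longrightarrow> 0 \<le> g f)"

text \<open>For i = j the two summands fall on the same entry, which becomes x plus its adjoint. The
  same factor 1/2 is therefore right on and off the diagonal in
  \<open>functional_map\<close>.\<close>

definition melem :: "'a::complex_vector op_system \<Rightarrow> nat \<Rightarrow> nat \<Rightarrow> 'a \<Rightarrow> nat \<times> nat \<Rightarrow> 'a" where
  "melem X i j x = (\<lambda>(p, q). (if p = i \<and> q = j then x else 0)
     + (if p = j \<and> q = i then os_star X x else 0))"

text \<open>If g comes from a completely positive \<phi>, its value at \<open>melem X i j x\<close>
  is \<phi>(x)_ij plus its conjugate, twice the real part. Replacing x by \<i> x gives minus twice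
  the imaginary part.\<close>

definition functional_map ::
    "'a::complex_vector op_system \<Rightarrow> nat \<Rightarrow> ((nat \<times> nat \<Rightarrow> 'a) \<Rightarrow> real) \<Rightarrow> 'a \<Rightarrow> complex mat" where
  "functional_map X n g x = Matrix.mat n n
     (\<lambda>(i, j). Complex (g (melem X i j x) / 2) (- g (melem X i j (\<i> *\<^sub>C x)) / 2))"

context operator_system
begin

lemma msa_subspace: "subspace {f. msa X n f}"
  unfolding subspace_def zero_fun_def plus_fun_def scaleR_fun_def
  using msa_zero msa_add msa_scaleR by blast

lemma melem_space: "x \<in> os_space X \<Longrightarrow> melem X i j x z \<in> os_space X"
  by (auto simp: melem_def star_closed space_zero space_add split: prod.split)

lemma melem_star: "x \<in> os_space X \<Longrightarrow> os_star X (melem X i j x (q, p)) = melem X i j x (p, q)"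
  by (cases "p = i"; cases "q = j"; cases "p = j"; cases "q = i";
      simp add: melem_def star_closed star_star star_zero star_add add.commute)

lemma msa_melem: "x \<in> os_space X \<Longrightarrow> msa X n (melem X i j x)"
  unfolding msa_def using melem_space melem_star by blast

lemma melem_add:
  assumes "x \<in> os_space X" "y \<in> os_space X"
  shows "melem X i j (x + y) = (\<lambda>z. melem X i j x z + melem X i j y z)"
proof -
  have "(if b then x + y else 0) + (if c then os_star X (x + y) else 0) =
      (if b then x else 0) + (if c then os_star X x else 0)
      + ((if b then y else 0) + (if c then os_star X y else 0))" for b c
    using assms by (cases b; cases c; simp add: star_add)
  then show ?thesis unfolding melem_def by (intro ext) (simp only: split_beta)
qed

lemma melem_scaleR:
  assumes "x \<in> os_space X"
  shows "melem X i j (r *\<^sub>R x) = (\<lambda>z. r *\<^sub>R melem X i j x z)"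
proof -
  have "(if b then r *\<^sub>R x else 0) + (if c then os_star X (r *\<^sub>R x) else 0) =
      r *\<^sub>R ((if b then x else 0) + (if c then os_star X x else 0))" for b c
    using assms by (cases b; cases c; simp add: star_scaleR scaleR_add_right)
  then show ?thesis unfolding melem_def by (intro ext) (simp only: split_beta)
qed

lemma scaleC_cartesian: "c *\<^sub>C x = Re c *\<^sub>R x + Im c *\<^sub>R (\<i> *\<^sub>C (x::'a))"
proof -
  have "c = of_real (Re c) + of_real (Im c) * \<i>" by (simp add: complex_eq_iff)
  then show ?thesis by (metis scaleC_add_left scaleC_scaleC scaleR_scaleC)
qed

text \<open>Both f - h and h - f vanish on the relevant entries and so count as positive. Hence a
  positive functional cannot see the entries outside the n by n block.\<close>

lemma pos_functional_cong:
  assumes g: "pos_functional X n g" and f: "msa X n f"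
    and e: "\<And>i j. i < n \<Longrightarrow> j < n \<Longrightarrow> f (i, j) = h (i, j)"
  shows "g f = g h"
proof -
  have h: "msa X n h" using msa_cong[OF f e] .
  have g_scale: "\<And>r f. msa X n f \<Longrightarrow> g (\<lambda>z. r *\<^sub>R f z) = r * g f"
    and g_add: "\<And>f h. msa X n f \<Longrightarrow> msa X n h \<Longrightarrow> g (\<lambda>z. f z + h z) = g f + g h"
    and g_pos: "\<And>f. mpos X n f \<Longrightarrow> 0 \<le> g f"
    using g by (auto simp: pos_functional_def)
  have "0 \<le> g (\<lambda>z. f z + (-1) *\<^sub>R h z)" "0 \<le> g (\<lambda>z. h z + (-1) *\<^sub>R f z)"
    using e by (auto intro!: g_pos mpos_cong[OF mpos_zero])
  then show ?thesis
    using g_add[OF f msa_scaleR[OF h, of "-1"]] g_add[OF h msa_scaleR[OF f, of "-1"]]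
      g_scale[OF f, of "-1"] g_scale[OF h, of "-1"]
    by simp
qed

lemma pos_functional_sum:
  assumes g: "pos_functional X n g" and F: "\<And>a. a \<in> A \<Longrightarrow> msa X n (F a)"
  shows "msa X n (\<lambda>z. \<Sum>a\<in>A. F a z) \<and> g (\<lambda>z. \<Sum>a\<in>A. F a z) = (\<Sum>a\<in>A. g (F a))"
  using F
proof (induction A rule: infinite_finite_induct)
  case (insert a A)
  then show ?case using g by (simp add: pos_functional_def msa_add)
next
  case empty
  have "g (\<lambda>z. 0 *\<^sub>R (\<lambda>_. 0) z) = 0 * g (\<lambda>_. 0)"
    using g msa_zero[of n] unfolding pos_functional_def by blast
  then show ?case using msa_zero by simp
next
  case (infinite A)
  have "g (\<lambda>z. 0 *\<^sub>R (\<lambda>_. 0) z) = 0 * g (\<lambda>_. 0)"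
    using g msa_zero[of n] unfolding pos_functional_def by blast
  then show ?case using msa_zero infinite by simp
qed

lemma functional_map_linear:
  assumes g: "pos_functional X n g"
  shows "entrywise_linear X n (functional_map X n g)"
  unfolding entrywise_linear_def
proof (intro allI impI conjI ballI)
  fix i j assume ij: "i < n" "j < n"
  have add: "g (melem X i j (x + y)) = g (melem X i j x) + g (melem X i j y)"
    if "x \<in> os_space X" "y \<in> os_space X" for x y
    using that g msa_melem by (simp add: melem_add pos_functional_def)
  have scale: "g (melem X i j (r *\<^sub>R x)) = r * g (melem X i j x)" if "x \<in> os_space X" for r x
    using that g msa_melem by (simp add: melem_scaleR pos_functional_def)
  fix x assume x: "x \<in> os_space X"
  show "functional_map X n g (x + y) $$ (i, j) = functional_map X n g x $$ (i, j) + functional_map X n g y $$ (i, j)"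
    if "y \<in> os_space X" for y
    using that x ij add by (simp add: functional_map_def scaleC_add_right space_scaleC complex_eq_iff add_divide_distrib)
  fix c
  have "g (melem X i j (c *\<^sub>C x)) = Re c * g (melem X i j x) + Im c * g (melem X i j (\<i> *\<^sub>C x))" for c
    using x by (subst scaleC_cartesian) (simp add: add scale space_scaleR space_scaleC)
  from this[of c] this[of "\<i> * c"]
  show "functional_map X n g (c *\<^sub>C x) $$ (i, j) = c * functional_map X n g x $$ (i, j)"
    using ij by (simp add: functional_map_def scaleC_scaleC complex_eq_iff field_simps)
qed

text \<open>Summing the symmetrised elementary matrices of the entries of \<open>f\<close> produces
  every entry twice, once directly and once as the adjoint of the transposed entry, which gives 2
  \<open>g f\<close>. With an additional factor \<i> the two contributions cancel, so the imaginary
  part is 0.\<close>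

lemma functional_map_tform:
  assumes g: "pos_functional X n g" and f: "msa X n f"
  shows "tform n (functional_map X n g) f = of_real (g f)"
proof -
  have fs: "f (i, j) \<in> os_space X" if "i < n" "j < n" for i j using f that by (simp add: msa_def)
  let ?A = "{..<n} \<times> {..<n}"
  have star_f: "os_star X (f (j, i)) = f (i, j)" if "i < n" "j < n" for i j
    using f that by (simp add: msa_def)
  have sum: "(\<Sum>(i, j)\<in>?A. melem X i j (c *\<^sub>C f (i, j)) (p, q)) = c *\<^sub>C f (p, q) + cnj c *\<^sub>C f (p, q)"
    if pq: "p < n" "q < n" for p q c
  proof -
    have "(\<Sum>(i, j)\<in>?A. melem X i j (c *\<^sub>C f (i, j)) (p, q)) =
        (\<Sum>a\<in>?A. if a = (p, q) then c *\<^sub>C f (p, q) else 0) +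
        (\<Sum>a\<in>?A. if a = (q, p) then os_star X (c *\<^sub>C f (q, p)) else 0)"
      unfolding sum.distrib[symmetric]
    proof (rule sum.cong[OF refl])
      fix a assume "a \<in> ?A"
      show "(case a of (i, j) \<Rightarrow> melem X i j (c *\<^sub>C f (i, j)) (p, q)) =
          (if a = (p, q) then c *\<^sub>C f (p, q) else 0)
          + (if a = (q, p) then os_star X (c *\<^sub>C f (q, p)) else 0)"
        by (cases a) (simp only: melem_def prod.case prod.inject, rule arg_cong2[where f = "(+)"], auto)
    qed
    also have "\<dots> = c *\<^sub>C f (p, q) + os_star X (c *\<^sub>C f (q, p))"
      using pq by (simp add: sum.delta)
    finally show ?thesis using pq fs star_f by (simp add: star_scaleC)
  qed
  have re: "(\<Sum>(i, j)\<in>?A. g (melem X i j (f (i, j)))) = 2 * g f"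
  proof -
    have "(\<Sum>a\<in>?A. g (melem X (fst a) (snd a) (f a))) = g (\<lambda>z. \<Sum>a\<in>?A. melem X (fst a) (snd a) (f a) z)"
      using pos_functional_sum[OF g, of ?A "\<lambda>a. melem X (fst a) (snd a) (f a)"] msa_melem fs by auto
    also have "\<dots> = g (\<lambda>z. 2 *\<^sub>R f z)"
    proof (rule pos_functional_cong[OF g])
      show "msa X n (\<lambda>z. \<Sum>a\<in>?A. melem X (fst a) (snd a) (f a) z)"
        using pos_functional_sum[OF g, of ?A "\<lambda>a. melem X (fst a) (snd a) (f a)"] msa_melem fs by auto
      show "(\<Sum>a\<in>?A. melem X (fst a) (snd a) (f a) (p, q)) = 2 *\<^sub>R f (p, q)" if "p < n" "q < n" for p q
        using sum[OF that, of 1] by (simp add: case_prod_beta scaleC_one scaleR_2)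
    qed
    also have "\<dots> = 2 * g f" using g f by (simp add: pos_functional_def)
    finally show ?thesis by (simp add: case_prod_beta)
  qed
  have im: "(\<Sum>(i, j)\<in>?A. g (melem X i j (\<i> *\<^sub>C f (i, j)))) = 0"
  proof -
    have "(\<Sum>a\<in>?A. g (melem X (fst a) (snd a) (\<i> *\<^sub>C f a))) = g (\<lambda>z. \<Sum>a\<in>?A. melem X (fst a) (snd a) (\<i> *\<^sub>C f a) z)"
      using pos_functional_sum[OF g, of ?A "\<lambda>a. melem X (fst a) (snd a) (\<i> *\<^sub>C f a)"] msa_melem fs space_scaleC
      by auto
    also have "\<dots> = g (\<lambda>z. 0 *\<^sub>R f z)"
    proof (rule pos_functional_cong[OF g])
      show "msa X n (\<lambda>z. \<Sum>a\<in>?A. melem X (fst a) (snd a) (\<i> *\<^sub>C f a) z)"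
        using pos_functional_sum[OF g, of ?A "\<lambda>a. melem X (fst a) (snd a) (\<i> *\<^sub>C f a)"] msa_melem fs space_scaleC
        by auto
      show "(\<Sum>a\<in>?A. melem X (fst a) (snd a) (\<i> *\<^sub>C f a) (p, q)) = 0 *\<^sub>R f (p, q)" if "p < n" "q < n" for p q
        using sum[OF that, of \<i>] by (simp add: case_prod_beta)
    qed
    also have "\<dots> = 0" using g f by (simp add: pos_functional_def del: scaleR_zero_left)
    finally show ?thesis by (simp add: case_prod_beta)
  qed
  have "tform n (functional_map X n g) f
      = (\<Sum>(i, j)\<in>?A. Complex (g (melem X i j (f (i, j))) / 2) (- g (melem X i j (\<i> *\<^sub>C f (i, j))) / 2))"
    unfolding tform_def sum.cartesian_product[symmetric] by (simp add: functional_map_def)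
  then have "Re (tform n (functional_map X n g) f) = (\<Sum>(i, j)\<in>?A. g (melem X i j (f (i, j)))) / 2"
    and "Im (tform n (functional_map X n g) f) = - (\<Sum>(i, j)\<in>?A. g (melem X i j (\<i> *\<^sub>C f (i, j)))) / 2"
    by (simp_all add: sum_divide_distrib sum_negf case_prod_beta)
  then show ?thesis using re im by (simp add: complex_eq_iff)
qed

lemma functional_map_cp:
  assumes g: "pos_functional X n g"
  shows "cp_map X n (functional_map X n g)"
proof (rule cp_mapI[OF _ functional_map_linear[OF g]])
  show "functional_map X n g x \<in> carrier_mat n n" for x by (simp add: functional_map_def)
  show "0 \<le> tform n (functional_map X n g) f" if "mpos X n f" for f
    using functional_map_tform[OF g mpos_msa[OF that]] g that
    by (simp add: pos_functional_def less_eq_complex_def)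
qed

text \<open>The Archimedean axiom keeps even \<open>f\<close> plus a positive multiple
  \<open>d\<close> of the unit outside the cone. This margin makes the separation strict.\<close>

lemma separating_functional:
  assumes f: "msa X n f" "\<not> mpos X n f"
  obtains g where "pos_functional X n g" "g (munit X) = 1" "g f < 0"
proof -
  obtain d where d: "d > 0" "\<not> mpos X n (\<lambda>z. d *\<^sub>R munit X z + f z)"
    using mpos_archimedean[OF f(1)] f(2) by blast
  let ?C = "{f. mpos X n f}" and ?S = "{f. msa X n f}"
  have unit: "\<exists>r. r *\<^sub>R munit X + h \<in> ?C" if "h \<in> ?S" for h
    using mpos_order_unit[of n h] that by (auto simp: plus_fun_def scaleR_fun_def)
  have add: "h + h' \<in> ?C" if "h \<in> ?C" "h' \<in> ?C" for h h'
    using that mpos_add by (simp add: plus_fun_def)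
  have scale: "r *\<^sub>R h \<in> ?C" if "h \<in> ?C" "0 \<le> r" for h r
    using that mpos_scaleR by (simp add: scaleR_fun_def)
  have sep: "d *\<^sub>R munit X + f \<notin> ?C"
    using d by (simp add: plus_fun_def scaleR_fun_def)
  have mem: "0 \<in> ?C" "munit X \<in> ?C" "munit X \<in> ?S" "f \<in> ?S"
    using mpos_zero mpos_munit msa_munit f by (auto simp: zero_fun_def)
  obtain g where g: "\<And>x y. x \<in> ?S \<Longrightarrow> y \<in> ?S \<Longrightarrow> g (x + y) = g x + g y"
    "\<And>x r. x \<in> ?S \<Longrightarrow> g (r *\<^sub>R x) = r * g x"
    "\<And>x. x \<in> ?S \<Longrightarrow> x \<in> ?C \<Longrightarrow> 0 \<le> g x" "g (munit X) = 1" "g f < 0"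
  proof -
    note t = that
    show ?thesis
    proof (rule krein_separation[OF msa_subspace mem add scale unit d(1) sep])
      show thesis if "\<And>x y. x \<in> ?S \<Longrightarrow> y \<in> ?S \<Longrightarrow> g (x + y) = g x + g y"
        "\<And>x r. x \<in> ?S \<Longrightarrow> g (r *\<^sub>R x) = r * g x"
        "\<And>x. x \<in> ?S \<Longrightarrow> x \<in> ?C \<Longrightarrow> 0 \<le> g x" "g (munit X) = 1" "g f < 0" for g
        by (rule t[of g]) (fact that)+
    qed auto
  qed
  have "pos_functional X n g"
    using g(1-3) mpos_msa by (auto simp: pos_functional_def plus_fun_def scaleR_fun_def)
  then show thesis using that g(4,5) by blast
qed

end

lemma mform_sform:
  "mform k n \<phi> f v = (\<Sum>p<k. \<Sum>q<k. sform n (\<lambda>i j. \<phi> (f (p, q)) $$ (i, j)) (v p) (v q))"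
  by (simp add: mform_def sform_def)

lemma sform_cong: "(\<And>i. i < n \<Longrightarrow> u i = u' i) \<Longrightarrow> (\<And>i. i < n \<Longrightarrow> w i = w' i) \<Longrightarrow> sform n M u w = sform n M u' w'"
  by (simp add: sform_def)

lemma sum_cnj_eq: "(\<Sum>i<n. cnj (u i) * u i) = complex_of_real (\<Sum>i<n. (cmod (u i))\<^sup>2)"
  by (simp only: of_real_sum complex_norm_square mult.commute)

lemma sform_scalar:
  "sform n (\<lambda>i j. M i j + (if i = j then c else 0)) u u
    = sform n M u u + c * of_real (\<Sum>i<n. (cmod (u i))\<^sup>2)"
proof -
  have "(\<Sum>j<n. cnj (u i) * u j * (if i = j then c else 0)) = c * (cnj (u i) * u i)" if "i < n" for i
    using that by (subst sum.remove[of _ i]) auto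
  then have "(\<Sum>i<n. \<Sum>j<n. cnj (u i) * u j * (if i = j then c else 0)) = (\<Sum>i<n. c * (cnj (u i) * u i))"
    by simp
  also have "\<dots> = c * of_real (\<Sum>i<n. (cmod (u i))\<^sup>2)"
    by (simp only: sum_distrib_left[symmetric] sum_cnj_eq)
  finally show ?thesis by (simp add: sform_def distrib_left sum.distrib)
qed

context operator_system
begin

text \<open>The separating completely positive map need not be unital. A small multiple of the trace
  makes its value at the unit invertible, after which it is normalised by a congruence.\<close>

lemma separating_matrix_state:
  assumes f: "msa X n f" "\<not> mpos X n f"
  obtains \<phi> v where "\<phi> \<in> matrix_states X n" "\<not> 0 \<le> mform n n \<phi> f v"
proof -
  obtain g where g: "pos_functional X n g" "g (munit X) = 1" "g f < 0"
    using separating_functional[OF f] .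
  define \<phi>0 where "\<phi>0 = functional_map X n g"
  have cp0: "cp_map X n \<phi>0" unfolding \<phi>0_def by (rule functional_map_cp[OF g(1)])
  note lin0 = cp_map_linear[OF cp0]
  \<comment> \<open>The trace of \<open>\<phi>0\<close>; the normalisation of \<open>g\<close> makes
    it 1 at the unit.\<close>
  define \<tau> where "\<tau> x = (\<Sum>l<n. \<phi>0 x $$ (l, l))" for x
  have fs: "f (i, j) \<in> os_space X" if "i < n" "j < n" for i j using f that by (simp add: msa_def)
  have "tform n \<phi>0 (munit X) = \<tau> (os_unit X)"
  proof -
    have "(\<Sum>j<n. \<phi>0 (munit X (i, j)) $$ (i, j)) = \<phi>0 (os_unit X) $$ (i, i)" if "i < n" for i
      using that entrywise_linear_zero[OF lin0]
      by (subst sum.remove[of _ i]) (auto simp: munit_def intro!: sum.neutral)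
    then show ?thesis by (simp add: tform_def \<tau>_def)
  qed
  then have \<tau>1: "\<tau> (os_unit X) = 1"
    using functional_map_tform[OF g(1) msa_munit] g(2) by (simp add: \<phi>0_def)
  have \<tau>_pos: "0 \<le> \<tau> x" if "x \<in> os_pos X" for x
    unfolding \<tau>_def
  proof (rule sum_nonneg)
    fix l assume "l \<in> {..<n}"
    then show "0 \<le> \<phi>0 x $$ (l, l)" using cp_map_form[OF cp0 that, of "std l"] by (simp add: sform_std)
  qed
  have \<tau>_add: "\<tau> (x + y) = \<tau> x + \<tau> y" and \<tau>_scale: "\<tau> (c *\<^sub>C x) = c * \<tau> x"
    if "x \<in> os_space X" "y \<in> os_space X" for x y c
    using lin0 that by (simp_all add: \<tau>_def entrywise_linear_def sum.distrib sum_distrib_left)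
  define m where "m = (\<Sum>i<n. \<tau> (f (i, i)))"
  \<comment> \<open>With this choice the added trace term contributes at most - \<open>g f\<close> /
    2 at \<open>f\<close>, so the perturbed value is still at most \<open>g f\<close> / 2 and
    negative.\<close>
  define \<delta> where "\<delta> = - g f / (2 * (1 + \<bar>Re m\<bar>))"
  have \<delta>: "\<delta> > 0" using g(3) unfolding \<delta>_def by (intro divide_pos_pos) auto
  define \<phi>1 where "\<phi>1 x = Matrix.mat n n (\<lambda>(i, j). \<phi>0 x $$ (i, j) + (if i = j then \<delta> * \<tau> x else 0))" for x
  have lin1: "entrywise_linear X n \<phi>1"
    using lin0 \<tau>_add \<tau>_scale by (auto simp: entrywise_linear_def \<phi>1_def algebra_simps)
  have tform1: "tform n \<phi>1 h = tform n \<phi>0 h + of_real \<delta> * (\<Sum>i<n. \<tau> (h (i, i)))" for h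
  proof -
    have "(\<Sum>j<n. if i = j then \<delta> * \<tau> (h (i, j)) else 0) = of_real \<delta> * \<tau> (h (i, i))" if "i < n" for i
      using that by (subst sum.remove[of _ i]) auto
    then show ?thesis
      by (simp add: tform_def \<phi>1_def sum.distrib sum_distrib_left)
  qed
  have cp1: "cp_map X n \<phi>1"
  proof (rule cp_mapI[OF _ lin1])
    show "\<phi>1 x \<in> carrier_mat n n" for x by (simp add: \<phi>1_def)
    fix h assume h: "mpos X n h"
    have diag: "h (i, i) \<in> os_pos X" if "i < n" for i
    proof -
      have "mcompress n (\<lambda>k l. if k = i then 1 else 0) h (0, 0) = (\<Sum>k<n. if k = i then h (i, i) else 0)"
        unfolding mcompress_def prod.case
      proof (rule sum.cong[OF refl])
        fix k assume "k \<in> {..<n}"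
        show "(\<Sum>l<n. (cnj (if k = i then 1 else 0) * (if l = i then 1 else 0)) *\<^sub>C h (k, l))
            = (if k = i then h (i, i) else 0)"
          using \<open>i < n\<close> by (subst sum.remove[of _ i]) (auto simp: scaleC_one)
      qed
      then have "mcompress n (\<lambda>k l. if k = i then 1 else 0) h (0, 0) = h (i, i)" using that by simp
      then show ?thesis unfolding pos_iff
        by (intro mpos_cong[OF mpos_compress[OF h, of 1 "\<lambda>k l. if k = i then 1 else 0"]]) auto
    qed
    have "0 \<le> (\<Sum>i<n. \<tau> (h (i, i)))" using \<tau>_pos diag by (intro sum_nonneg) auto
    moreover have "0 \<le> tform n \<phi>0 h"
      using cp0 h by (simp add: tform_eq_mform cp_map_def)
    ultimately show "0 \<le> tform n \<phi>1 h"
      using \<delta> unfolding tform1 by (simp add: less_eq_complex_def)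
  qed
  have neg: "\<not> 0 \<le> tform n \<phi>1 f"
  proof
    assume "0 \<le> tform n \<phi>1 f"
    then have "0 \<le> g f + \<delta> * Re m"
      unfolding tform1 using functional_map_tform[OF g(1) f(1)]
      by (simp add: \<phi>0_def m_def less_eq_complex_def)
    moreover have "\<delta> * Re m \<le> \<delta> * (1 + \<bar>Re m\<bar>)" using \<delta> by (intro mult_left_mono) auto
    moreover have "\<delta> * (1 + \<bar>Re m\<bar>) = - g f / 2" by (simp add: \<delta>_def field_simps add_pos_nonneg)
    ultimately show False using g(3) by simp
  qed
  define P where "P i j = \<phi>1 (os_unit X) $$ (i, j)" for i j
  have P: "sform n P u u = sform n (\<lambda>i j. \<phi>0 (os_unit X) $$ (i, j)) u u
      + of_real \<delta> * of_real (\<Sum>i<n. (cmod (u i))\<^sup>2)" for u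
    unfolding sform_scalar[symmetric] by (simp add: sform_def P_def \<phi>1_def \<tau>1 cong: if_cong)
  have P_ge: "\<delta> * (\<Sum>i<n. (cmod (u i))\<^sup>2) \<le> Re (sform n P u u)" and P_im: "Im (sform n P u u) = 0" for u
    using cp_map_form[OF cp0 pos_unit, of u] unfolding P by (auto simp: less_eq_complex_def)
  have nonneg: "0 \<le> sform n P u u" for u
  proof -
    have "0 \<le> \<delta> * (\<Sum>i<n. (cmod (u i))\<^sup>2)"
      using \<delta> by (intro mult_nonneg_nonneg sum_nonneg) auto
    then show ?thesis using P_ge[of u] P_im[of u] by (simp add: less_eq_complex_def)
  qed
  have definite: "\<forall>i<n. u i = 0" if "sform n P u u = 0" for u
  proof -
    have "(\<Sum>i<n. (cmod (u i))\<^sup>2) \<le> 0" using P_ge[of u] that \<delta> by (simp add: mult_le_0_iff)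
    then have "(\<Sum>i<n. (cmod (u i))\<^sup>2) = 0" by (simp add: antisym sum_nonneg)
    then show ?thesis by (simp add: sum_nonneg_eq_0_iff)
  qed
  obtain d e where
    d: "\<And>i j. i < n \<Longrightarrow> j < n \<Longrightarrow> sform n P (d i) (d j) = (if i = j then 1 else 0)"
    and e: "\<And>a p. a < n \<Longrightarrow> p < n \<Longrightarrow> (\<Sum>i<n. d i a * e i p) = (if a = p then 1 else (0::complex))"
  proof -
    note t = that
    show ?thesis
    proof (rule positive_definite_congruence[OF nonneg definite])
      show thesis if "\<And>i j. i < n \<Longrightarrow> j < n \<Longrightarrow> sform n P (d i) (d j) = (if i = j then 1 else 0)"
        "\<And>a p. a < n \<Longrightarrow> p < n \<Longrightarrow> (\<Sum>i<n. d i a * e i p) = (if a = p then 1 else (0::complex))" for d e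
        by (rule t[of d e]) (fact that)+
    qed
  qed
  \<comment> \<open>The congruence of \<open>\<phi>1\<close> by the matrix with columns
    \<open>d i\<close>, which turns the value at the unit into the identity.\<close>
  define \<phi>2 where "\<phi>2 x = Matrix.mat n n (\<lambda>(i, j). sform n (\<lambda>a b. \<phi>1 x $$ (a, b)) (d i) (d j))" for x
  have mform2: "mform k n \<phi>2 h v = mform k n \<phi>1 h (\<lambda>p a. \<Sum>i<n. v p i * d i a)" for k h v
  proof -
    have "sform n (\<lambda>i j. \<phi>2 x $$ (i, j)) u w =
        sform n (\<lambda>i j. \<phi>1 x $$ (i, j)) (\<lambda>a. \<Sum>i<n. u i * d i a) (\<lambda>a. \<Sum>i<n. w i * d i a)" for x u w
      unfolding sform_sum_left sform_sum_right sform_scale_left sform_scale_right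
      by (simp add: sform_def[of n _ u w] \<phi>2_def sum_distrib_left mult.assoc)
    then show ?thesis by (simp add: mform_sform)
  qed
  have lin2: "entrywise_linear X n \<phi>2"
    using lin1 unfolding entrywise_linear_def \<phi>2_def
    by (auto simp: sform_def sum.distrib sum_distrib_left algebra_simps)
  have cp2: "cp_map X n \<phi>2"
    unfolding cp_map_iff[OF operator_system_axioms] mform2
    using lin2 cp1 by (auto simp: \<phi>2_def cp_map_def)
  have "\<phi>2 (os_unit X) = 1\<^sub>m n"
    using d by (intro eq_matI) (auto simp: \<phi>2_def P_def[abs_def])
  from restrict_matrix_state[OF cp2 this] have st: "restrict \<phi>2 (os_space X) \<in> matrix_states X n" .
  \<comment> \<open>The test vector is moved by the inverse matrix \<open>e\<close>, so that the
    form of \<open>\<phi>2\<close> there is the negative value \<open>tform n \<phi>1 f\<close>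
    found above.\<close>
  have "mform n n \<phi>1 f (\<lambda>p a. \<Sum>i<n. e i p * d i a) = mform n n \<phi>1 f std"
    unfolding mform_sform
    by (intro sum.cong refl sform_cong) (use e in \<open>auto simp: std_def mult.commute\<close>)
  moreover have "mform n n (restrict \<phi>2 (os_space X)) f v = mform n n \<phi>2 f v" for v
    unfolding mform_def using fs by simp
  ultimately have "\<not> 0 \<le> mform n n (restrict \<phi>2 (os_space X)) f (\<lambda>p i. e i p)"
    using neg by (simp add: mform2 tform_eq_mform)
  then show thesis using that st by blast
qed

end

section \<open>Complete order embeddings and Arveson's extension theorem\<close>

locale order_embedding = X: operator_system X + V: operator_system V
  for X :: "'a::complex_vector op_system" and V :: "'b::complex_vector op_system" +
  fixes h :: "'a \<Rightarrow> 'b"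
  assumes embedding: "complete_order_embedding X V h"
begin

lemma map_space: "x \<in> os_space X \<Longrightarrow> h x \<in> os_space V"
  and map_add: "x \<in> os_space X \<Longrightarrow> y \<in> os_space X \<Longrightarrow> h (x + y) = h x + h y"
  and map_scaleC: "x \<in> os_space X \<Longrightarrow> h (c *\<^sub>C x) = c *\<^sub>C h x"
  and map_unit: "h (os_unit X) = os_unit V"
  and map_inj: "inj_on h (os_space X)"
  using embedding by (auto simp: complete_order_embedding_def completely_positive_def)

lemma map_scaleR: "x \<in> os_space X \<Longrightarrow> h (r *\<^sub>R x) = r *\<^sub>R h x"
  by (simp add: scaleR_scaleC map_scaleC)

lemma map_zero: "h 0 = 0"
  using map_scaleR[OF X.space_zero, of 0] by simp

lemma map_mpos: "mpos X n f \<Longrightarrow> mpos V n (\<lambda>z. h (f z))"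
  using embedding unfolding complete_order_embedding_def completely_positive_def mpos_def
  by (metis map_mat_fun)

lemma mpos_map_iff:
  assumes f: "\<And>i j. i < n \<Longrightarrow> j < n \<Longrightarrow> f (i, j) \<in> os_space X"
  shows "mpos V n (\<lambda>z. h (f z)) \<longleftrightarrow> mpos X n f"
proof
  assume p: "mpos V n (\<lambda>z. h (f z))"
  let ?g = "inv_into (os_space X) h"
  have "Matrix.mat n n (\<lambda>z. h (f z)) \<in> os_cone (os_sub V (h ` os_space X)) n"
    using p f by (auto simp: os_sub_def mpos_def elements_mat_def)
  then have "map_mat ?g (Matrix.mat n n (\<lambda>z. h (f z))) \<in> os_cone X n"
    using embedding by (auto simp: complete_order_embedding_def completely_positive_def)
  then have "mpos X n (\<lambda>z. ?g (h (f z)))" by (simp add: map_mat_fun mpos_def)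
  then show "mpos X n f" by (rule mpos_cong) (simp add: f inv_into_f_f[OF map_inj])
qed (rule map_mpos)

lemma map_pos: "x \<in> os_pos X \<Longrightarrow> h x \<in> os_pos V"
  unfolding X.pos_iff V.pos_iff by (rule map_mpos)

text \<open>The definition of a complete order embedding does not mention the involution. It is
  respected because a self-adjoint element becomes positive after a multiple of the unit is
  added.\<close>

lemma map_sa: assumes x: "x \<in> os_sa X" shows "h x \<in> os_sa V"
proof -
  obtain r where r: "r *\<^sub>R os_unit X + x \<in> os_pos X" using X.pos_order_unit[OF x] by auto
  have "r *\<^sub>R os_unit V + h x \<in> os_sa V"
    using V.pos_sa[OF map_pos[OF r]] x
    by (simp add: map_add map_scaleR X.space_scaleR X.unit_closed X.sa_space map_unit)
  from V.sa_diff[OF this V.sa_scaleR[OF V.sa_unit, of r]] show ?thesis by simp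
qed

lemma map_star: assumes x: "x \<in> os_space X" shows "h (os_star X x) = os_star V (h x)"
proof -
  obtain a b where ab: "a \<in> os_sa X" "b \<in> os_sa X" "x = a + \<i> *\<^sub>C b"
    using X.cartesian_decomposition[OF x] .
  have "os_star X x = a + (- \<i>) *\<^sub>C b"
    using ab by (simp add: X.star_add X.star_scaleC X.sa_space X.sa_star X.space_scaleC)
  then have "h (os_star X x) = h a + (- \<i>) *\<^sub>C h b"
    using ab by (simp only: map_add map_scaleC X.sa_space X.space_scaleC)
  moreover have "os_star V (h x) = h a + (- \<i>) *\<^sub>C h b"
    using ab map_sa[OF ab(1)] map_sa[OF ab(2)]
    by (simp add: map_add map_scaleC X.sa_space X.space_scaleC V.star_add V.star_scaleC V.sa_space
        V.sa_star V.space_scaleC)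
  ultimately show ?thesis by simp
qed

lemma map_msa: "msa X n f \<Longrightarrow> msa V n (\<lambda>z. h (f z))"
  unfolding msa_def by (metis map_space map_star)

text \<open>\<open>tform n \<phi>\<close> is carried to the image of the matrices over X. It is
  positive there because the embedding reflects the order, and the image is cofinal because it
  contains the unit. The map recovered from an extension agrees with \<phi> on X, since the
  symmetrised elementary matrices of \<open>h x\<close> lie in the image.\<close>

theorem arveson_extension:
  assumes \<phi>: "\<phi> \<in> matrix_states X n"
  obtains \<Phi> where "\<Phi> \<in> matrix_states V n" "\<And>x. x \<in> os_space X \<Longrightarrow> \<Phi> (h x) = \<phi> x"
proof -
  have cp: "cp_map X n \<phi>" and \<phi>1: "\<phi> (os_unit X) = 1\<^sub>m n"
    using \<phi> by (simp_all add: X.matrix_states_iff)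
  note lin = X.cp_map_linear[OF cp]
  let ?S = "{f. msa V n f}" and ?C = "{f. mpos V n f}"
  \<comment> \<open>Values in the space are demanded at all indices, not only below
    \<open>n\<close>: the graph consists of whole functions, and \<open>h\<close> is linear only on
    \<open>os_space X\<close>.\<close>
  define D where "D = {f. msa X n f \<and> range f \<subseteq> os_space X}"
  have Dsp: "f z \<in> os_space X" if "f \<in> D" for f z using that by (auto simp: D_def)
  have Dadd: "(\<lambda>z. f z + g z) \<in> D" if "f \<in> D" "g \<in> D" for f g
    using that Dsp by (auto simp: D_def X.msa_add X.space_add)
  have Dscale: "(\<lambda>z. r *\<^sub>R f z) \<in> D" if "f \<in> D" for f r
    using that Dsp by (auto simp: D_def X.msa_scaleR X.space_scaleR)
  have tadd: "tform n \<phi> (\<lambda>z. f z + g z) = tform n \<phi> f + tform n \<phi> g" if "f \<in> D" "g \<in> D" for f g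
    using lin Dsp[OF that(1)] Dsp[OF that(2)]
    by (simp add: tform_def entrywise_linear_def sum.distrib)
  have tscale: "tform n \<phi> (\<lambda>z. r *\<^sub>R f z) = of_real r * tform n \<phi> f" if "f \<in> D" for f r
    using lin Dsp[OF that] by (simp add: tform_def entrywise_linear_def sum_distrib_left scaleR_scaleC)
  define G where "G = (\<lambda>f. (\<lambda>z. h (f z), Re (tform n \<phi> f))) ` D"
  have "subspace G"
    unfolding subspace_def
  proof (intro conjI ballI allI)
    have 0: "(\<lambda>_. 0) \<in> D" by (auto simp: D_def X.msa_zero X.space_zero)
    have "tform n \<phi> (\<lambda>_. 0) = 0" using tscale[OF 0, of 0] by simp
    then show "0 \<in> G" unfolding G_def using 0
      by (intro image_eqI[of _ _ "\<lambda>_. 0"]) (auto simp: map_zero zero_prod_def zero_fun_def)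
    fix x assume "x \<in> G"
    then obtain f where f: "f \<in> D" "x = (\<lambda>z. h (f z), Re (tform n \<phi> f))" by (auto simp: G_def)
    show "r *\<^sub>R x \<in> G" for r
      unfolding G_def using f Dscale[OF f(1)] Dsp[OF f(1)]
      by (intro image_eqI[of _ _ "\<lambda>z. r *\<^sub>R f z"]) (simp_all add: scaleR_fun_def map_scaleR tscale)
    fix y assume "y \<in> G"
    then obtain g where g: "g \<in> D" "y = (\<lambda>z. h (g z), Re (tform n \<phi> g))" by (auto simp: G_def)
    show "x + y \<in> G"
      unfolding G_def using f g Dadd[OF f(1) g(1)] Dsp[OF f(1)] Dsp[OF g(1)]
      by (intro image_eqI[of _ _ "\<lambda>z. f z + g z"]) (simp_all add: plus_fun_def map_add tadd)
  qed
  moreover have "0 \<le> r" if "(x, r) \<in> G" "x \<in> ?C" for x r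
  proof -
    obtain f where f: "f \<in> D" "x = (\<lambda>z. h (f z))" "r = Re (tform n \<phi> f)"
      using \<open>(x, r) \<in> G\<close> by (auto simp: G_def)
    then have "mpos X n f" using \<open>x \<in> ?C\<close> Dsp mpos_map_iff by simp
    then have "0 \<le> tform n \<phi> f" using cp by (simp add: tform_eq_mform cp_map_def)
    then show ?thesis using f by (simp add: less_eq_complex_def)
  qed
  ultimately have G: "positive_graph ?C G" by (simp add: positive_graph_def)
  have GS: "fst ` G \<subseteq> ?S" by (auto simp: G_def D_def map_msa)
  have cof: "\<exists>(y, s)\<in>G. y + x \<in> ?C" if xS: "x \<in> ?S" for x
  proof -
    obtain r where r: "mpos V n (\<lambda>z. r *\<^sub>R munit V z + x z)"
      using V.mpos_order_unit[of n x] xS by auto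
    have "(\<lambda>z. r *\<^sub>R munit X z) \<in> D"
    proof (rule Dscale)
      have "munit X z \<in> os_space X" for z by (auto simp: munit_def X.unit_closed X.space_zero split: prod.split)
      then show "munit X \<in> D" using X.msa_munit[of n] by (auto simp: D_def)
    qed
    moreover have "h (r *\<^sub>R munit X z) = r *\<^sub>R munit V z" for z
      by (cases z) (simp add: munit_def map_scaleR X.unit_closed map_unit map_zero)
    ultimately have "((\<lambda>z. r *\<^sub>R munit V z), Re (tform n \<phi> (\<lambda>z. r *\<^sub>R munit X z))) \<in> G"
      unfolding G_def by (intro image_eqI[of _ _ "\<lambda>z. r *\<^sub>R munit X z"]) auto
    then show ?thesis using r by (intro bexI) (auto simp: plus_fun_def)
  qed
  have add: "f + f' \<in> ?C" if "f \<in> ?C" "f' \<in> ?C" for f f'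
    using that V.mpos_add by (simp add: plus_fun_def)
  have scale: "r *\<^sub>R f \<in> ?C" if "f \<in> ?C" "0 \<le> r" for f r
    using that V.mpos_scaleR by (simp add: scaleR_fun_def)
  have zero: "0 \<in> ?C" using V.mpos_zero by (simp add: zero_fun_def)
  obtain g where g: "\<And>x y. x \<in> ?S \<Longrightarrow> y \<in> ?S \<Longrightarrow> g (x + y) = g x + g y"
    "\<And>x r. x \<in> ?S \<Longrightarrow> g (r *\<^sub>R x) = r * g x"
    "\<And>x. x \<in> ?S \<Longrightarrow> x \<in> ?C \<Longrightarrow> 0 \<le> g x" "\<And>x r. (x, r) \<in> G \<Longrightarrow> g x = r"
  proof -
    note t = that
    show ?thesis
    proof (rule krein_extension[OF V.msa_subspace zero add scale G GS])
      show "\<exists>(y, s)\<in>G. y + x \<in> ?C" if "x \<in> ?S" for x by (rule cof[OF that])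
      show thesis if "\<And>x y. x \<in> ?S \<Longrightarrow> y \<in> ?S \<Longrightarrow> g (x + y) = g x + g y"
        "\<And>x r. x \<in> ?S \<Longrightarrow> g (r *\<^sub>R x) = r * g x"
        "\<And>x. x \<in> ?S \<Longrightarrow> x \<in> ?C \<Longrightarrow> 0 \<le> g x" "\<And>x r. (x, r) \<in> G \<Longrightarrow> g x = r" for g
        by (rule t[of g]) (fact that)+
    qed auto
  qed
  have gp: "pos_functional V n g"
    using g(1-3) V.mpos_msa by (auto simp: pos_functional_def plus_fun_def scaleR_fun_def)
  define \<Phi> where "\<Phi> = functional_map V n g"
  have g_melem: "g (melem V i j (h x)) = 2 * Re (\<phi> x $$ (i, j))"
    if x: "x \<in> os_space X" and ij: "i < n" "j < n" for x i j
  proof -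
    have "melem X i j x \<in> D" using X.msa_melem[OF x] X.melem_space[OF x] by (auto simp: D_def)
    moreover have "melem V i j (h x) = (\<lambda>z. h (melem X i j x z))"
    proof
      fix z
      have "(if b then h x else 0) + (if c then os_star V (h x) else 0) =
          h ((if b then x else 0) + (if c then os_star X x else 0))" for b c
        using x by (cases b; cases c; simp add: map_add map_zero map_star X.star_closed)
      then show "melem V i j (h x) z = h (melem X i j x z)"
        unfolding melem_def by (simp only: split_beta)
    qed
    ultimately have "(melem V i j (h x), Re (tform n \<phi> (melem X i j x))) \<in> G"
      unfolding G_def by (intro image_eqI[of _ _ "melem X i j x"]) auto
    then have "g (melem V i j (h x)) = Re (tform n \<phi> (melem X i j x))" by (rule g(4))
    also have "tform n \<phi> (melem X i j x) = \<phi> x $$ (i, j) + \<phi> (os_star X x) $$ (j, i)"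
    proof -
      have "\<phi> (melem X i j x (p, q)) $$ (p, q) =
          (if p = i then if q = j then \<phi> x $$ (i, j) else 0 else 0)
          + (if p = j then if q = i then \<phi> (os_star X x) $$ (j, i) else 0 else 0)"
        if pq: "p < n" "q < n" for p q
      proof -
        have "\<phi> ((if b then x else 0) + (if c then os_star X x else 0)) $$ (p, q) =
            (if b then \<phi> x $$ (p, q) else 0) + (if c then \<phi> (os_star X x) $$ (p, q) else 0)" for b c
          using lin pq x X.star_closed[OF x] X.entrywise_linear_zero[OF lin pq]
          by (cases b; cases c; simp add: entrywise_linear_def)
        then have "\<phi> (melem X i j x (p, q)) $$ (p, q) = (if p = i \<and> q = j then \<phi> x $$ (p, q) else 0)
            + (if p = j \<and> q = i then \<phi> (os_star X x) $$ (p, q) else 0)"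
          unfolding melem_def by (simp only: prod.case)
        also have "\<dots> = (if p = i then if q = j then \<phi> x $$ (i, j) else 0 else 0)
          + (if p = j then if q = i then \<phi> (os_star X x) $$ (j, i) else 0 else 0)"
          by (rule arg_cong2[where f = "(+)"]) auto
        finally show ?thesis .
      qed
      then have "tform n \<phi> (melem X i j x) = (\<Sum>p<n. \<Sum>q<n. (if p = i then if q = j then \<phi> x $$ (i, j) else 0 else 0)
          + (if p = j then if q = i then \<phi> (os_star X x) $$ (j, i) else 0 else 0))"
        unfolding tform_def by (intro sum.cong) auto
      also have "\<dots> = (\<Sum>p<n. if p = i then \<phi> x $$ (i, j) else 0)
          + (\<Sum>p<n. if p = j then \<phi> (os_star X x) $$ (j, i) else 0)"
        unfolding sum.distrib
        by (rule arg_cong2[where f = "(+)"]; rule sum.cong[OF refl]) (use ij in auto)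
      finally show ?thesis using ij by simp
    qed
    also have "\<phi> (os_star X x) $$ (j, i) = cnj (\<phi> x $$ (i, j))"
      by (rule X.cp_map_star[OF cp x ij(2,1)])
    finally show ?thesis by simp
  qed
  have ext: "\<Phi> (h x) = \<phi> x" if x: "x \<in> os_space X" for x
  proof (rule eq_matI)
    have c: "\<phi> x \<in> carrier_mat n n" using cp x by (simp add: cp_map_def)
    then show "dim_row (\<Phi> (h x)) = dim_row (\<phi> x)" "dim_col (\<Phi> (h x)) = dim_col (\<phi> x)"
      by (simp_all add: \<Phi>_def functional_map_def)
    fix i j assume "i < dim_row (\<phi> x)" "j < dim_col (\<phi> x)"
    then have ij: "i < n" "j < n" using c by auto
    have "g (melem V i j (\<i> *\<^sub>C h x)) = 2 * Re (\<phi> (\<i> *\<^sub>C x) $$ (i, j))"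
      using g_melem[OF X.space_scaleC[OF x] ij] x by (simp add: map_scaleC)
    also have "\<phi> (\<i> *\<^sub>C x) $$ (i, j) = \<i> * \<phi> x $$ (i, j)"
      using lin x ij by (simp add: entrywise_linear_def)
    finally show "\<Phi> (h x) $$ (i, j) = \<phi> x $$ (i, j)"
      using ij g_melem[OF x ij] by (simp add: \<Phi>_def functional_map_def complex_eq_iff)
  qed
  have "\<Phi> (os_unit V) = 1\<^sub>m n" using ext[OF X.unit_closed] by (simp add: map_unit \<phi>1)
  then have "restrict \<Phi> (os_space V) \<in> matrix_states V n"
    using V.functional_map_cp[OF gp] by (intro V.restrict_matrix_state) (simp_all add: \<Phi>_def)
  then show thesis using ext by (intro that[of "restrict \<Phi> (os_space V)"]) (simp_all add: map_space)
qed

end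

section \<open>The operator norm of matrices\<close>

definition sqsum :: "nat \<Rightarrow> (nat \<Rightarrow> complex) \<Rightarrow> real" where
  "sqsum n u = (\<Sum>i<n. (cmod (u i))\<^sup>2)"

definition mapply :: "nat \<Rightarrow> complex mat \<Rightarrow> (nat \<Rightarrow> complex) \<Rightarrow> nat \<Rightarrow> complex" where
  "mapply n A u i = (\<Sum>j<n. A $$ (i, j) * u j)"

lemma sqsum_nonneg: "0 \<le> sqsum n u"
  by (simp add: sqsum_def sum_nonneg)

lemma sqsum_scale: "sqsum n (\<lambda>i. c * u i) = (cmod c)\<^sup>2 * sqsum n u"
  by (simp add: sqsum_def norm_mult power_mult_distrib sum_distrib_left)

lemma vnorm_vec: "vnorm (Matrix.vec n u) = sqrt (sqsum n u)"
  by (simp add: vnorm_def sqsum_def)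

lemma vnorm_carrier: "v \<in> carrier_vec n \<Longrightarrow> vnorm v = sqrt (sqsum n (vec_index v))"
  by (auto simp: vnorm_def sqsum_def)

lemma vnorm_mult: "A \<in> carrier_mat n n \<Longrightarrow> v \<in> carrier_vec n \<Longrightarrow>
    vnorm (A *\<^sub>v v) = sqrt (sqsum n (mapply n A (vec_index v)))"
  by (auto simp: vnorm_def sqsum_def mapply_def scalar_prod_def atLeast0LessThan row_def intro!: sum.cong)

lemma op_norm_upper:
  assumes A: "A \<in> carrier_mat n n" and u: "sqsum n u \<le> 1"
  shows "sqrt (sqsum n (mapply n A u)) \<le> op_norm A"
proof -
  let ?S = "{v \<in> carrier_vec (dim_col A). vnorm v \<le> 1}"
  \<comment> \<open>The supremum defining \<open>op_norm\<close> is a real one and gives upper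
    bounds only after boundedness is known; the sum of the moduli of the entries is a crude
    bound.\<close>
  let ?B = "\<Sum>i<n. \<Sum>j<n. cmod (A $$ (i, j))"
  have bound: "vnorm (A *\<^sub>v v) \<le> ?B" if "v \<in> ?S" for v
  proof -
    have v: "v \<in> carrier_vec n" "sqsum n (vec_index v) \<le> 1" using that A vnorm_carrier[of v n] by auto
    have v1: "cmod (vec_index v j) \<le> 1" if "j < n" for j
    proof -
      have "(cmod (vec_index v j))\<^sup>2 \<le> sqsum n (vec_index v)"
        unfolding sqsum_def using that by (intro member_le_sum) auto
      then show ?thesis using v(2) by (auto intro: power2_le_imp_le[where y = 1])
    qed
    have "vnorm (A *\<^sub>v v) = L2_set (\<lambda>i. cmod (mapply n A (vec_index v) i)) {..<n}"
      unfolding vnorm_mult[OF A v(1)] by (simp add: L2_set_def sqsum_def)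
    also have "\<dots> \<le> (\<Sum>i<n. cmod (mapply n A (vec_index v) i))"
      by (rule L2_set_le_sum) simp
    also have "\<dots> \<le> ?B"
      unfolding mapply_def
    proof (rule sum_mono)
      fix i
      have "cmod (\<Sum>j<n. A $$ (i, j) * vec_index v j) \<le> (\<Sum>j<n. cmod (A $$ (i, j) * vec_index v j))"
        by (rule norm_sum)
      also have "\<dots> \<le> (\<Sum>j<n. cmod (A $$ (i, j)))"
        using v1 by (intro sum_mono) (simp add: norm_mult mult_left_le)
      finally show "cmod (\<Sum>j<n. A $$ (i, j) * vec_index v j) \<le> (\<Sum>j<n. cmod (A $$ (i, j)))" .
    qed
    finally show ?thesis .
  qed
  have u': "Matrix.vec n u \<in> carrier_vec n" "Matrix.vec n u \<in> ?S" using A u by (auto simp: vnorm_vec)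
  have "vnorm (A *\<^sub>v Matrix.vec n u) \<le> op_norm A"
    unfolding op_norm_def using bound u'(2) by (intro cSUP_upper) (auto simp: bdd_above_def)
  moreover have "mapply n A (vec_index (Matrix.vec n u)) = mapply n A u"
    by (auto simp: mapply_def fun_eq_iff)
  ultimately show ?thesis by (simp add: vnorm_mult[OF A u'(1)])
qed

lemma op_norm_leI:
  assumes A: "A \<in> carrier_mat n n" and t: "0 \<le> t"
    and le: "\<And>u. sqsum n (mapply n A u) \<le> t\<^sup>2 * sqsum n u"
  shows "op_norm A \<le> t"
  unfolding op_norm_def
proof (rule cSUP_least)
  have "0\<^sub>v n \<in> {v \<in> carrier_vec (dim_col A). vnorm v \<le> 1}" using A by (auto simp: vnorm_def)
  then show "{v \<in> carrier_vec (dim_col A). vnorm v \<le> 1} \<noteq> {}" by blast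
  fix v assume "v \<in> {v \<in> carrier_vec (dim_col A). vnorm v \<le> 1}"
  then have v: "v \<in> carrier_vec n" "sqsum n (vec_index v) \<le> 1" using A vnorm_carrier[of v n] by auto
  have "sqsum n (mapply n A (vec_index v)) \<le> t\<^sup>2 * 1"
    by (rule order_trans[OF le mult_left_mono[OF v(2)]]) simp
  then show "vnorm (A *\<^sub>v v) \<le> t"
    unfolding vnorm_mult[OF A v(1)] using t by (intro real_le_lsqrt) (auto simp: sqsum_nonneg)
qed

lemma sform_mapply: "sform n (\<lambda>i j. A $$ (i, j)) w u = (\<Sum>i<n. cnj (w i) * mapply n A u i)"
  by (simp add: sform_def mapply_def sum_distrib_left mult_ac)

text \<open>Cauchy-Schwarz, after normalising \<open>u\<close>.\<close>

lemma cmod_sform_le: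
  assumes A: "A \<in> carrier_mat n n"
  shows "cmod (sform n (\<lambda>i j. A $$ (i, j)) u u) \<le> op_norm A * sqsum n u"
proof (cases "sqsum n u = 0")
  case True
  then have "u i = 0" if "i < n" for i
    using that by (simp add: sqsum_def sum_nonneg_eq_0_iff)
  then show ?thesis using True by (simp add: sform_def)
next
  case False
  then have pos: "sqsum n u > 0" using sqsum_nonneg[of n u] by simp
  define c where "c = 1 / sqrt (sqsum n u)"
  define w where "w i = of_real c * u i" for i
  have c2: "c\<^sup>2 * sqsum n u = 1" using pos by (simp add: c_def power_divide)
  have w: "sqsum n w = 1" unfolding w_def sqsum_scale using c2 by simp
  have "cmod (sform n (\<lambda>i j. A $$ (i, j)) w w) \<le> (\<Sum>i<n. \<bar>cmod (w i)\<bar> * \<bar>cmod (mapply n A w i)\<bar>)"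
    unfolding sform_mapply by (rule order_trans[OF norm_sum]) (simp add: norm_mult)
  also have "\<dots> \<le> L2_set (\<lambda>i. cmod (w i)) {..<n} * L2_set (\<lambda>i. cmod (mapply n A w i)) {..<n}"
    by (rule L2_set_mult_ineq)
  also have "\<dots> = sqrt (sqsum n (mapply n A w))" using w by (simp add: L2_set_def sqsum_def)
  also have "\<dots> \<le> op_norm A" by (rule op_norm_upper[OF A]) (simp add: w)
  finally have "cmod (sform n (\<lambda>i j. A $$ (i, j)) w w) \<le> op_norm A" .
  moreover have "sform n (\<lambda>i j. A $$ (i, j)) w w = of_real (c\<^sup>2) * sform n (\<lambda>i j. A $$ (i, j)) u u"
    unfolding w_def sform_scale_left sform_scale_right by (simp add: power2_eq_square)
  ultimately have "c\<^sup>2 * cmod (sform n (\<lambda>i j. A $$ (i, j)) u u) \<le> op_norm A"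
    by (simp add: norm_mult norm_power)
  from mult_right_mono[OF this, of "sqsum n u"]
  have "(c\<^sup>2 * sqsum n u) * cmod (sform n (\<lambda>i j. A $$ (i, j)) u u) \<le> op_norm A * sqsum n u"
    using pos by (simp add: mult_ac)
  then show ?thesis by (simp add: c2)
qed

text \<open>Polarise and test the form against \<open>A u / t\<close>.\<close>

lemma op_norm_le_form:
  assumes A: "A \<in> carrier_mat n n" and t: "0 \<le> t"
    and form: "\<And>u. Im (sform n (\<lambda>i j. A $$ (i, j)) u u) = 0"
      "\<And>u. \<bar>Re (sform n (\<lambda>i j. A $$ (i, j)) u u)\<bar> \<le> t * sqsum n u"
  shows "op_norm A \<le> t"
proof (rule field_le_epsilon)
  fix e :: real assume "e > 0"
  \<comment> \<open>The test vector involves a division, while \<open>t\<close> may be 0; hence the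
    slack \<open>e\<close>.\<close>
  define s where "s = t + e"
  have s: "s > 0" using t \<open>e > 0\<close> by (simp add: s_def)
  let ?F = "sform n (\<lambda>i j. A $$ (i, j))"
  have form': "\<bar>Re (?F u u)\<bar> \<le> s * sqsum n u" for u
    using form(2)[of u] \<open>e > 0\<close> sqsum_nonneg[of n u] by (simp add: s_def distrib_right add_increasing2)
  show "op_norm A \<le> t + e"
    unfolding s_def[symmetric]
  proof (rule op_norm_leI[OF A])
    fix u
    define w where "w i = of_real (1/s) * mapply n A u i" for i
    define m where "m = sqsum n (mapply n A u)"
    have "?F w u = of_real (1/s) * (\<Sum>i<n. cnj (mapply n A u i) * mapply n A u i)"
      unfolding w_def sform_scale_left by (simp add: sform_mapply)
    then have Fw: "?F w u = of_real (m / s)"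
      by (simp add: sum_cnj_eq m_def sqsum_def)
    have Fu: "?F u w = cnj (?F w u)" by (rule sform_hermitian[OF form(1)])
    have sw: "sqsum n w = m / s\<^sup>2" unfolding w_def sqsum_scale m_def using s by (simp add: norm_divide power_divide)
    \<comment> \<open>Polarisation with w = A u / s, where F(w, u) = m / s is real. The
      parallelogram law then bounds the right side by 2 m / s plus 2 s times the square sum of u,
      and half of the left side is absorbed.\<close>
    have "4 * (m / s) = Re (?F (\<lambda>i. w i + u i) (\<lambda>i. w i + u i)) - Re (?F (\<lambda>i. w i + (-1) * u i) (\<lambda>i. w i + (-1) * u i))"
      unfolding sform_add_left sform_add_right sform_scale_left sform_scale_right Fu Fw by simp
    also have "\<dots> \<le> s * sqsum n (\<lambda>i. w i + u i) + s * sqsum n (\<lambda>i. w i + (-1) * u i)"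
      using form'[of "\<lambda>i. w i + u i"] form'[of "\<lambda>i. w i + (-1) * u i"] by linarith
    also have "\<dots> = s * (2 * sqsum n w + 2 * sqsum n u)"
    proof -
      have "(cmod (a + b))\<^sup>2 + (cmod (a + (-1) * b))\<^sup>2 = 2 * (cmod a)\<^sup>2 + 2 * (cmod b)\<^sup>2" for a b
        unfolding cmod_power2 by (simp add: power2_eq_square algebra_simps)
      then have "sqsum n (\<lambda>i. w i + u i) + sqsum n (\<lambda>i. w i + (-1) * u i) = 2 * sqsum n w + 2 * sqsum n u"
        unfolding sqsum_def sum.distrib[symmetric] sum_distrib_left by (intro sum.cong refl)
      then show ?thesis by (simp only: distrib_left[symmetric])
    qed
    also have "\<dots> = 2 * (m / s) + 2 * (s * sqsum n u)"
      using s by (simp add: sw power2_eq_square distrib_left)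
    finally have "m / s \<le> s * sqsum n u" by simp
    then show "sqsum n (mapply n A u) \<le> s\<^sup>2 * sqsum n u"
      using s by (simp add: m_def[symmetric] pos_divide_le_eq power2_eq_square mult_ac)
  qed (use s in simp)
qed

lemma op_norm_1:
  assumes A: "A \<in> carrier_mat 1 1" shows "op_norm A = cmod (A $$ (0, 0))"
proof (rule antisym)
  show "op_norm A \<le> cmod (A $$ (0, 0))"
    by (rule op_norm_leI[OF A]) (simp_all add: sqsum_def mapply_def norm_mult power_mult_distrib)
  show "cmod (A $$ (0, 0)) \<le> op_norm A"
    using cmod_sform_le[OF A, of "\<lambda>_. 1"] by (simp add: sform_def sqsum_def)
qed

context operator_system
begin

lemma matrix_state_carrier: "\<phi> \<in> matrix_states X n \<Longrightarrow> x \<in> os_space X \<Longrightarrow> \<phi> x \<in> carrier_mat n n"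
  by (simp add: matrix_states_iff cp_map_def)

lemma matrix_state_index:
  assumes "\<phi> \<in> matrix_states X n" "i < n" "j < n"
  shows "x \<in> os_space X \<Longrightarrow> y \<in> os_space X \<Longrightarrow> \<phi> (x + y) $$ (i, j) = \<phi> x $$ (i, j) + \<phi> y $$ (i, j)"
    and "x \<in> os_space X \<Longrightarrow> \<phi> (c *\<^sub>C x) $$ (i, j) = c * \<phi> x $$ (i, j)"
    and "x \<in> os_space X \<Longrightarrow> \<phi> (r *\<^sub>R x) $$ (i, j) = of_real r * \<phi> x $$ (i, j)"
    and "x \<in> os_space X \<Longrightarrow> y \<in> os_space X \<Longrightarrow> \<phi> (x - y) $$ (i, j) = \<phi> x $$ (i, j) - \<phi> y $$ (i, j)"
    and "\<phi> (os_unit X) $$ (i, j) = (if i = j then 1 else 0)"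
proof -
  have lin: "entrywise_linear X n \<phi>" using assms(1) matrix_states_iff cp_map_linear by auto
  show add: "\<phi> (x + y) $$ (i, j) = \<phi> x $$ (i, j) + \<phi> y $$ (i, j)" if "x \<in> os_space X" "y \<in> os_space X" for x y
    using lin assms that by (simp add: entrywise_linear_def)
  show sc: "\<phi> (c *\<^sub>C x) $$ (i, j) = c * \<phi> x $$ (i, j)" if "x \<in> os_space X" for c x
    using lin assms that by (simp add: entrywise_linear_def)
  show scR: "\<phi> (r *\<^sub>R x) $$ (i, j) = of_real r * \<phi> x $$ (i, j)" if "x \<in> os_space X" for r x
    using sc that by (simp add: scaleR_scaleC)
  show "\<phi> (x - y) $$ (i, j) = \<phi> x $$ (i, j) - \<phi> y $$ (i, j)" if "x \<in> os_space X" "y \<in> os_space X"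
    using add[of x "(-1) *\<^sub>R y"] scR[of y "-1"] that space_minus by simp
  show "\<phi> (os_unit X) $$ (i, j) = (if i = j then 1 else 0)"
    using assms by (simp add: matrix_states_iff)
qed

lemma matrix_state_form:
  assumes \<phi>: "\<phi> \<in> matrix_states X n" and x: "x \<in> os_space X"
  shows "sform n (\<lambda>i j. \<phi> (r *\<^sub>R os_unit X + x) $$ (i, j)) u u
    = of_real (r * sqsum n u) + sform n (\<lambda>i j. \<phi> x $$ (i, j)) u u"
proof -
  have "sform n (\<lambda>i j. \<phi> (r *\<^sub>R os_unit X + x) $$ (i, j)) u u
      = sform n (\<lambda>i j. \<phi> x $$ (i, j) + (if i = j then of_real r else 0)) u u"
    unfolding sform_def
    by (intro sum.cong refl) (use x in \<open>auto simp: matrix_state_index[OF \<phi>] space_scaleR unit_closed\<close>)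
  then show ?thesis by (simp add: sform_scalar sqsum_def)
qed

text \<open>Positivity of t1 + x and t1 - x, with t the norm of x, bounds the quadratic form of
  \<phi>(x) by t on unit vectors. For a hermitian matrix this bounds the operator norm.\<close>

lemma matrix_state_contractive:
  assumes \<phi>: "\<phi> \<in> matrix_states X n" and x: "x \<in> os_sa X"
  shows "op_norm (\<phi> x) \<le> os_norm X x"
proof -
  define t where "t = os_norm X x"
  note xs = sa_space[OF x]
  have cp: "cp_map X n \<phi>" using \<phi> by (simp add: matrix_states_iff)
  have b: "t *\<^sub>R os_unit X + x \<in> os_pos X" "t *\<^sub>R os_unit X + (- x) \<in> os_pos X"
    using bounded_by_norm[OF x, of t] by (auto simp: bounded_by_def t_def)
  have neg: "sform n (\<lambda>i j. \<phi> (- x) $$ (i, j)) u u = - sform n (\<lambda>i j. \<phi> x $$ (i, j)) u u" for u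
    using matrix_state_index(3)[OF \<phi> _ _ xs, of _ _ "-1"] by (simp add: sform_def sum_negf)
  show ?thesis
    unfolding t_def[symmetric]
  proof (rule op_norm_le_form)
    show "\<phi> x \<in> carrier_mat n n" by (rule matrix_state_carrier[OF \<phi> xs])
    show "0 \<le> t" by (simp add: t_def os_norm_nonneg x)
    fix u
    have "0 \<le> of_real (t * sqsum n u) + sform n (\<lambda>i j. \<phi> x $$ (i, j)) u u"
      "0 \<le> of_real (t * sqsum n u) + sform n (\<lambda>i j. \<phi> (- x) $$ (i, j)) u u"
      using cp_map_form[OF cp b(1), of u] cp_map_form[OF cp b(2), of u]
        matrix_state_form[OF \<phi> xs] matrix_state_form[OF \<phi> space_minus[OF xs]] by simp_all
    then show "Im (sform n (\<lambda>i j. \<phi> x $$ (i, j)) u u) = 0"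
      "\<bar>Re (sform n (\<lambda>i j. \<phi> x $$ (i, j)) u u)\<bar> \<le> t * sqsum n u"
      unfolding neg by (auto simp: less_eq_complex_def)
  qed
qed

end

section \<open>States\<close>

context operator_system
begin

lemma state_add: "\<sigma> \<in> state_space X \<Longrightarrow> x \<in> os_space X \<Longrightarrow> y \<in> os_space X \<Longrightarrow> \<sigma> (x + y) = \<sigma> x + \<sigma> y"
  and state_scaleC: "\<sigma> \<in> state_space X \<Longrightarrow> x \<in> os_space X \<Longrightarrow> \<sigma> (c *\<^sub>C x) = c * \<sigma> x"
  and state_unit: "\<sigma> \<in> state_space X \<Longrightarrow> \<sigma> (os_unit X) = 1"
  and state_pos: "\<sigma> \<in> state_space X \<Longrightarrow> x \<in> os_pos X \<Longrightarrow> 0 \<le> \<sigma> x"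
  by (simp_all add: state_space_def)

lemma state_scaleR: "\<sigma> \<in> state_space X \<Longrightarrow> x \<in> os_space X \<Longrightarrow> \<sigma> (r *\<^sub>R x) = of_real r * \<sigma> x"
  by (simp add: scaleR_scaleC state_scaleC)

lemma state_zero: "\<sigma> \<in> state_space X \<Longrightarrow> \<sigma> 0 = 0"
  using state_scaleR[of \<sigma> 0 0] space_zero by simp

lemma state_minus: "\<sigma> \<in> state_space X \<Longrightarrow> x \<in> os_space X \<Longrightarrow> \<sigma> (- x) = - \<sigma> x"
  using state_scaleR[of \<sigma> x "-1"] by simp

lemma state_diff: "\<sigma> \<in> state_space X \<Longrightarrow> x \<in> os_space X \<Longrightarrow> y \<in> os_space X \<Longrightarrow> \<sigma> (x - y) = \<sigma> x - \<sigma> y"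
  using state_add[of \<sigma> x "- y"] state_minus[of \<sigma> y] space_minus by simp

lemma state_bound:
  assumes \<sigma>: "\<sigma> \<in> state_space X" and x: "x \<in> os_sa X" and b: "bounded_by t x"
  shows "Im (\<sigma> x) = 0" and "cmod (\<sigma> x) \<le> t"
proof -
  have e: "\<sigma> (t *\<^sub>R os_unit X + x) = of_real t + \<sigma> x" "\<sigma> (t *\<^sub>R os_unit X - x) = of_real t - \<sigma> x"
    using \<sigma> x unit_closed space_scaleR[OF unit_closed]
    by (simp_all add: state_add state_diff state_scaleR state_unit sa_space)
  have p: "0 \<le> of_real t + \<sigma> x" "0 \<le> of_real t - \<sigma> x"
    using state_pos[OF \<sigma>] b unfolding bounded_by_def e[symmetric] by auto
  then show im: "Im (\<sigma> x) = 0" by (simp add: less_eq_complex_def)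
  show "cmod (\<sigma> x) \<le> t" using p im by (simp add: less_eq_complex_def cmod_eq_Re abs_le_iff)
qed

lemma state_norm_bound: "\<sigma> \<in> state_space X \<Longrightarrow> x \<in> os_sa X \<Longrightarrow> cmod (\<sigma> x) \<le> os_norm X x"
  using state_bound(2) bounded_by_norm by blast

lemma state_real: "\<sigma> \<in> state_space X \<Longrightarrow> x \<in> os_sa X \<Longrightarrow> Im (\<sigma> x) = 0"
  using state_bound(1) bounded_by_norm by blast

lemma matrix_state_1:
  assumes \<phi>: "\<phi> \<in> matrix_states X 1"
  shows "restrict (\<lambda>x. \<phi> x $$ (0, 0)) (os_space X) \<in> state_space X"
proof -
  have "0 \<le> \<phi> x $$ (0, 0)" if "x \<in> os_pos X" for x
    using cp_map_form[of 1 \<phi> x "\<lambda>_. 1"] \<phi> that by (simp add: matrix_states_iff sform_def)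
  then show ?thesis
    using matrix_state_index[OF \<phi>, of 0 0] pos_sa sa_space
    by (auto simp: state_space_def space_add space_scaleC unit_closed)
qed

lemma state_matrix_state:
  assumes \<sigma>: "\<sigma> \<in> state_space X"
  shows "restrict (\<lambda>x. Matrix.mat 1 1 (\<lambda>_. \<sigma> x)) (os_space X) \<in> matrix_states X 1"
proof (rule restrict_matrix_state)
  have "0 \<le> \<sigma> (f (0, 0))" if "mpos X 1 f" for f
    using state_pos[OF \<sigma>] mpos_cong[OF that, of "\<lambda>_. f (0, 0)"] by (simp add: pos_iff)
  then show "cp_map X 1 (\<lambda>x. Matrix.mat 1 1 (\<lambda>_. \<sigma> x))"
    using \<sigma> by (intro cp_mapI) (auto simp: entrywise_linear_def state_add state_scaleC tform_def)
  show "Matrix.mat 1 1 (\<lambda>_. \<sigma> (os_unit X)) = 1\<^sub>m 1"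
    by (rule eq_matI) (auto simp: state_unit[OF \<sigma>])
qed

text \<open>Separation at matrix size 1, where a matrix state is just a state.\<close>

lemma pos_by_states:
  assumes x: "x \<in> os_sa X" and \<sigma>: "\<And>\<sigma>. \<sigma> \<in> state_space X \<Longrightarrow> 0 \<le> \<sigma> x"
  shows "x \<in> os_pos X"
  unfolding pos_iff
proof (rule ccontr)
  assume np: "\<not> mpos X 1 (\<lambda>_. x)"
  have "msa X 1 (\<lambda>_. x)" using x by (simp add: msa_def os_sa_def)
  then obtain \<phi> v where \<phi>: "\<phi> \<in> matrix_states X 1" "\<not> 0 \<le> mform 1 1 \<phi> (\<lambda>_. x) v"
    using separating_matrix_state[OF _ np] by blast
  have "0 \<le> \<phi> x $$ (0, 0)" using \<sigma>[OF matrix_state_1[OF \<phi>(1)]] sa_space[OF x] by simp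
  moreover have "mform 1 1 \<phi> (\<lambda>_. x) v = of_real ((cmod (v 0 0))\<^sup>2) * \<phi> x $$ (0, 0)"
    unfolding complex_norm_square by (simp add: mform_def mult.commute)
  ultimately show False using \<phi>(2) by (simp add: less_eq_complex_def)
qed

lemma exists_state:
  assumes "os_unit X \<noteq> 0" shows "state_space X \<noteq> {}"
proof
  assume "state_space X = {}"
  then have "(-1) *\<^sub>R os_unit X \<in> os_pos X" using sa_unit by (intro pos_by_states sa_scaleR) auto
  then show False using pos_scalar_iff[OF assms, of "-1"] by simp
qed

lemma scalar_by_states:
  assumes x: "x \<in> os_sa X" and \<sigma>: "\<And>\<sigma>. \<sigma> \<in> state_space X \<Longrightarrow> \<sigma> x = of_real r"
  shows "x = r *\<^sub>R os_unit X"
proof -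
  have u: "r *\<^sub>R os_unit X \<in> os_sa X" using sa_unit sa_scaleR by auto
  have "0 \<le> \<sigma> (x - r *\<^sub>R os_unit X)" "0 \<le> \<sigma> (r *\<^sub>R os_unit X - x)" if "\<sigma> \<in> state_space X" for \<sigma>
    using that x u \<sigma>[OF that] by (simp_all add: state_diff sa_space state_scaleR unit_closed state_unit)
  then have "x - r *\<^sub>R os_unit X \<in> os_pos X" "- (x - r *\<^sub>R os_unit X) \<in> os_pos X"
    using x u by (auto intro!: pos_by_states sa_diff)
  from pos_proper[OF this] show ?thesis by simp
qed

lemma state_eqI:
  assumes \<sigma>: "\<sigma> \<in> state_space X" and \<omega>: "\<omega> \<in> state_space X" and e: "\<And>x. x \<in> os_space X \<Longrightarrow> \<sigma> x = \<omega> x"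
  shows "\<sigma> = \<omega>"
  by (rule extensionalityI[of _ "os_space X"]) (use assms in \<open>auto simp: state_space_def PiE_def\<close>)

end

section \<open>Direct sums\<close>

text \<open>The axioms of an operator system in terms of functions on index pairs; the direct sum,
  the amalgam and the zero system are all verified in this form.\<close>

lemma operator_systemI:
  fixes V :: "'a::complex_vector op_system"
  assumes space: "module.subspace scaleC (os_space V)"
    and star: "\<And>x. x \<in> os_space V \<Longrightarrow> os_star V x \<in> os_space V"
      "\<And>x. x \<in> os_space V \<Longrightarrow> os_star V (os_star V x) = x"
      "\<And>x y. x \<in> os_space V \<Longrightarrow> y \<in> os_space V \<Longrightarrow> os_star V (x + y) = os_star V x + os_star V y"
      "\<And>c x. x \<in> os_space V \<Longrightarrow> os_star V (c *\<^sub>C x) = cnj c *\<^sub>C os_star V x"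
    and unit: "os_unit V \<in> os_space V" "os_star V (os_unit V) = os_unit V"
    and carrier: "\<And>n. os_cone V n \<subseteq> carrier_mat n n"
    and sa: "\<And>n f. mpos V n f \<Longrightarrow> msa V n f"
    and add: "\<And>n f g. mpos V n f \<Longrightarrow> mpos V n g \<Longrightarrow> mpos V n (\<lambda>z. f z + g z)"
    and scale: "\<And>n f r. mpos V n f \<Longrightarrow> 0 \<le> r \<Longrightarrow> mpos V n (\<lambda>z. r *\<^sub>R f z)"
    and proper: "\<And>n f i j. mpos V n f \<Longrightarrow> mpos V n (\<lambda>z. - f z) \<Longrightarrow> i < n \<Longrightarrow> j < n \<Longrightarrow> f (i, j) = 0"
    and compress: "\<And>n m f a. mpos V n f \<Longrightarrow> mpos V m (mcompress n a f)"
    and order_unit: "\<And>n f. msa V n f \<Longrightarrow> \<exists>r>0. mpos V n (\<lambda>z. r *\<^sub>R munit V z + f z)"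
    and archimedean: "\<And>n f. msa V n f \<Longrightarrow> (\<And>r. r > 0 \<Longrightarrow> mpos V n (\<lambda>z. r *\<^sub>R munit V z + f z)) \<Longrightarrow> mpos V n f"
  shows "operator_system V"
proof -
  have cone: "\<exists>f. A = Matrix.mat n n f \<and> mpos V n f" if "A \<in> os_cone V n" for A n
    using that carrier[of n] mat_fun_eq[of A n] by (intro exI[of _ "\<lambda>z. A $$ z"]) (auto simp: mpos_def)
  have sac: "\<exists>f. A = Matrix.mat n n f \<and> msa V n f" if "A \<in> os_mats_sa V n" for A n
  proof -
    have "A = Matrix.mat n n (\<lambda>z. A $$ z)"
      using that by (intro mat_fun_eq[symmetric]) (auto simp: os_mats_sa_def os_mats_def)
    then show ?thesis using that msa_iff by metis
  qed
  have scalar: "os_scalar V n r + Matrix.mat n n f = Matrix.mat n n (\<lambda>z. r *\<^sub>R munit V z + f z)" for n r f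
    by (rule eq_matI) (auto simp: os_scalar_def munit_def)
  show ?thesis
  proof
    show "os_cone V n \<subseteq> os_mats_sa V n" for n
      using cone sa msa_iff by fastforce
    show "A + B \<in> os_cone V n" if "A \<in> os_cone V n" "B \<in> os_cone V n" for A B n
      using cone[OF that(1)] cone[OF that(2)] add by (auto simp: mat_fun_add mpos_def)
    show "map_mat ((*\<^sub>R) r) A \<in> os_cone V n" if "A \<in> os_cone V n" "0 \<le> r" for A n r
      using cone[OF that(1)] scale that(2) by (auto simp: map_mat_fun mpos_def)
    show "A = 0\<^sub>m n n" if A: "A \<in> os_cone V n" "- A \<in> os_cone V n" for A n
    proof -
      obtain f where f: "A = Matrix.mat n n f" "mpos V n f" using cone[OF A(1)] by auto
      have "- A = Matrix.mat n n (\<lambda>z. - f z)" unfolding f(1) by (rule eq_matI) auto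
      then have "mpos V n (\<lambda>z. - f z)" using A(2) by (simp add: mpos_def)
      then show ?thesis unfolding f(1) using proper[OF f(2)] by (intro eq_matI) auto
    qed
    show "compress \<alpha> A \<in> os_cone V m" if A: "A \<in> os_cone V n" "\<alpha> \<in> carrier_mat n m" for A \<alpha> n m
    proof -
      obtain f where f: "A = Matrix.mat n n f" "mpos V n f" using cone[OF A(1)] by auto
      have "compress \<alpha> A = Matrix.mat m m (mcompress n (\<lambda>k i. \<alpha> $$ (k, i)) f)"
        unfolding f(1) using A(2) by (intro eq_matI) (auto simp: compress_def mcompress_def intro!: sum.cong)
      then show ?thesis using compress[OF f(2)] by (simp add: mpos_def)
    qed
    show "\<exists>r>0. os_scalar V n r + A \<in> os_cone V n" if "A \<in> os_mats_sa V n" for A n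
      using sac[OF that] order_unit by (auto simp: scalar mpos_def)
    show "A \<in> os_cone V n" if "A \<in> os_mats_sa V n" "\<And>r. r > 0 \<Longrightarrow> os_scalar V n r + A \<in> os_cone V n" for A n
      using sac[OF that(1)] that(2) archimedean by (auto simp: scalar mpos_def)
  qed (fact space star unit)+
qed

lemma mpos_sum: "mpos (os_sum X Y) n f \<longleftrightarrow> mpos X n (\<lambda>z. fst (f z)) \<and> mpos Y n (\<lambda>z. snd (f z))"
  by (simp add: mpos_def os_sum_def map_mat_fun)

lemma msa_sum: "msa (os_sum X Y) n f \<longleftrightarrow> msa X n (\<lambda>z. fst (f z)) \<and> msa Y n (\<lambda>z. snd (f z))"
  by (auto simp: msa_def os_sum_def mem_Times_iff prod_eq_iff)

lemma munit_sum: "munit (os_sum X Y) z = (munit X z, munit Y z)"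
  by (cases z) (simp add: munit_def os_sum_def zero_prod_def)

lemma fst_scaleC: "fst (c *\<^sub>C z) = c *\<^sub>C fst z" and snd_scaleC: "snd (c *\<^sub>C z) = c *\<^sub>C snd z"
  by (simp_all add: scaleC_prod_def)

lemma fst_mcompress: "fst (mcompress n a f z) = mcompress n a (\<lambda>z. fst (f z)) z"
  and snd_mcompress: "snd (mcompress n a f z) = mcompress n a (\<lambda>z. snd (f z)) z"
  by (cases z, simp add: mcompress_def fst_sum snd_sum fst_scaleC snd_scaleC)+

lemma operator_system_sum:
  assumes "operator_system X" "operator_system Y"
  shows "operator_system (os_sum X Y)"
proof -
  interpret X: operator_system X by fact
  interpret Y: operator_system Y by fact
  show ?thesis
  proof (rule operator_systemI)
    show "module.subspace scaleC (os_space (os_sum X Y))"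
      by (rule cv.subspaceI) (auto simp: os_sum_def zero_prod_def scaleC_prod_def X.space_zero Y.space_zero
          X.space_add Y.space_add X.space_scaleC Y.space_scaleC)
    show "os_cone (os_sum X Y) n \<subseteq> carrier_mat n n" for n
      using X.cone_sa[of n] by (fastforce simp: os_sum_def os_mats_sa_def os_mats_def)
    show "msa (os_sum X Y) n f" if "mpos (os_sum X Y) n f" for n f
      using that X.mpos_msa Y.mpos_msa by (simp add: mpos_sum msa_sum)
    show "mpos (os_sum X Y) n (\<lambda>z. f z + g z)" if "mpos (os_sum X Y) n f" "mpos (os_sum X Y) n g" for n f g
      using that X.mpos_add Y.mpos_add by (simp add: mpos_sum)
    show "mpos (os_sum X Y) n (\<lambda>z. r *\<^sub>R f z)" if "mpos (os_sum X Y) n f" "0 \<le> r" for n f r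
      using that X.mpos_scaleR Y.mpos_scaleR by (simp add: mpos_sum)
    show "f (i, j) = 0" if "mpos (os_sum X Y) n f" "mpos (os_sum X Y) n (\<lambda>z. - f z)" "i < n" "j < n" for n f i j
      using that X.mpos_proper[of n "\<lambda>z. fst (f z)" i j] Y.mpos_proper[of n "\<lambda>z. snd (f z)" i j]
      by (simp add: mpos_sum prod_eq_iff)
    show "mpos (os_sum X Y) m (mcompress n a f)" if "mpos (os_sum X Y) n f" for n m f a
      using that X.mpos_compress Y.mpos_compress by (simp add: mpos_sum fst_mcompress snd_mcompress)
    show "mpos (os_sum X Y) n f" if "msa (os_sum X Y) n f"
      "\<And>r. r > 0 \<Longrightarrow> mpos (os_sum X Y) n (\<lambda>z. r *\<^sub>R munit (os_sum X Y) z + f z)" for n f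
      using that X.mpos_archimedean[of n "\<lambda>z. fst (f z)"] Y.mpos_archimedean[of n "\<lambda>z. snd (f z)"]
      by (simp add: mpos_sum msa_sum munit_sum)
    show "\<exists>r>0. mpos (os_sum X Y) n (\<lambda>z. r *\<^sub>R munit (os_sum X Y) z + f z)" if "msa (os_sum X Y) n f" for n f
    proof -
      obtain r where r: "r > 0" "mpos X n (\<lambda>z. r *\<^sub>R munit X z + fst (f z))"
        using X.mpos_order_unit[of n "\<lambda>z. fst (f z)"] \<open>msa (os_sum X Y) n f\<close> by (auto simp: msa_sum)
      obtain s where s: "s > 0" "mpos Y n (\<lambda>z. s *\<^sub>R munit Y z + snd (f z))"
        using Y.mpos_order_unit[of n "\<lambda>z. snd (f z)"] \<open>msa (os_sum X Y) n f\<close> by (auto simp: msa_sum)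
      have "mpos X n (\<lambda>z. (r + s) *\<^sub>R munit X z + fst (f z))"
        using X.mpos_add[OF r(2) X.mpos_scaleR[OF X.mpos_munit, of s]] s(1) by (simp add: algebra_simps)
      moreover have "mpos Y n (\<lambda>z. (r + s) *\<^sub>R munit Y z + snd (f z))"
        using Y.mpos_add[OF s(2) Y.mpos_scaleR[OF Y.mpos_munit, of r]] r(1) by (simp add: algebra_simps)
      ultimately show ?thesis using r(1) s(1)
        by (intro exI[of _ "r + s"]) (simp add: mpos_sum munit_sum)
    qed
  qed (auto simp: os_sum_def X.star_closed Y.star_closed X.star_star Y.star_star X.star_add Y.star_add
      scaleC_prod_def X.star_scaleC Y.star_scaleC X.unit_closed Y.unit_closed X.star_unit Y.star_unit)
qed

section \<open>The weak* topology on the state space\<close>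

lemma continuous_map_euclidean_iff:
  "continuous_map T euclidean f \<longleftrightarrow> (\<forall>x\<in>topspace T. (f \<longlongrightarrow> f x) (atin T x))"
  by (simp add: continuous_map_atin)

lemma topspace_weak_star: "topspace (weak_star X) = state_space X"
  by (auto simp: weak_star_def state_space_def PiE_def)

lemma continuous_map_eval: "x \<in> os_space X \<Longrightarrow> continuous_map (weak_star X) euclidean (\<lambda>\<sigma>. \<sigma> x)"
  unfolding weak_star_def
  by (intro continuous_map_from_subtopology continuous_map_product_projection)

lemma continuous_map_into_weak_star:
  assumes "\<And>t. t \<in> topspace T \<Longrightarrow> F t \<in> state_space X"
    and "\<And>x. x \<in> os_space X \<Longrightarrow> continuous_map T euclidean (\<lambda>t. F t x)"
  shows "continuous_map T (weak_star X) F"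
  using assms unfolding weak_star_def continuous_map_in_subtopology continuous_map_componentwise
  by (auto simp: state_space_def PiE_def)

lemma openin_cmod_less:
  assumes "continuous_map T euclidean f"
  shows "openin T {x \<in> topspace T. cmod (f x - c) < r}"
proof -
  have "open {z. cmod (z - c) < r}" by (intro open_Collect_less continuous_intros)
  then show ?thesis using openin_continuous_map_preimage[OF assms, of "{z. cmod (z - c) < r}"]
    by (simp add: open_openin[symmetric])
qed

context operator_system
begin

text \<open>Banach-Alaoglu for states: the state space is cut out of the product by closed
  conditions and lies in a product of discs, compact by Tychonoff. The radius at x is the sum of the
  norms of the real and imaginary part of x.\<close>

lemma compact_space_weak_star: "compact_space (weak_star X)"
proof -
  let ?T = "product_topology (\<lambda>_. euclidean) (os_space X) :: ('a \<Rightarrow> complex) topology"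
  have ev: "continuous_map ?T euclidean (\<lambda>\<sigma>. \<sigma> x)" if "x \<in> os_space X" for x
    using that by (rule continuous_map_product_projection)
  have closed_zero: "closedin ?T {\<sigma> \<in> topspace ?T. g \<sigma> = 0}"
    if "continuous_map ?T euclidean g" for g :: "('a \<Rightarrow> complex) \<Rightarrow> complex"
  proof -
    have "closedin euclidean {0 :: complex}" by simp
    from closedin_continuous_map_preimage[OF that this] show ?thesis by (simp only: singleton_iff)
  qed
  have 1: "closedin ?T {\<sigma> \<in> topspace ?T. \<sigma> (x + y) - \<sigma> x - \<sigma> y = 0}"
    if "x \<in> os_space X" "y \<in> os_space X" for x y
    using that space_add[OF that] ev
    by (intro closed_zero) (auto simp: continuous_map_euclidean_iff intro!: tendsto_intros)
  have 2: "closedin ?T {\<sigma> \<in> topspace ?T. \<sigma> (c *\<^sub>C x) - c * \<sigma> x = 0}" if "x \<in> os_space X" for x c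
    using that space_scaleC[OF that, of c] ev
    by (intro closed_zero) (auto simp: continuous_map_euclidean_iff intro!: tendsto_intros)
  have 3: "closedin ?T {\<sigma> \<in> topspace ?T. \<sigma> (os_unit X) - 1 = 0}"
    using unit_closed ev
    by (intro closed_zero) (auto simp: continuous_map_euclidean_iff intro!: tendsto_intros)
  have 4: "closedin ?T {\<sigma> \<in> topspace ?T. 0 \<le> \<sigma> x}" if "x \<in> os_pos X" for x
  proof -
    have "closed {z. 0 \<le> Re z \<and> Im z = 0}"
      by (intro closed_Collect_conj closed_Collect_le closed_Collect_eq continuous_intros)
    moreover have "{z. 0 \<le> Re z \<and> Im z = 0} = {z :: complex. 0 \<le> z}"
      by (auto simp: less_eq_complex_def)
    ultimately show ?thesis
      using closedin_continuous_map_preimage[OF ev[OF sa_space[OF pos_sa[OF that]]], of "{z. 0 \<le> z}"]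
      by simp
  qed
  define \<C> where "\<C> = insert (topspace ?T)
    ((\<lambda>(x, y). {\<sigma> \<in> topspace ?T. \<sigma> (x + y) - \<sigma> x - \<sigma> y = 0}) ` (os_space X \<times> os_space X)
    \<union> (\<lambda>(c, x). {\<sigma> \<in> topspace ?T. \<sigma> (c *\<^sub>C x) - c * \<sigma> x = 0}) ` (UNIV \<times> os_space X)
    \<union> {{\<sigma> \<in> topspace ?T. \<sigma> (os_unit X) - 1 = 0}}
    \<union> (\<lambda>x. {\<sigma> \<in> topspace ?T. 0 \<le> \<sigma> x}) ` os_pos X)"
  have "closedin ?T (\<Inter>\<C>)"
  proof (rule closedin_Inter)
    show "\<C> \<noteq> {}" by (simp add: \<C>_def)
    show "closedin ?T S" if "S \<in> \<C>" for S
      using that unfolding \<C>_def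
      by (elim insertE UnE imageE SigmaE) (use 1 2 3 4 closedin_topspace[of ?T] in \<open>simp_all only: prod.case empty_iff\<close>)
  qed
  moreover have "\<Inter>\<C> = state_space X"
  proof (rule Set.set_eqI)
    fix \<sigma>
    have "\<sigma> \<in> \<Inter>\<C> \<longleftrightarrow> \<sigma> \<in> topspace ?T \<and>
        (\<forall>x\<in>os_space X. \<forall>y\<in>os_space X. \<sigma> (x + y) - \<sigma> x - \<sigma> y = 0) \<and>
        (\<forall>c. \<forall>x\<in>os_space X. \<sigma> (c *\<^sub>C x) - c * \<sigma> x = 0) \<and> \<sigma> (os_unit X) - 1 = 0 \<and>
        (\<forall>x\<in>os_pos X. 0 \<le> \<sigma> x)"
      unfolding \<C>_def by (simp only: Inter_insert Inter_Un_distrib Int_iff INT_iff mem_Collect_eq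
          Ball_def split_paired_all mem_Times_iff split_paired_All prod.case fst_conv snd_conv UNIV_I
          Inter_empty) blast
    then show "\<sigma> \<in> \<Inter>\<C> \<longleftrightarrow> \<sigma> \<in> state_space X"
      by (simp add: state_space_def algebra_simps)
  qed
  ultimately have closed: "closedin ?T (state_space X)" by simp
  have "\<exists>b. \<forall>\<sigma>\<in>state_space X. cmod (\<sigma> x) \<le> b" if x: "x \<in> os_space X" for x
  proof -
    obtain a b where ab: "a \<in> os_sa X" "b \<in> os_sa X" "x = a + \<i> *\<^sub>C b"
      using cartesian_decomposition[OF x] .
    have "cmod (\<sigma> x) \<le> os_norm X a + os_norm X b" if \<sigma>: "\<sigma> \<in> state_space X" for \<sigma>
    proof -
      have "\<sigma> x = \<sigma> a + \<i> * \<sigma> b"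
        using ab \<sigma> by (simp add: state_add state_scaleC sa_space space_scaleC)
      then have "cmod (\<sigma> x) \<le> cmod (\<sigma> a) + cmod (\<sigma> b)"
        using norm_triangle_ineq[of "\<sigma> a" "\<i> * \<sigma> b"] by (simp add: norm_mult)
      then show ?thesis using state_norm_bound[OF \<sigma> ab(1)] state_norm_bound[OF \<sigma> ab(2)] by simp
    qed
    then show ?thesis by blast
  qed
  then obtain b where b: "\<And>x \<sigma>. x \<in> os_space X \<Longrightarrow> \<sigma> \<in> state_space X \<Longrightarrow> cmod (\<sigma> x) \<le> b x"
    by metis
  have "compactin ?T (PiE (os_space X) (\<lambda>x. cball 0 (b x)))"
    unfolding compactin_PiE by simp
  moreover have "state_space X \<subseteq> PiE (os_space X) (\<lambda>x. cball 0 (b x))"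
    using b by (auto simp: state_space_def PiE_def Pi_def)
  ultimately have "compactin ?T (state_space X)" using closed by (rule closed_compactin)
  then show ?thesis unfolding weak_star_def by (rule compact_space_subtopology)
qed

end

section \<open>Lip-norms\<close>

lemma lip_dist_eq:
  "lip_dist X L \<sigma> \<omega> \<le> r \<longleftrightarrow> (\<forall>x\<in>lip_ball X L. ennreal (cmod (\<sigma> x - \<omega> x)) \<le> r)"
  by (simp add: lip_dist_def SUP_le_iff)

lemma lip_dist_upper: "x \<in> lip_ball X L \<Longrightarrow> ennreal (cmod (\<sigma> x - \<omega> x)) \<le> lip_dist X L \<sigma> \<omega>"
  unfolding lip_dist_def by (rule SUP_upper)

lemma lip_dist_commute: "lip_dist X L \<sigma> \<omega> = lip_dist X L \<omega> \<sigma>"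
  by (simp add: lip_dist_def norm_minus_commute)

lemma lip_dist_triangle: "lip_dist X L \<sigma> \<omega> \<le> lip_dist X L \<sigma> \<tau> + lip_dist X L \<tau> \<omega>"
  unfolding lip_dist_eq
proof
  fix x assume x: "x \<in> lip_ball X L"
  have "ennreal (cmod (\<sigma> x - \<omega> x)) \<le> ennreal (cmod (\<sigma> x - \<tau> x) + cmod (\<tau> x - \<omega> x))"
    using norm_triangle_ineq[of "\<sigma> x - \<tau> x" "\<tau> x - \<omega> x"] by (intro ennreal_leI) simp
  also have "\<dots> = ennreal (cmod (\<sigma> x - \<tau> x)) + ennreal (cmod (\<tau> x - \<omega> x))" by simp
  also have "\<dots> \<le> lip_dist X L \<sigma> \<tau> + lip_dist X L \<tau> \<omega>" using x by (intro add_mono lip_dist_upper)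
  finally show "ennreal (cmod (\<sigma> x - \<omega> x)) \<le> lip_dist X L \<sigma> \<tau> + lip_dist X L \<tau> \<omega>" .
qed

context operator_system
begin

text \<open>The weak* topology is compact, so a Hausdorff topology coarser than it must coincide with it.\<close>

lemma lip_normI:
  assumes add: "\<And>x y. x \<in> os_sa X \<Longrightarrow> y \<in> os_sa X \<Longrightarrow> L (x + y) \<le> L x + L y"
    and scale: "\<And>r x. x \<in> os_sa X \<Longrightarrow> L (r *\<^sub>R x) = ennreal \<bar>r\<bar> * L x"
    and unit: "\<And>r. L (r *\<^sub>R os_unit X) = 0"
    and fin: "\<And>\<sigma> \<omega>. \<sigma> \<in> state_space X \<Longrightarrow> \<omega> \<in> state_space X \<Longrightarrow> lip_dist X L \<sigma> \<omega> < \<infinity>"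
    and sep: "\<And>\<sigma> \<omega>. \<sigma> \<in> state_space X \<Longrightarrow> \<omega> \<in> state_space X \<Longrightarrow>
      (\<And>x. x \<in> lip_ball X L \<Longrightarrow> \<sigma> x = \<omega> x) \<Longrightarrow> \<sigma> = \<omega>"
    and cont: "\<And>\<sigma> \<delta>. \<sigma> \<in> state_space X \<Longrightarrow> \<delta> > 0 \<Longrightarrow> \<exists>U. openin (weak_star X) U \<and> \<sigma> \<in> U \<and>
      (\<forall>\<omega>\<in>U. \<forall>x\<in>lip_ball X L. cmod (\<sigma> x - \<omega> x) \<le> \<delta>)"
  shows "lip_norm X L"
proof -
  let ?d = "\<lambda>\<sigma> \<omega>. enn2real (lip_dist X L \<sigma> \<omega>)"
  have d: "ennreal (?d \<sigma> \<omega>) = lip_dist X L \<sigma> \<omega>" if "\<sigma> \<in> state_space X" "\<omega> \<in> state_space X" for \<sigma> \<omega>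
    using fin[OF that] by simp
  interpret Metric_space "state_space X" ?d
  proof
    fix \<sigma> \<omega> assume s: "\<sigma> \<in> state_space X" "\<omega> \<in> state_space X"
    show "?d \<sigma> \<omega> = 0 \<longleftrightarrow> \<sigma> = \<omega>"
    proof
      assume "?d \<sigma> \<omega> = 0"
      then have "lip_dist X L \<sigma> \<omega> = 0" using d[OF s] by simp
      then have "\<sigma> x = \<omega> x" if "x \<in> lip_ball X L" for x
        using lip_dist_upper[OF that, of \<sigma> \<omega>] by simp
      then show "\<sigma> = \<omega>" using sep[OF s] by blast
    next
      assume "\<sigma> = \<omega>"
      then have "lip_dist X L \<sigma> \<omega> \<le> 0" unfolding lip_dist_eq by simp
      then show "?d \<sigma> \<omega> = 0" by simp
    qed
    fix \<tau> assume t: "\<tau> \<in> state_space X"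
    have "ennreal (?d \<sigma> \<tau>) \<le> ennreal (?d \<sigma> \<omega> + ?d \<omega> \<tau>)"
      using lip_dist_triangle[of X L \<sigma> \<tau> \<omega>] d s t by simp
    then show "?d \<sigma> \<tau> \<le> ?d \<sigma> \<omega> + ?d \<omega> \<tau>"
      by (rule ennreal_le_iff[THEN iffD1, rotated]) simp
  qed (simp_all add: lip_dist_commute)
  have "continuous_map (weak_star X) mtopology id"
    unfolding continuous_map_def
  proof (intro conjI allI impI)
    show "id \<in> topspace (weak_star X) \<rightarrow> topspace mtopology" by (simp add: topspace_weak_star)
    fix W assume W: "openin mtopology W"
    show "openin (weak_star X) {x \<in> topspace (weak_star X). id x \<in> W}"
    proof (subst openin_subopen, intro ballI)
      fix \<sigma> assume "\<sigma> \<in> {x \<in> topspace (weak_star X). id x \<in> W}"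
      then have \<sigma>: "\<sigma> \<in> state_space X" "\<sigma> \<in> W" by (simp_all add: topspace_weak_star)
      obtain r where r: "r > 0" "mball \<sigma> r \<subseteq> W" using W \<sigma>(2) by (auto simp: openin_mtopology)
      obtain U where U: "openin (weak_star X) U" "\<sigma> \<in> U"
        "\<forall>\<omega>\<in>U. \<forall>x\<in>lip_ball X L. cmod (\<sigma> x - \<omega> x) \<le> r / 2" using cont[OF \<sigma>(1), of "r/2"] r by auto
      have "U \<subseteq> {x \<in> topspace (weak_star X). id x \<in> W}"
      proof
        fix \<omega> assume \<omega>: "\<omega> \<in> U"
        then have \<omega>S: "\<omega> \<in> state_space X" using openin_subset[OF U(1)] by (auto simp: topspace_weak_star)
        have "lip_dist X L \<sigma> \<omega> \<le> ennreal (r/2)"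
          unfolding lip_dist_eq using U(3) \<omega> by (auto intro!: ennreal_leI)
        then have "?d \<sigma> \<omega> \<le> r / 2" using r by (intro enn2real_leI) auto
        then have "\<omega> \<in> mball \<sigma> r" using r \<sigma>(1) \<omega>S by simp
        then show "\<omega> \<in> {x \<in> topspace (weak_star X). id x \<in> W}" using r(2) \<omega>S by (auto simp: topspace_weak_star)
      qed
      then show "\<exists>U. openin (weak_star X) U \<and> \<sigma> \<in> U \<and> U \<subseteq> {x \<in> topspace (weak_star X). id x \<in> W}"
        using U by blast
    qed
  qed
  then have "homeomorphic_map (weak_star X) mtopology id"
    by (rule continuous_imp_homeomorphic_map[OF _ compact_space_weak_star Hausdorff_space_mtopology])
      (simp_all add: topspace_weak_star)
  then have "mtopology = weak_star X" by (simp add: homeomorphic_map_id)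
  then show ?thesis
    unfolding lip_norm_def using add scale unit fin Metric_space_axioms by blast
qed

text \<open>Equicontinuity: the elements of the Lip-ball, seen as functions on the state space, vary
  little on a common weak* neighbourhood.\<close>

lemma lip_norm_ball_open:
  assumes L: "lip_norm X L" and \<sigma>: "\<sigma> \<in> state_space X" and r: "r > 0"
  obtains U where "openin (weak_star X) U" "\<sigma> \<in> U"
    "\<And>\<omega> x. \<omega> \<in> U \<Longrightarrow> x \<in> lip_ball X L \<Longrightarrow> cmod (\<sigma> x - \<omega> x) \<le> r"
proof -
  let ?d = "\<lambda>\<sigma> \<omega>. enn2real (lip_dist X L \<sigma> \<omega>)"
  interpret Metric_space "state_space X" ?d using L by (simp add: lip_norm_def)
  have "openin (weak_star X) (mball \<sigma> r)" using L openin_mball by (simp add: lip_norm_def)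
  moreover have "\<sigma> \<in> mball \<sigma> r" using \<sigma> r by simp
  moreover have "cmod (\<sigma> x - \<omega> x) \<le> r" if "\<omega> \<in> mball \<sigma> r" "x \<in> lip_ball X L" for \<omega> x
  proof -
    have "lip_dist X L \<sigma> \<omega> < \<infinity>" using L that(1) by (simp add: lip_norm_def)
    then have "ennreal (cmod (\<sigma> x - \<omega> x)) \<le> ennreal (?d \<sigma> \<omega>)" using lip_dist_upper[OF that(2)] by simp
    then show ?thesis using that(1) by (simp add: ennreal_le_iff)
  qed
  ultimately show thesis using that by blast
qed

text \<open>The Lip-ball is bounded modulo scalars. A compact metric space lies in a ball around
  some state \<omega>, and the scalar belonging to x is \<omega>(x), which is real because x is
  self-adjoint.\<close>

lemma lip_norm_bounded:
  assumes L: "lip_norm X L"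
  obtains R where "0 \<le> R"
    "\<And>x. x \<in> lip_ball X L \<Longrightarrow> \<exists>r. \<forall>\<sigma>\<in>state_space X. cmod (\<sigma> x - of_real r) \<le> R"
proof (cases "state_space X = {}")
  case True
  then show thesis using that[of 0] by simp
next
  case False
  let ?d = "\<lambda>\<sigma> \<omega>. enn2real (lip_dist X L \<sigma> \<omega>)"
  interpret Metric_space "state_space X" ?d using L by (simp add: lip_norm_def)
  have "compactin mtopology (state_space X)"
    using L compact_space_weak_star by (simp add: lip_norm_def compact_space_def topspace_weak_star)
  then have "mbounded (state_space X)" by (rule compactin_imp_mbounded)
  then obtain \<omega> B where B: "state_space X \<subseteq> mcball \<omega> B" by (auto simp: mbounded_def)
  have \<omega>: "\<omega> \<in> state_space X" using False B by auto
  have "cmod (\<sigma> x - of_real (Re (\<omega> x))) \<le> max 0 B" if x: "x \<in> lip_ball X L" and \<sigma>: "\<sigma> \<in> state_space X" for x \<sigma>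
  proof -
    have sa: "x \<in> os_sa X" using x by (simp add: lip_ball_def)
    have "lip_dist X L \<omega> \<sigma> < \<infinity>" using L \<sigma> \<omega> by (simp add: lip_norm_def)
    then have "ennreal (cmod (\<omega> x - \<sigma> x)) \<le> ennreal (?d \<omega> \<sigma>)" using lip_dist_upper[OF x] by simp
    then have "cmod (\<omega> x - \<sigma> x) \<le> ?d \<omega> \<sigma>" by (simp add: ennreal_le_iff)
    also have "\<dots> \<le> B" using B \<sigma> by auto
    finally have "cmod (\<sigma> x - \<omega> x) \<le> B" by (simp add: norm_minus_commute)
    moreover have "of_real (Re (\<omega> x)) = \<omega> x" using state_real[OF \<omega> sa] by (simp add: complex_eq_iff)
    ultimately show ?thesis by simp
  qed
  then show thesis using that[of "max 0 B"] by auto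
qed

end

section \<open>Restricting states along a positive map\<close>

text \<open>The maps of interest are the two inclusions of the summands into a direct sum; they are not
  unital.\<close>

locale subunital_map = X: operator_system X + Z: operator_system Z
  for X :: "'a::complex_vector op_system" and Z :: "'b::complex_vector op_system" +
  fixes j :: "'a \<Rightarrow> 'b"
  assumes map_space: "x \<in> os_space X \<Longrightarrow> j x \<in> os_space Z"
    and map_add: "x \<in> os_space X \<Longrightarrow> y \<in> os_space X \<Longrightarrow> j (x + y) = j x + j y"
    and map_scaleC: "x \<in> os_space X \<Longrightarrow> j (c *\<^sub>C x) = c *\<^sub>C j x"
    and map_pos: "x \<in> os_pos X \<Longrightarrow> j x \<in> os_pos Z"
    and map_unit: "os_unit Z - j (os_unit X) \<in> os_pos Z"
begin

lemma map_scaleR: "x \<in> os_space X \<Longrightarrow> j (r *\<^sub>R x) = r *\<^sub>R j x"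
  by (simp add: scaleR_scaleC map_scaleC)

lemma map_diff: "x \<in> os_space X \<Longrightarrow> y \<in> os_space X \<Longrightarrow> j (x - y) = j x - j y"
  using map_add[of x "(-1) *\<^sub>R y"] map_scaleR[of y "-1"] X.space_scaleR[of y "-1"] by simp

text \<open>The mass of the restricted functional. It lies between 0 and 1, and 0 does
  occur.\<close>

definition weight :: "('b \<Rightarrow> complex) \<Rightarrow> real" where
  "weight \<omega> = Re (\<omega> (j (os_unit X)))"

text \<open>The normalised restriction; it is shown to be a state when the weight is
  positive.\<close>

definition pullback :: "('b \<Rightarrow> complex) \<Rightarrow> 'a \<Rightarrow> complex" where
  "pullback \<omega> = restrict (\<lambda>x. \<omega> (j x) / \<omega> (j (os_unit X))) (os_space X)"

lemma weight:
  assumes "\<omega> \<in> state_space Z"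
  shows "\<omega> (j (os_unit X)) = of_real (weight \<omega>)" "0 \<le> weight \<omega>" "weight \<omega> \<le> 1"
proof -
  have 1: "0 \<le> \<omega> (j (os_unit X))" using Z.state_pos[OF assms map_pos[OF X.pos_unit]] .
  have 2: "0 \<le> 1 - \<omega> (j (os_unit X))"
    using Z.state_pos[OF assms map_unit] assms
    by (simp add: Z.state_diff Z.unit_closed Z.state_unit map_space X.unit_closed)
  show "\<omega> (j (os_unit X)) = of_real (weight \<omega>)" "0 \<le> weight \<omega>" "weight \<omega> \<le> 1"
    using 1 2 by (auto simp: weight_def less_eq_complex_def complex_eq_iff)
qed

lemma pullback_state:
  assumes \<omega>: "\<omega> \<in> state_space Z" and w: "weight \<omega> > 0"
  shows "pullback \<omega> \<in> state_space X"
proof -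
  have "0 \<le> \<omega> (j x) / of_real (weight \<omega>)" if "x \<in> os_pos X" for x
    using Z.state_pos[OF \<omega> map_pos[OF that]] w by (simp add: less_eq_complex_def)
  then show ?thesis
    using \<omega> w X.pos_sa X.sa_space
    by (auto simp: state_space_def pullback_def weight(1)[OF \<omega>] X.space_add X.space_scaleC map_add
        map_scaleC map_space add_divide_distrib X.unit_closed)
qed

lemma map_bound:
  assumes \<omega>: "\<omega> \<in> state_space Z" and x: "x \<in> os_sa X"
  shows "cmod (\<omega> (j x)) \<le> os_norm X x * weight \<omega>"
proof -
  let ?t = "os_norm X x"
  have b: "?t *\<^sub>R os_unit X + x \<in> os_pos X" "?t *\<^sub>R os_unit X - x \<in> os_pos X"
    using X.bounded_by_norm[OF x, of ?t] by (auto simp: X.bounded_by_def)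
  have "\<omega> (j (?t *\<^sub>R os_unit X + x)) = of_real (?t * weight \<omega>) + \<omega> (j x)"
    "\<omega> (j (?t *\<^sub>R os_unit X - x)) = of_real (?t * weight \<omega>) - \<omega> (j x)"
    using \<omega> x weight(1)[OF \<omega>]
    by (simp_all add: map_add map_diff map_scaleR X.sa_space X.unit_closed X.space_scaleR map_space
        Z.state_add Z.state_diff Z.state_scaleR Z.space_scaleR)
  then have "0 \<le> of_real (?t * weight \<omega>) + \<omega> (j x)" "0 \<le> of_real (?t * weight \<omega>) - \<omega> (j x)"
    using Z.state_pos[OF \<omega> map_pos[OF b(1)]] Z.state_pos[OF \<omega> map_pos[OF b(2)]] by auto
  then show ?thesis by (auto simp: less_eq_complex_def cmod_eq_Re abs_le_iff)
qed

text \<open>A positive functional that vanishes at the unit is 0.\<close>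

lemma map_zero_weight:
  assumes \<omega>: "\<omega> \<in> state_space Z" and w: "weight \<omega> = 0" and x: "x \<in> os_space X"
  shows "\<omega> (j x) = 0"
proof -
  obtain a b where ab: "a \<in> os_sa X" "b \<in> os_sa X" "x = a + \<i> *\<^sub>C b"
    using X.cartesian_decomposition[OF x] .
  have "\<omega> (j a) = 0" "\<omega> (j b) = 0" using map_bound[OF \<omega> ab(1)] map_bound[OF \<omega> ab(2)] w by auto
  then show ?thesis
    using ab \<omega> by (simp add: map_add map_scaleC X.sa_space X.space_scaleC Z.state_add Z.state_scaleC
        map_space Z.space_scaleC)
qed

lemma map_eq_pullback:
  assumes \<omega>: "\<omega> \<in> state_space Z" and w: "weight \<omega> > 0" and x: "x \<in> os_space X"
  shows "\<omega> (j x) = of_real (weight \<omega>) * pullback \<omega> x"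
  using assms by (simp add: pullback_def weight(1))

lemma map_shift_bound:
  assumes \<omega>: "\<omega> \<in> state_space Z" and x: "x \<in> os_space X" and R: "0 \<le> R"
    and r: "\<forall>\<tau>\<in>state_space X. cmod (\<tau> x - of_real r) \<le> R"
  shows "cmod (\<omega> (j (x - r *\<^sub>R os_unit X))) \<le> weight \<omega> * R"
proof (cases "weight \<omega> = 0")
  case True
  then show ?thesis
    using map_zero_weight[OF \<omega> True] X.space_diff[OF x X.space_scaleR[OF X.unit_closed]] by simp
next
  case False
  then have w: "weight \<omega> > 0" using weight(2)[OF \<omega>] by simp
  note p = pullback_state[OF \<omega> w]
  have "\<omega> (j (x - r *\<^sub>R os_unit X)) = of_real (weight \<omega>) * (pullback \<omega> x - of_real r)"
    using map_eq_pullback[OF \<omega> w] x p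
    by (simp add: X.space_diff X.space_scaleR X.unit_closed X.state_diff X.state_scaleR X.state_unit)
  then show ?thesis using r p w by (simp add: norm_mult mult_left_mono)
qed

text \<open>For positive weight the normalised restrictions agree on the Lip-ball, so their distance
  for the metric of the Lip-norm is 0 and they coincide.\<close>

lemma map_separates:
  assumes L: "lip_norm X L" and s: "\<sigma> \<in> state_space Z" "\<omega> \<in> state_space Z"
    and w: "weight \<sigma> = weight \<omega>"
    and e: "\<And>x. x \<in> lip_ball X L \<Longrightarrow> \<sigma> (j x) = \<omega> (j x)" and x: "x \<in> os_space X"
  shows "\<sigma> (j x) = \<omega> (j x)"
proof (cases "weight \<sigma> = 0")
  case True
  then show ?thesis using map_zero_weight[OF s(1) _ x] map_zero_weight[OF s(2) _ x] w by simp
next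
  case False
  then have pos: "weight \<sigma> > 0" "weight \<omega> > 0" using weight(2)[OF s(1)] w by simp_all
  let ?d = "\<lambda>\<sigma> \<omega>. enn2real (lip_dist X L \<sigma> \<omega>)"
  interpret Metric_space "state_space X" ?d using L by (simp add: lip_norm_def)
  have "lip_dist X L (pullback \<sigma>) (pullback \<omega>) \<le> 0"
    unfolding lip_dist_eq using e weight(1)[OF s(1)] weight(1)[OF s(2)] w
    by (auto simp: pullback_def lip_ball_def X.sa_space)
  then have "pullback \<sigma> = pullback \<omega>"
    using zero[OF pullback_state[OF s(1) pos(1)] pullback_state[OF s(2) pos(2)]] by simp
  then show ?thesis using map_eq_pullback[OF s(1) pos(1) x] map_eq_pullback[OF s(2) pos(2) x] w by simp
qed

text \<open>If the weight vanishes at \<sigma>, it is small nearby and so are all values in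
  question. If it is positive, it stays positive nearby, the normalised restriction is weak*
  continuous there, and equicontinuity of the Lip-ball over X applies.\<close>

lemma map_equicontinuous:
  assumes L: "lip_norm X L" and \<sigma>: "\<sigma> \<in> state_space Z" and \<delta>: "\<delta> > 0" and R: "0 \<le> R"
  obtains U where "openin (weak_star Z) U" "\<sigma> \<in> U"
    "\<And>\<omega> x r. \<omega> \<in> U \<Longrightarrow> x \<in> lip_ball X L \<Longrightarrow> \<forall>\<tau>\<in>state_space X. cmod (\<tau> x - of_real r) \<le> R \<Longrightarrow>
      cmod (\<sigma> (j (x - r *\<^sub>R os_unit X)) - \<omega> (j (x - r *\<^sub>R os_unit X))) \<le> \<delta>"
proof -
  let ?u = "j (os_unit X)"
  have ev: "continuous_map (weak_star Z) euclidean (\<lambda>\<omega>. \<omega> (j x))" if "x \<in> os_space X" for x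
    by (rule continuous_map_eval[OF map_space[OF that]])
  \<comment> \<open>Chosen so that a change of the weight by \<eta> costs at most half of \<delta>;
    the summand 1 protects against R = 0.\<close>
  define \<eta> where "\<eta> = \<delta> / (2 * (R + 1))"
  have \<eta>: "\<eta> > 0" "\<eta> * R \<le> \<delta> / 2"
    using \<delta> R by (simp_all add: \<eta>_def divide_simps)
  define U1 where "U1 = {\<omega> \<in> state_space Z. cmod (\<omega> ?u - \<sigma> ?u) < \<eta>}"
  have U1: "openin (weak_star Z) U1" "\<sigma> \<in> U1"
    using openin_cmod_less[OF ev[OF X.unit_closed], of "\<sigma> ?u" \<eta>] \<sigma> \<eta>
    by (simp_all add: U1_def topspace_weak_star)
  have U1_weight: "\<omega> \<in> state_space Z" "\<bar>weight \<omega> - weight \<sigma>\<bar> < \<eta>" if "\<omega> \<in> U1" for \<omega>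
    using that weight(1)[of \<omega>] weight(1)[OF \<sigma>] by (simp_all add: U1_def flip: of_real_diff)
  show thesis
  proof (cases "weight \<sigma> = 0")
    case True
    show thesis
    proof (rule that[OF U1])
      fix \<omega> x r
      assume \<omega>: "\<omega> \<in> U1" and x: "x \<in> lip_ball X L"
        and r: "\<forall>\<tau>\<in>state_space X. cmod (\<tau> x - of_real r) \<le> R"
      have xs: "x \<in> os_space X" using x by (simp add: lip_ball_def X.sa_space)
      have "\<sigma> (j (x - r *\<^sub>R os_unit X)) = 0"
        by (rule map_zero_weight[OF \<sigma> True]) (intro X.space_diff X.space_scaleR X.unit_closed xs)
      moreover have "cmod (\<omega> (j (x - r *\<^sub>R os_unit X))) \<le> weight \<omega> * R"
        by (rule map_shift_bound[OF U1_weight(1)[OF \<omega>] xs R r])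
      moreover have "weight \<omega> * R \<le> \<eta> * R"
        using U1_weight(2)[OF \<omega>] True R by (intro mult_right_mono) auto
      ultimately show "cmod (\<sigma> (j (x - r *\<^sub>R os_unit X)) - \<omega> (j (x - r *\<^sub>R os_unit X))) \<le> \<delta>"
        using \<eta> \<delta> by simp
    qed
  next
    case False
    then have s: "weight \<sigma> > 0" using weight(2)[OF \<sigma>] by simp
    obtain B where B: "openin (weak_star X) B" "pullback \<sigma> \<in> B"
      "\<And>\<omega> x. \<omega> \<in> B \<Longrightarrow> x \<in> lip_ball X L \<Longrightarrow> cmod (pullback \<sigma> x - \<omega> x) \<le> \<delta> / 2"
      using X.lip_norm_ball_open[OF L pullback_state[OF \<sigma> s], of "\<delta>/2"] \<delta> by auto
    \<comment> \<open>On this neighbourhood the weight is positive, so the quotient in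
      \<open>pullback\<close> is continuous.\<close>
    define W where "W = {\<omega> \<in> state_space Z. cmod (\<omega> ?u - \<sigma> ?u) < weight \<sigma>}"
    have W: "openin (weak_star Z) W" "\<sigma> \<in> W"
      using openin_cmod_less[OF ev[OF X.unit_closed], of "\<sigma> ?u" "weight \<sigma>"] \<sigma> s
      by (simp_all add: W_def topspace_weak_star)
    have Wpos: "\<omega> \<in> state_space Z" "weight \<omega> > 0" if "\<omega> \<in> W" for \<omega>
      using that weight(1)[of \<omega>] weight(1)[OF \<sigma>] by (auto simp: W_def simp flip: of_real_diff)
    have "continuous_map (subtopology (weak_star Z) W) (weak_star X) pullback"
    proof (rule continuous_map_into_weak_star)
      show "pullback \<omega> \<in> state_space X" if "\<omega> \<in> topspace (subtopology (weak_star Z) W)" for \<omega>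
        using that pullback_state Wpos by (auto simp: topspace_weak_star)
      fix x assume x: "x \<in> os_space X"
      have "continuous_map (subtopology (weak_star Z) W) euclidean (\<lambda>\<omega>. \<omega> (j x))"
        "continuous_map (subtopology (weak_star Z) W) euclidean (\<lambda>\<omega>. \<omega> ?u)"
        using ev x X.unit_closed by (auto intro: continuous_map_from_subtopology)
      then show "continuous_map (subtopology (weak_star Z) W) euclidean (\<lambda>\<omega>. pullback \<omega> x)"
        using x Wpos weight(1) unfolding continuous_map_euclidean_iff
        by (fastforce simp: pullback_def intro!: tendsto_divide)
    qed
    from openin_continuous_map_preimage[OF this B(1)]
    have "openin (weak_star Z) {\<omega> \<in> W. pullback \<omega> \<in> B}"
      using openin_open_subtopology[OF W(1)] openin_subset[OF W(1)]
      by (simp add: Int_absorb1 Int_absorb2)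
    then have "openin (weak_star Z) (U1 \<inter> {\<omega> \<in> W. pullback \<omega> \<in> B})" using U1(1) by (rule openin_Int[rotated])
    moreover have "\<sigma> \<in> U1 \<inter> {\<omega> \<in> W. pullback \<omega> \<in> B}" using U1(2) W(2) B(2) by simp
    ultimately show thesis
    proof (rule that)
      fix \<omega> x r
      assume \<omega>: "\<omega> \<in> U1 \<inter> {\<omega> \<in> W. pullback \<omega> \<in> B}" and x: "x \<in> lip_ball X L"
        and r: "\<forall>\<tau>\<in>state_space X. cmod (\<tau> x - of_real r) \<le> R"
      have xs: "x \<in> os_space X" using x by (simp add: lip_ball_def X.sa_space)
      have \<omega>Z: "\<omega> \<in> state_space Z" and t: "weight \<omega> > 0" using Wpos \<omega> by auto
      have eq: "\<rho> (j (x - r *\<^sub>R os_unit X)) = of_real (weight \<rho>) * (pullback \<rho> x - of_real r)"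
        if "\<rho> \<in> state_space Z" "weight \<rho> > 0" for \<rho>
        using map_eq_pullback[OF that] pullback_state[OF that] xs
        by (simp add: X.space_diff X.space_scaleR X.unit_closed X.state_diff X.state_scaleR X.state_unit)
      let ?D = "\<sigma> (j (x - r *\<^sub>R os_unit X)) - \<omega> (j (x - r *\<^sub>R os_unit X))"
      \<comment> \<open>As for the difference of two products: the change of the normalised state is
        weighted with \<open>weight \<sigma>\<close>, the change of the weight with a value bounded
        by R.\<close>
      have D: "?D =
          of_real (weight \<sigma>) * (pullback \<sigma> x - pullback \<omega> x)
          + of_real (weight \<sigma> - weight \<omega>) * (pullback \<omega> x - of_real r)"
        unfolding eq[OF \<sigma> s] eq[OF \<omega>Z t] by (simp add: algebra_simps)
      have "cmod ?D \<le> weight \<sigma> * cmod (pullback \<sigma> x - pullback \<omega> x)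
          + \<bar>weight \<sigma> - weight \<omega>\<bar> * cmod (pullback \<omega> x - of_real r)"
        unfolding D by (rule order_trans[OF norm_triangle_ineq]) (use s in \<open>simp add: norm_mult del: of_real_diff\<close>)
      also have "\<dots> \<le> 1 * (\<delta> / 2) + \<eta> * R"
        using weight[OF \<sigma>] U1_weight(2)[of \<omega>] \<omega> B(3)[OF _ x] r pullback_state[OF \<omega>Z t] \<eta>(1)
        by (intro add_mono mult_mono) auto
      also have "\<dots> \<le> \<delta>" using \<eta> by simp
      finally show "cmod ?D \<le> \<delta>" .
    qed
  qed
qed

end

section \<open>Lip-norms on direct sums from joint embeddings\<close>

lemma sum_simps:
  "os_space (os_sum X Y) = os_space X \<times> os_space Y"
  "os_unit (os_sum X Y) = (os_unit X, os_unit Y)"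
  by (simp_all add: os_sum_def)

lemma sa_sum_iff: "z \<in> os_sa (os_sum X Y) \<longleftrightarrow> fst z \<in> os_sa X \<and> snd z \<in> os_sa Y"
  by (auto simp: os_sa_def os_sum_def mem_Times_iff prod_eq_iff)

lemma pos_sum_iff: "z \<in> os_pos (os_sum X Y) \<longleftrightarrow> fst z \<in> os_pos X \<and> snd z \<in> os_pos Y"
  using mpos_sum[of X Y 1 "\<lambda>_. z"] by (simp add: os_pos_def mpos_def)

lemma subunital_map_Inl:
  assumes "operator_system X" "operator_system Y"
  shows "subunital_map X (os_sum X Y) (\<lambda>x. (x, 0))"
proof -
  interpret X: operator_system X by fact
  interpret Y: operator_system Y by fact
  interpret Z: operator_system "os_sum X Y" by (rule operator_system_sum) fact+
  have "0 \<in> os_pos X" "0 \<in> os_pos Y"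
    using X.pos_scaleR[OF X.pos_unit, of 0] Y.pos_scaleR[OF Y.pos_unit, of 0] by auto
  then show ?thesis
    by unfold_locales (auto simp: sum_simps pos_sum_iff Y.space_zero Y.pos_unit scaleC_prod_def)
qed

lemma subunital_map_Inr:
  assumes "operator_system X" "operator_system Y"
  shows "subunital_map Y (os_sum X Y) (\<lambda>y. (0, y))"
proof -
  interpret X: operator_system X by fact
  interpret Y: operator_system Y by fact
  interpret Z: operator_system "os_sum X Y" by (rule operator_system_sum) fact+
  have "0 \<in> os_pos X" "0 \<in> os_pos Y"
    using X.pos_scaleR[OF X.pos_unit, of 0] Y.pos_scaleR[OF Y.pos_unit, of 0] by auto
  then show ?thesis
    by unfold_locales (auto simp: sum_simps pos_sum_iff X.space_zero X.pos_unit scaleC_prod_def)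
qed

lemma (in operator_system) matrix_state_diff:
  assumes \<phi>: "\<phi> \<in> matrix_states X n" and "x \<in> os_space X" "y \<in> os_space X"
  shows "\<phi> (x - y) = \<phi> x - \<phi> y"
proof -
  have c: "\<phi> x \<in> carrier_mat n n" "\<phi> y \<in> carrier_mat n n" "\<phi> (x - y) \<in> carrier_mat n n"
    using assms matrix_state_carrier[OF \<phi>] space_diff by auto
  show ?thesis
    using c minus_carrier_mat[OF c(2)] assms matrix_state_index(4)[OF \<phi>]
    by (subst carrier_mat_eq_iff[of _ n]) auto
qed

lemma (in order_embedding) pullback_matrix_state:
  assumes \<Phi>: "\<Phi> \<in> matrix_states V n"
  shows "restrict (\<lambda>x. \<Phi> (h x)) (os_space X) \<in> matrix_states X n"
proof (rule X.restrict_matrix_state)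
  have "mform k n (\<lambda>x. \<Phi> (h x)) f v = mform k n \<Phi> (\<lambda>z. h (f z)) v" for k f v
    by (simp add: mform_def)
  then show "cp_map X n (\<lambda>x. \<Phi> (h x))"
    using \<Phi> map_mpos unfolding V.matrix_states_iff cp_map_def
    by (simp add: map_space map_add map_scaleC)
  show "\<Phi> (h (os_unit X)) = 1\<^sub>m n" using \<Phi> by (simp add: map_unit V.matrix_states_iff)
qed

text \<open>Homogeneity reduces the formula for the quotient seminorm to unit balls:
  \<open>p\<close> does not increase the seminorm, and elements of the ball downstairs lift to the
  ball upstairs.\<close>

lemma quotient_seminorm:
  fixes N :: "'z::real_vector \<Rightarrow> ennreal" and M :: "'x::real_vector \<Rightarrow> ennreal"
  assumes p: "\<And>r z. p (r *\<^sub>R z) = r *\<^sub>R p z" and Z: "\<And>r z. z \<in> Z \<Longrightarrow> r *\<^sub>R z \<in> Z"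
    and N: "\<And>r z. z \<in> Z \<Longrightarrow> N (r *\<^sub>R z) = ennreal \<bar>r\<bar> * N z"
    and M: "\<And>r. M (r *\<^sub>R x) = ennreal \<bar>r\<bar> * M x"
    and le: "\<And>z. z \<in> Z \<Longrightarrow> M (p z) \<le> N z"
    and lift: "\<And>r. M (r *\<^sub>R x) \<le> 1 \<Longrightarrow> \<exists>z\<in>Z. p z = r *\<^sub>R x \<and> N z \<le> 1"
  shows "M x = (INF z\<in>{z \<in> Z. p z = x}. N z)"
proof (rule antisym)
  show "M x \<le> (INF z\<in>{z \<in> Z. p z = x}. N z)" using le by (intro INF_greatest) auto
  show "(INF z\<in>{z \<in> Z. p z = x}. N z) \<le> M x"
  proof (rule ennreal_le_epsilon)
    fix e :: real assume fin: "M x < Orderings.top_class.top" and e: "0 < e"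
    \<comment> \<open>The summand \<open>e\<close> allows division by \<open>c\<close> even if
      \<open>M x\<close> is 0.\<close>
    define c where "c = enn2real (M x) + e"
    have c: "c > 0" using e by (simp add: c_def add_nonneg_pos)
    have Mx: "M x = ennreal (enn2real (M x))" using fin by simp
    have "M ((1 / c) *\<^sub>R x) = ennreal (1 / c * enn2real (M x))"
      unfolding M using c by (subst Mx) (simp add: ennreal_mult[symmetric] del: ennreal_enn2real)
    also have "\<dots> \<le> 1" using e c by (simp add: c_def ennreal_le_1)
    finally obtain z where z: "z \<in> Z" "p z = (1 / c) *\<^sub>R x" "N z \<le> 1" using lift by blast
    have "(INF z\<in>{z \<in> Z. p z = x}. N z) \<le> N (c *\<^sub>R z)"
      using z c Z[OF z(1), of c] by (intro INF_lower) (simp add: p)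
    also have "\<dots> \<le> ennreal c * 1" unfolding N[OF z(1)] using z(3) c by (intro mult_mono) auto
    also have "\<dots> = M x + ennreal e" using e fin by (simp add: c_def)
    finally show "(INF z\<in>{z \<in> Z. p z = x}. N z) \<le> M x + ennreal e" .
  qed
qed

definition joint_lip :: "'v::complex_vector op_system \<Rightarrow> ('x \<Rightarrow> 'v) \<Rightarrow> ('y \<Rightarrow> 'v) \<Rightarrow>
    ('x \<Rightarrow> ennreal) \<Rightarrow> ('y \<Rightarrow> ennreal) \<Rightarrow> real \<Rightarrow> 'x \<times> 'y \<Rightarrow> ennreal" where
  "joint_lip V hX hY LX LY \<epsilon> z =
     max (max (LX (fst z)) (LY (snd z))) (ennreal (os_norm V (hX (fst z) - hY (snd z)) / \<epsilon>))"

text \<open>The number \<epsilon> will exceed the Hausdorff distance strictly. Hence matching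
  elements can be demanded, although the infima need not be attained.\<close>

locale joint_embedding = EX: order_embedding X V hX + EY: order_embedding Y V hY
  for X :: "'x::complex_vector op_system" and Y :: "'y::complex_vector op_system"
    and V :: "'v::complex_vector op_system" and hX hY +
  fixes LX LY and \<epsilon> :: real
  assumes LX: "lip_norm X LX" and LY: "lip_norm Y LY" and eps: "\<epsilon> > 0"
    and matchX: "\<And>x. x \<in> lip_ball X LX \<Longrightarrow> \<exists>y\<in>lip_ball Y LY. os_norm V (hX x - hY y) \<le> \<epsilon>"
    and matchY: "\<And>y. y \<in> lip_ball Y LY \<Longrightarrow> \<exists>x\<in>lip_ball X LX. os_norm V (hX x - hY y) \<le> \<epsilon>"
begin

abbreviation "Z \<equiv> os_sum X Y"
abbreviation "L \<equiv> joint_lip V hX hY LX LY \<epsilon>"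

sublocale Z: operator_system Z
  by (rule operator_system_sum) unfold_locales

sublocale jX: subunital_map X Z "\<lambda>x. (x, 0)"
  by (rule subunital_map_Inl) unfold_locales

sublocale jY: subunital_map Y Z "\<lambda>y. (0, y)"
  by (rule subunital_map_Inr) unfold_locales

lemma LX_simps:
  "x \<in> os_sa X \<Longrightarrow> x' \<in> os_sa X \<Longrightarrow> LX (x + x') \<le> LX x + LX x'"
  "x \<in> os_sa X \<Longrightarrow> LX (r *\<^sub>R x) = ennreal \<bar>r\<bar> * LX x" "LX (r *\<^sub>R os_unit X) = 0"
  using LX by (simp_all add: lip_norm_def)

lemma LY_simps:
  "y \<in> os_sa Y \<Longrightarrow> y' \<in> os_sa Y \<Longrightarrow> LY (y + y') \<le> LY y + LY y'"
  "y \<in> os_sa Y \<Longrightarrow> LY (r *\<^sub>R y) = ennreal \<bar>r\<bar> * LY y" "LY (r *\<^sub>R os_unit Y) = 0"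
  using LY by (simp_all add: lip_norm_def)

lemma diff_sa: "z \<in> os_sa Z \<Longrightarrow> hX (fst z) - hY (snd z) \<in> os_sa V"
  by (simp add: sa_sum_iff EX.V.sa_diff EX.map_sa EY.map_sa)

lemma L_add:
  assumes z: "z \<in> os_sa Z" and w: "w \<in> os_sa Z" shows "L (z + w) \<le> L z + L w"
proof -
  have s: "fst z \<in> os_sa X" "snd z \<in> os_sa Y" "fst w \<in> os_sa X" "snd w \<in> os_sa Y"
    using z w by (auto simp: sa_sum_iff)
  have "LX (fst (z + w)) \<le> L z + L w"
    using LX_simps(1)[OF s(1,3)] unfolding joint_lip_def fst_add
    by (rule order_trans) (intro add_mono max.coboundedI1 order_refl)
  moreover have "LY (snd (z + w)) \<le> L z + L w"
    using LY_simps(1)[OF s(2,4)] unfolding joint_lip_def snd_add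
    by (rule order_trans) (intro add_mono max.coboundedI1 max.coboundedI2 order_refl)
  moreover have "ennreal (os_norm V (hX (fst (z + w)) - hY (snd (z + w))) / \<epsilon>) \<le> L z + L w"
  proof -
    have "hX (fst (z + w)) - hY (snd (z + w)) = (hX (fst z) - hY (snd z)) + (hX (fst w) - hY (snd w))"
      using s by (simp add: EX.map_add EY.map_add EX.X.sa_space EY.X.sa_space)
    then have "os_norm V (hX (fst (z + w)) - hY (snd (z + w))) / \<epsilon>
        \<le> os_norm V (hX (fst z) - hY (snd z)) / \<epsilon> + os_norm V (hX (fst w) - hY (snd w)) / \<epsilon>"
      using EX.V.os_norm_triangle[OF diff_sa[OF z] diff_sa[OF w]] eps
      by (simp add: divide_right_mono flip: add_divide_distrib)
    then have "ennreal (os_norm V (hX (fst (z + w)) - hY (snd (z + w))) / \<epsilon>)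
        \<le> ennreal (os_norm V (hX (fst z) - hY (snd z)) / \<epsilon>) + ennreal (os_norm V (hX (fst w) - hY (snd w)) / \<epsilon>)"
      using EX.V.os_norm_nonneg[OF diff_sa[OF z]] EX.V.os_norm_nonneg[OF diff_sa[OF w]] eps
      by (subst ennreal_plus[symmetric]) (auto intro!: ennreal_leI simp del: ennreal_plus)
    also have "\<dots> \<le> L z + L w" unfolding joint_lip_def by (intro add_mono max.coboundedI2 order_refl)
    finally show ?thesis .
  qed
  ultimately show ?thesis unfolding joint_lip_def[of _ _ _ _ _ _ "z + w"] by simp
qed

lemma L_scaleR:
  assumes z: "z \<in> os_sa Z" shows "L (r *\<^sub>R z) = ennreal \<bar>r\<bar> * L z"
proof -
  have s: "fst z \<in> os_sa X" "snd z \<in> os_sa Y" using z by (auto simp: sa_sum_iff)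
  have m: "mono ((*) (ennreal \<bar>r\<bar>))" by (intro monoI mult_left_mono) auto
  have "hX (fst (r *\<^sub>R z)) - hY (snd (r *\<^sub>R z)) = r *\<^sub>R (hX (fst z) - hY (snd z))"
    using s by (simp add: EX.map_scaleR EY.map_scaleR EX.X.sa_space EY.X.sa_space scaleR_diff_right)
  then have "ennreal (os_norm V (hX (fst (r *\<^sub>R z)) - hY (snd (r *\<^sub>R z))) / \<epsilon>)
      = ennreal \<bar>r\<bar> * ennreal (os_norm V (hX (fst z) - hY (snd z)) / \<epsilon>)"
    using EX.V.os_norm_scaleR[OF diff_sa[OF z]] EX.V.os_norm_nonneg[OF diff_sa[OF z]] eps
    by (simp add: ennreal_mult[symmetric])
  then show ?thesis using s
    unfolding joint_lip_def by (simp add: LX_simps LY_simps max_of_mono[OF m])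
qed

lemma L_unit: "L (r *\<^sub>R os_unit Z) = 0"
  by (simp add: joint_lip_def sum_simps LX_simps LY_simps EX.map_scaleR EY.map_scaleR
      EX.X.unit_closed EY.X.unit_closed EX.map_unit EY.map_unit EX.V.os_norm_zero)

lemma L_ball: "z \<in> lip_ball Z L \<longleftrightarrow> fst z \<in> lip_ball X LX \<and> snd z \<in> lip_ball Y LY \<and>
    os_norm V (hX (fst z) - hY (snd z)) \<le> \<epsilon>"
  using eps by (auto simp: lip_ball_def sa_sum_iff joint_lip_def ennreal_le_1 divide_le_eq_1)

text \<open>An element with finite seminorm can be scaled into the Lip-ball, so states that agree on
  the ball agree at it.\<close>

lemma L_finite_zero:
  assumes L: "L z < \<infinity>" and z: "z \<in> os_sa Z" and s: "\<sigma> \<in> state_space Z" "\<omega> \<in> state_space Z"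
    and e: "\<And>z. z \<in> lip_ball Z L \<Longrightarrow> \<sigma> z = \<omega> z"
  shows "\<sigma> z = \<omega> z"
proof -
  define c where "c = enn2real (L z) + 1"
  have c: "c > 0" by (simp add: c_def add_nonneg_pos)
  have "L ((1/c) *\<^sub>R z) = ennreal (1/c) * ennreal (enn2real (L z))"
    using L c by (simp add: L_scaleR[OF z])
  also have "\<dots> = ennreal (1/c * enn2real (L z))" using c by (subst ennreal_mult) auto
  also have "\<dots> \<le> 1" using c by (simp add: c_def ennreal_le_1)
  finally have "(1/c) *\<^sub>R z \<in> lip_ball Z L" using z by (simp add: lip_ball_def Z.sa_scaleR)
  from e[OF this] c show ?thesis
    by (simp add: Z.state_scaleR[OF s(1) Z.sa_space[OF z]] Z.state_scaleR[OF s(2) Z.sa_space[OF z]])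
qed

text \<open>The coupling term is always finite, so (x, 0) has finite \<open>L\<close> as soon as
  \<open>LX x\<close> is finite, and likewise for (0, y). For the units this shows that the weights
  agree; each summand is then settled separately by \<open>map_separates\<close>.\<close>

lemma states_separated:
  assumes s: "\<sigma> \<in> state_space Z" "\<omega> \<in> state_space Z"
    and e: "\<And>z. z \<in> lip_ball Z L \<Longrightarrow> \<sigma> z = \<omega> z"
  shows "\<sigma> = \<omega>"
proof -
  have zero: "LX 0 = 0" "LY 0 = 0" using LX_simps(3)[of 0] LY_simps(3)[of 0] by simp_all
  have X: "\<sigma> (x, 0) = \<omega> (x, 0)" if "x \<in> os_sa X" "LX x < \<infinity>" for x
    using that by (intro L_finite_zero[OF _ _ s e])
      (simp_all add: joint_lip_def zero sa_sum_iff EY.X.sa_zero)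
  have Y: "\<sigma> (0, y) = \<omega> (0, y)" if "y \<in> os_sa Y" "LY y < \<infinity>" for y
    using that by (intro L_finite_zero[OF _ _ s e])
      (simp_all add: joint_lip_def zero sa_sum_iff EX.X.sa_zero)
  have "LX (os_unit X) = 0" "LY (os_unit Y) = 0" using LX_simps(3)[of 1] LY_simps(3)[of 1] by simp_all
  then have w: "jX.weight \<sigma> = jX.weight \<omega>" "jY.weight \<sigma> = jY.weight \<omega>"
    using X[OF EX.X.sa_unit] Y[OF EY.X.sa_unit] by (simp_all add: jX.weight_def jY.weight_def)
  have bX: "\<sigma> (x, 0) = \<omega> (x, 0)" if "x \<in> lip_ball X LX" for x
    using that X order_le_less_trans[of "LX x" 1 \<infinity>] by (simp add: lip_ball_def)
  have bY: "\<sigma> (0, y) = \<omega> (0, y)" if "y \<in> lip_ball Y LY" for y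
    using that Y order_le_less_trans[of "LY y" 1 \<infinity>] by (simp add: lip_ball_def)
  show ?thesis
  proof (rule Z.state_eqI[OF s])
    fix z assume "z \<in> os_space Z"
    then have z: "fst z \<in> os_space X" "snd z \<in> os_space Y" by (auto simp: sum_simps)
    have split: "\<rho> z = \<rho> (fst z, 0) + \<rho> (0, snd z)" if "\<rho> \<in> state_space Z" for \<rho>
      using Z.state_add[OF that jX.map_space[OF z(1)] jY.map_space[OF z(2)]] by simp
    show "\<sigma> z = \<omega> z"
      unfolding split[OF s(1)] split[OF s(2)]
      using jX.map_separates[OF LX s w(1) bX z(1)] jY.map_separates[OF LY s w(2) bY z(2)] by simp
  qed
qed

text \<open>Since (r1, r1) is a multiple of the unit, it contributes a constant. Only the difference
  t - r of the two scalars meets a quantity that depends on the state.\<close>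

lemma state_split:
  assumes s: "\<sigma> \<in> state_space Z" and x: "x \<in> os_space X" and y: "y \<in> os_space Y"
  shows "\<sigma> (x, y) = \<sigma> (x - r *\<^sub>R os_unit X, 0) + \<sigma> (0, y - t *\<^sub>R os_unit Y)
    + of_real r + of_real (t - r) * \<sigma> (0, os_unit Y)"
proof -
  have "(x, y) = (x - r *\<^sub>R os_unit X, 0) + (0, y - t *\<^sub>R os_unit Y)
      + r *\<^sub>R os_unit Z + (t - r) *\<^sub>R (0, os_unit Y)"
    by (simp add: sum_simps algebra_simps)
  moreover have "(x - r *\<^sub>R os_unit X, 0) \<in> os_space Z" "(0, y - t *\<^sub>R os_unit Y) \<in> os_space Z"
    "(0, os_unit Y) \<in> os_space Z"
    using x y by (auto intro!: jX.map_space jY.map_space EX.X.space_diff EY.X.space_diff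
        EX.X.space_scaleR EY.X.space_scaleR EX.X.unit_closed EY.X.unit_closed)
  ultimately show ?thesis
    using s by (simp only: Z.state_add Z.state_scaleR Z.state_unit Z.space_add Z.space_scaleR
        Z.unit_closed mult_1_right)
qed

text \<open>A state of \<open>V\<close>, restricted along both embeddings, takes a value within
  \<open>RX\<close> of r at the first coordinate and within \<open>RY\<close> of t at the second,
  and these values differ by at most \<epsilon>.\<close>

lemma joint_shift:
  assumes ne: "state_space Z \<noteq> {}"
    and RX: "\<And>x. x \<in> lip_ball X LX \<Longrightarrow> \<exists>r. \<forall>\<sigma>\<in>state_space X. cmod (\<sigma> x - of_real r) \<le> RX"
    and RY: "\<And>y. y \<in> lip_ball Y LY \<Longrightarrow> \<exists>r. \<forall>\<sigma>\<in>state_space Y. cmod (\<sigma> y - of_real r) \<le> RY"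
    and z: "z \<in> lip_ball Z L"
  obtains r t where "\<forall>\<sigma>\<in>state_space X. cmod (\<sigma> (fst z) - of_real r) \<le> RX"
    "\<forall>\<sigma>\<in>state_space Y. cmod (\<sigma> (snd z) - of_real t) \<le> RY" "\<bar>t - r\<bar> \<le> RX + RY + \<epsilon>"
proof -
  note b = z[unfolded L_ball]
  obtain r t where r: "\<forall>\<sigma>\<in>state_space X. cmod (\<sigma> (fst z) - of_real r) \<le> RX"
    and t: "\<forall>\<sigma>\<in>state_space Y. cmod (\<sigma> (snd z) - of_real t) \<le> RY" using RX RY b by blast
  have sa: "fst z \<in> os_sa X" "snd z \<in> os_sa Y" "z \<in> os_sa Z" using b by (auto simp: lip_ball_def sa_sum_iff)
  \<comment> \<open>The existence of a state of the sum is passed on to \<open>V\<close> through the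
    units.\<close>
  have "os_unit Z \<noteq> 0" using ne Z.state_unit Z.state_zero by fastforce
  then have "os_unit X \<noteq> 0 \<or> os_unit Y \<noteq> 0" by (auto simp: sum_simps zero_prod_def)
  then have "os_unit V \<noteq> 0"
    using inj_onD[OF EX.map_inj, of "os_unit X" 0] inj_onD[OF EY.map_inj, of "os_unit Y" 0]
    by (auto simp: EX.map_unit EY.map_unit EX.map_zero EY.map_zero EX.X.unit_closed EY.X.unit_closed
        EX.X.space_zero EY.X.space_zero)
  then obtain \<psi> where \<psi>: "\<psi> \<in> state_space V" using EX.V.exists_state by blast
  note \<Psi> = EX.V.state_matrix_state[OF \<psi>]
  have "cmod (\<psi> (hX (fst z)) - of_real r) \<le> RX"
    using r EX.X.matrix_state_1[OF EX.pullback_matrix_state[OF \<Psi>]] sa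
    by (fastforce simp: EX.X.sa_space EX.map_space)
  moreover have "cmod (\<psi> (hY (snd z)) - of_real t) \<le> RY"
    using t EY.X.matrix_state_1[OF EY.pullback_matrix_state[OF \<Psi>]] sa
    by (fastforce simp: EY.X.sa_space EY.map_space)
  moreover have "cmod (\<psi> (hX (fst z)) - \<psi> (hY (snd z))) \<le> \<epsilon>"
    using EX.V.state_norm_bound[OF \<psi> diff_sa[OF sa(3)]] b \<psi> sa
    by (simp add: EX.V.state_diff EX.map_space EY.map_space EX.X.sa_space EY.X.sa_space)
  ultimately have "cmod (of_real t - of_real r) \<le> RX + RY + \<epsilon>"
    using norm_triangle_ineq[of "(\<psi> (hX (fst z)) - of_real r) - (\<psi> (hX (fst z)) - \<psi> (hY (snd z)))" "- (\<psi> (hY (snd z)) - of_real t)"]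
      norm_triangle_ineq4[of "\<psi> (hX (fst z)) - of_real r" "\<psi> (hX (fst z)) - \<psi> (hY (snd z))"]
    by (simp add: norm_minus_commute)
  then have "\<bar>t - r\<bar> \<le> RX + RY + \<epsilon>" by (simp flip: of_real_diff)
  then show thesis using that r t by blast
qed

text \<open>On an element of the Lip-ball two states differ by at most a contribution from X, one
  from Y, and \<open>K\<close> times the difference of weights. The scalars r and t depend on the
  element alone, so the three contributions are bounded uniformly over the ball and are uniformly
  small on a weak* neighbourhood.\<close>

lemma lip_norm_L: "lip_norm Z L"
proof -
  obtain RX where RX: "0 \<le> RX"
    "\<And>x. x \<in> lip_ball X LX \<Longrightarrow> \<exists>r. \<forall>\<sigma>\<in>state_space X. cmod (\<sigma> x - of_real r) \<le> RX"
    using EX.X.lip_norm_bounded[OF LX] by blast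
  obtain RY where RY: "0 \<le> RY"
    "\<And>x. x \<in> lip_ball Y LY \<Longrightarrow> \<exists>r. \<forall>\<sigma>\<in>state_space Y. cmod (\<sigma> x - of_real r) \<le> RY"
    using EY.X.lip_norm_bounded[OF LY] by blast
  define K where "K = RX + RY + \<epsilon>"
  have K: "K > 0" using RX(1) RY(1) eps by (simp add: K_def)
  have diff: "\<exists>r t. (\<forall>\<sigma>\<in>state_space X. cmod (\<sigma> (fst z) - of_real r) \<le> RX) \<and>
      (\<forall>\<sigma>\<in>state_space Y. cmod (\<sigma> (snd z) - of_real t) \<le> RY) \<and>
      (\<forall>\<sigma>\<in>state_space Z. \<forall>\<omega>\<in>state_space Z. cmod (\<sigma> z - \<omega> z) \<le>
        cmod (\<sigma> (fst z - r *\<^sub>R os_unit X, 0) - \<omega> (fst z - r *\<^sub>R os_unit X, 0))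
        + cmod (\<sigma> (0, snd z - t *\<^sub>R os_unit Y) - \<omega> (0, snd z - t *\<^sub>R os_unit Y))
        + K * cmod (\<sigma> (0, os_unit Y) - \<omega> (0, os_unit Y)))"
    if z: "z \<in> lip_ball Z L" and ne: "state_space Z \<noteq> {}" for z
  proof -
    obtain r t where rt: "\<forall>\<sigma>\<in>state_space X. cmod (\<sigma> (fst z) - of_real r) \<le> RX"
      "\<forall>\<sigma>\<in>state_space Y. cmod (\<sigma> (snd z) - of_real t) \<le> RY" "\<bar>t - r\<bar> \<le> K"
      using joint_shift[OF ne RX(2) RY(2) z] unfolding K_def by blast
    have zs: "fst z \<in> os_space X" "snd z \<in> os_space Y"
      using z by (auto simp: lip_ball_def sa_sum_iff intro: EX.X.sa_space EY.X.sa_space)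
    have "cmod (\<sigma> z - \<omega> z) \<le>
        cmod (\<sigma> (fst z - r *\<^sub>R os_unit X, 0) - \<omega> (fst z - r *\<^sub>R os_unit X, 0))
        + cmod (\<sigma> (0, snd z - t *\<^sub>R os_unit Y) - \<omega> (0, snd z - t *\<^sub>R os_unit Y))
        + K * cmod (\<sigma> (0, os_unit Y) - \<omega> (0, os_unit Y))"
      if s: "\<sigma> \<in> state_space Z" "\<omega> \<in> state_space Z" for \<sigma> \<omega>
    proof -
      let ?a = "\<sigma> (fst z - r *\<^sub>R os_unit X, 0) - \<omega> (fst z - r *\<^sub>R os_unit X, 0)"
      let ?b = "\<sigma> (0, snd z - t *\<^sub>R os_unit Y) - \<omega> (0, snd z - t *\<^sub>R os_unit Y)"
      let ?c = "of_real (t - r) * (\<sigma> (0, os_unit Y) - \<omega> (0, os_unit Y))"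
      have split: "\<rho> z = \<rho> (fst z - r *\<^sub>R os_unit X, 0) + \<rho> (0, snd z - t *\<^sub>R os_unit Y)
          + of_real r + of_real (t - r) * \<rho> (0, os_unit Y)" if "\<rho> \<in> state_space Z" for \<rho>
        using state_split[OF that zs, of r t] by simp
      have e: "\<sigma> z - \<omega> z = ?a + ?b + ?c"
        unfolding split[OF s(1)] split[OF s(2)] by (simp add: algebra_simps)
      have "cmod (\<sigma> z - \<omega> z) \<le> cmod ?a + cmod ?b + cmod ?c"
        unfolding e by (rule norm_triangle_le[OF add_right_mono[OF norm_triangle_ineq]])
      moreover have "cmod ?c \<le> K * cmod (\<sigma> (0, os_unit Y) - \<omega> (0, os_unit Y))"
        unfolding norm_mult norm_of_real using rt(3) by (rule mult_right_mono) simp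
      ultimately show ?thesis by linarith
    qed
    then show ?thesis using rt by blast
  qed
  show ?thesis
  proof (rule Z.lip_normI[OF L_add L_scaleR L_unit _ states_separated])
    fix \<sigma> \<omega> assume s: "\<sigma> \<in> state_space Z" "\<omega> \<in> state_space Z"
    have "cmod (\<sigma> z - \<omega> z) \<le> 2 * RX + 2 * RY + K * 2" if z: "z \<in> lip_ball Z L" for z
    proof -
      obtain r t where rt: "\<forall>\<sigma>\<in>state_space X. cmod (\<sigma> (fst z) - of_real r) \<le> RX"
        "\<forall>\<sigma>\<in>state_space Y. cmod (\<sigma> (snd z) - of_real t) \<le> RY"
        and d: "cmod (\<sigma> z - \<omega> z) \<le>
        cmod (\<sigma> (fst z - r *\<^sub>R os_unit X, 0) - \<omega> (fst z - r *\<^sub>R os_unit X, 0))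
        + cmod (\<sigma> (0, snd z - t *\<^sub>R os_unit Y) - \<omega> (0, snd z - t *\<^sub>R os_unit Y))
        + K * cmod (\<sigma> (0, os_unit Y) - \<omega> (0, os_unit Y))"
        using diff[OF z] s by blast
      have zs: "fst z \<in> os_space X" "snd z \<in> os_space Y"
        using z by (auto simp: lip_ball_def sa_sum_iff intro: EX.X.sa_space EY.X.sa_space)
      have bX: "cmod (\<rho> (fst z - r *\<^sub>R os_unit X, 0)) \<le> RX" if \<rho>: "\<rho> \<in> state_space Z" for \<rho>
        by (rule order_trans[OF jX.map_shift_bound[OF \<rho> zs(1) RX(1) rt(1)]])
          (use jX.weight[OF \<rho>] RX(1) in \<open>simp add: mult_left_le_one_le\<close>)
      have bY: "cmod (\<rho> (0, snd z - t *\<^sub>R os_unit Y)) \<le> RY" if \<rho>: "\<rho> \<in> state_space Z" for \<rho>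
        by (rule order_trans[OF jY.map_shift_bound[OF \<rho> zs(2) RY(1) rt(2)]])
          (use jY.weight[OF \<rho>] RY(1) in \<open>simp add: mult_left_le_one_le\<close>)
      have b1: "cmod (\<rho> (0, os_unit Y)) \<le> 1" if \<rho>: "\<rho> \<in> state_space Z" for \<rho>
        using jY.weight[OF \<rho>] by simp
      have "K * cmod (\<sigma> (0, os_unit Y) - \<omega> (0, os_unit Y)) \<le> K * 2"
        using norm_triangle_ineq4[of "\<sigma> (0, os_unit Y)" "\<omega> (0, os_unit Y)"] b1[OF s(1)] b1[OF s(2)] K
        by (intro mult_left_mono) auto
      then show ?thesis
        using d norm_triangle_ineq4[of "\<sigma> (fst z - r *\<^sub>R os_unit X, 0)" "\<omega> (fst z - r *\<^sub>R os_unit X, 0)"]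
          norm_triangle_ineq4[of "\<sigma> (0, snd z - t *\<^sub>R os_unit Y)" "\<omega> (0, snd z - t *\<^sub>R os_unit Y)"]
          bX[OF s(1)] bX[OF s(2)] bY[OF s(1)] bY[OF s(2)] by linarith
    qed
    then have "lip_dist Z L \<sigma> \<omega> \<le> ennreal (2 * RX + 2 * RY + K * 2)"
      unfolding lip_dist_eq by (auto intro: ennreal_leI)
    then show "lip_dist Z L \<sigma> \<omega> < \<infinity>" by (rule order_le_less_trans) simp
  next
    fix \<sigma> and \<delta> :: real assume \<sigma>: "\<sigma> \<in> state_space Z" and \<delta>: "\<delta> > 0"
    obtain U1 where U1: "openin (weak_star Z) U1" "\<sigma> \<in> U1"
      "\<And>\<omega> x r. \<omega> \<in> U1 \<Longrightarrow> x \<in> lip_ball X LX \<Longrightarrow> \<forall>\<tau>\<in>state_space X. cmod (\<tau> x - of_real r) \<le> RX \<Longrightarrow>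
        cmod (\<sigma> (x - r *\<^sub>R os_unit X, 0) - \<omega> (x - r *\<^sub>R os_unit X, 0)) \<le> \<delta> / 3"
      using jX.map_equicontinuous[OF LX \<sigma> _ RX(1), of "\<delta>/3"] \<delta> by auto
    obtain U2 where U2: "openin (weak_star Z) U2" "\<sigma> \<in> U2"
      "\<And>\<omega> x r. \<omega> \<in> U2 \<Longrightarrow> x \<in> lip_ball Y LY \<Longrightarrow> \<forall>\<tau>\<in>state_space Y. cmod (\<tau> x - of_real r) \<le> RY \<Longrightarrow>
        cmod (\<sigma> (0, x - r *\<^sub>R os_unit Y) - \<omega> (0, x - r *\<^sub>R os_unit Y)) \<le> \<delta> / 3"
      using jY.map_equicontinuous[OF LY \<sigma> _ RY(1), of "\<delta>/3"] \<delta> by auto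
    \<comment> \<open>The scalar difference t - r is at most \<open>K\<close>, so weights within
      this tolerance contribute at most a third of \<delta>.\<close>
    define U3 where "U3 = {\<omega> \<in> state_space Z. cmod (\<omega> (0, os_unit Y) - \<sigma> (0, os_unit Y)) < \<delta> / (3 * K)}"
    have U3: "openin (weak_star Z) U3" "\<sigma> \<in> U3"
      using openin_cmod_less[OF continuous_map_eval[OF jY.map_space[OF EY.X.unit_closed]],
          of "\<sigma> (0, os_unit Y)" "\<delta> / (3 * K)"] \<sigma> \<delta> K
      by (simp_all add: U3_def topspace_weak_star)
    have "cmod (\<sigma> z - \<omega> z) \<le> \<delta>" if \<omega>: "\<omega> \<in> U1 \<inter> (U2 \<inter> U3)" and z: "z \<in> lip_ball Z L" for \<omega> z
    proof -
      have \<omega>S: "\<omega> \<in> state_space Z" using \<omega> by (simp add: U3_def)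
      obtain r t where rt: "\<forall>\<sigma>\<in>state_space X. cmod (\<sigma> (fst z) - of_real r) \<le> RX"
        "\<forall>\<sigma>\<in>state_space Y. cmod (\<sigma> (snd z) - of_real t) \<le> RY"
        and d: "cmod (\<sigma> z - \<omega> z) \<le>
        cmod (\<sigma> (fst z - r *\<^sub>R os_unit X, 0) - \<omega> (fst z - r *\<^sub>R os_unit X, 0))
        + cmod (\<sigma> (0, snd z - t *\<^sub>R os_unit Y) - \<omega> (0, snd z - t *\<^sub>R os_unit Y))
        + K * cmod (\<sigma> (0, os_unit Y) - \<omega> (0, os_unit Y))"
        using diff[OF z] \<sigma> \<omega>S by blast
      have "K * cmod (\<sigma> (0, os_unit Y) - \<omega> (0, os_unit Y)) \<le> K * (\<delta> / (3 * K))"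
        using \<omega> K by (intro mult_left_mono) (simp_all add: U3_def norm_minus_commute)
      also have "\<dots> = \<delta> / 3" using K by simp
      finally show ?thesis using d U1(3)[of \<omega>, OF _ _ rt(1)] U2(3)[of \<omega>, OF _ _ rt(2)] \<omega> z
        by (simp add: L_ball)
    qed
    then show "\<exists>U. openin (weak_star Z) U \<and> \<sigma> \<in> U \<and> (\<forall>\<omega>\<in>U. \<forall>x\<in>lip_ball Z L. cmod (\<sigma> x - \<omega> x) \<le> \<delta>)"
      using U1 U2 U3 by (intro exI[of _ "U1 \<inter> (U2 \<inter> U3)"]) auto
  qed
qed

text \<open>The matching hypotheses lift each element of either Lip-ball to the Lip-ball of the sum,
  which is what the quotient formula asks for.\<close>

lemma admissible_L: "admissible X LX Y LY L"
proof -
  have leX: "LX (fst z) \<le> L z" and leY: "LY (snd z) \<le> L z" for z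
    by (simp_all add: joint_lip_def le_max_iff_disj)
  have liftX: "\<exists>z\<in>os_sa Z. fst z = x \<and> L z \<le> 1" if x: "x \<in> os_sa X" "LX x \<le> 1" for x
  proof -
    obtain y where y: "y \<in> lip_ball Y LY" "os_norm V (hX x - hY y) \<le> \<epsilon>"
      using matchX[of x] x by (auto simp: lip_ball_def)
    then have "(x, y) \<in> lip_ball Z L" using x by (simp add: L_ball) (simp add: lip_ball_def)
    then show ?thesis by (intro bexI[of _ "(x, y)"]) (simp_all add: lip_ball_def)
  qed
  have liftY: "\<exists>z\<in>os_sa Z. snd z = y \<and> L z \<le> 1" if y: "y \<in> os_sa Y" "LY y \<le> 1" for y
  proof -
    obtain x where x: "x \<in> lip_ball X LX" "os_norm V (hX x - hY y) \<le> \<epsilon>"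
      using matchY[of y] y by (auto simp: lip_ball_def)
    then have "(x, y) \<in> lip_ball Z L" using y by (simp add: L_ball) (simp add: lip_ball_def)
    then show ?thesis by (intro bexI[of _ "(x, y)"]) (simp_all add: lip_ball_def)
  qed
  show ?thesis
    unfolding admissible_def
  proof (intro conjI ballI)
    show "LX x = (INF z\<in>{z \<in> os_sa Z. fst z = x}. L z)" if "x \<in> os_sa X" for x
      using that by (intro quotient_seminorm)
        (auto simp: L_scaleR LX_simps leX intro: liftX Z.sa_scaleR EX.X.sa_scaleR)
    show "LY y = (INF z\<in>{z \<in> os_sa Z. snd z = y}. L z)" if "y \<in> os_sa Y" for y
      using that by (intro quotient_seminorm)
        (auto simp: L_scaleR LY_simps leY intro: liftY Z.sa_scaleR EY.X.sa_scaleR)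
  qed (rule lip_norm_L)
qed

text \<open>The difference of the two restrictions at (x, y) is the value of \<Phi> at
  \<open>hX x - hY y\<close>, and \<Phi> is contractive on self-adjoint elements.\<close>

lemma extension_close:
  assumes \<Phi>: "\<Phi> \<in> matrix_states V n"
    and \<phi>: "\<And>x. x \<in> os_space X \<Longrightarrow> \<Phi> (hX x) = \<phi> x" and \<psi>: "\<And>y. y \<in> os_space Y \<Longrightarrow> \<Phi> (hY y) = \<psi> y"
  shows "lip_mat_dist Z L (restrict (\<phi> \<circ> fst) (os_space Z)) (restrict (\<psi> \<circ> snd) (os_space Z)) \<le> ennreal \<epsilon>"
  unfolding lip_mat_dist_def
proof (rule SUP_least)
  fix z assume z: "z \<in> lip_ball Z L"
  then have sa: "z \<in> os_sa Z" by (simp add: lip_ball_def)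
  then have s: "fst z \<in> os_space X" "snd z \<in> os_space Y" "z \<in> os_space Z"
    by (auto simp: sa_sum_iff EX.X.sa_space EY.X.sa_space Z.sa_space)
  have "\<phi> (fst z) - \<psi> (snd z) = \<Phi> (hX (fst z) - hY (snd z))"
    using EX.V.matrix_state_diff[OF \<Phi> EX.map_space[OF s(1)] EY.map_space[OF s(2)]] \<phi>[OF s(1)] \<psi>[OF s(2)]
    by simp
  then have "op_norm (\<phi> (fst z) - \<psi> (snd z)) \<le> os_norm V (hX (fst z) - hY (snd z))"
    using EX.V.matrix_state_contractive[OF \<Phi> diff_sa[OF sa]] by simp
  also have "\<dots> \<le> \<epsilon>" using z by (simp add: L_ball)
  finally show "ennreal (op_norm (restrict (\<phi> \<circ> fst) (os_space Z) z - restrict (\<psi> \<circ> snd) (os_space Z) z)) \<le> ennreal \<epsilon>"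
    using s(3) by (simp add: ennreal_leI)
qed

lemma dist_s_le: "dist_s X LX Y LY \<le> ennreal \<epsilon>"
  unfolding dist_s_def
proof (rule INF_lower2[of L])
  show "L \<in> {L. admissible X LX Y LY L}" using admissible_L by simp
  let ?d = "lip_mat_dist Z L"
  let ?A = "\<lambda>n. (\<lambda>\<phi>. restrict (\<phi> \<circ> fst) (os_space Z)) ` matrix_states X n"
  let ?B = "\<lambda>n. (\<lambda>\<psi>. restrict (\<psi> \<circ> snd) (os_space Z)) ` matrix_states Y n"
  have A: "(INF b\<in>?B n. ?d a b) \<le> ennreal \<epsilon>" if a: "a \<in> ?A n" for a n
  proof -
    obtain \<phi> where \<phi>: "\<phi> \<in> matrix_states X n" "a = restrict (\<phi> \<circ> fst) (os_space Z)" using a by blast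
    obtain \<Phi> where \<Phi>: "\<Phi> \<in> matrix_states V n" "\<And>x. x \<in> os_space X \<Longrightarrow> \<Phi> (hX x) = \<phi> x"
      using EX.arveson_extension[OF \<phi>(1)] by blast
    define \<psi> where "\<psi> = restrict (\<lambda>y. \<Phi> (hY y)) (os_space Y)"
    have "?d a (restrict (\<psi> \<circ> snd) (os_space Z)) \<le> ennreal \<epsilon>"
      unfolding \<phi>(2) by (rule extension_close[OF \<Phi>]) (simp_all add: \<psi>_def)
    then show ?thesis
      using EY.pullback_matrix_state[OF \<Phi>(1)] by (intro INF_lower2) (auto simp: \<psi>_def)
  qed
  have B: "(INF a\<in>?A n. ?d a b) \<le> ennreal \<epsilon>" if b: "b \<in> ?B n" for b n
  proof -
    obtain \<psi> where \<psi>: "\<psi> \<in> matrix_states Y n" "b = restrict (\<psi> \<circ> snd) (os_space Z)" using b by blast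
    obtain \<Phi> where \<Phi>: "\<Phi> \<in> matrix_states V n" "\<And>y. y \<in> os_space Y \<Longrightarrow> \<Phi> (hY y) = \<psi> y"
      using EY.arveson_extension[OF \<psi>(1)] by blast
    define \<phi> where "\<phi> = restrict (\<lambda>x. \<Phi> (hX x)) (os_space X)"
    have "?d (restrict (\<phi> \<circ> fst) (os_space Z)) b \<le> ennreal \<epsilon>"
      unfolding \<psi>(2) by (rule extension_close[OF \<Phi>(1) _ \<Phi>(2)]) (simp_all add: \<phi>_def)
    then show ?thesis
      using EX.pullback_matrix_state[OF \<Phi>(1)] by (intro INF_lower2) (auto simp: \<phi>_def)
  qed
  show "(SUP n\<in>{1..}. hausdorff ?d (?A n) (?B n)) \<le> ennreal \<epsilon>"
    unfolding hausdorff_def by (intro SUP_least max.boundedI A B)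
qed

end

theorem dist_s_le_dist_op:
  fixes X :: "'x::complex_vector op_system" and Y :: "'y::complex_vector op_system"
  assumes X: "lip_normed_op_system X LX" and Y: "lip_normed_op_system Y LY"
  shows "dist_s X LX Y LY \<le> dist_op TYPE('v::complex_vector) X LX Y LY"
  unfolding dist_op_def
proof (rule INF_greatest, clarify)
  fix V :: "('x \<times> 'y \<times> 'v) op_system" and hX hY
  assume V: "operator_system V" and hX: "complete_order_embedding X V hX"
    and hY: "complete_order_embedding Y V hY"
  let ?d = "\<lambda>v w. ennreal (os_norm V (v - w))"
  let ?A = "hX ` lip_ball X LX" and ?B = "hY ` lip_ball Y LY"
  let ?D = "hausdorff ?d ?A ?B"
  show "dist_s X LX Y LY \<le> ?D"
  proof (rule ennreal_le_epsilon)
    fix e :: real assume fin: "?D < Orderings.top_class.top" and e: "0 < e"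
    define \<epsilon> where "\<epsilon> = enn2real ?D + e"
    have \<epsilon>: "\<epsilon> > 0" using e by (simp add: \<epsilon>_def add_nonneg_pos)
    have D: "?D + ennreal e = ennreal \<epsilon>" using fin e by (simp add: \<epsilon>_def)
    \<comment> \<open>Strictness turns the infima in the Hausdorff distance into elements that
      match.\<close>
    have less: "?D < ennreal \<epsilon>" unfolding D[symmetric] using fin e by (simp add: ennreal_add_left_cancel_less)
    have A: "\<exists>b\<in>?B. ?d a b < ennreal \<epsilon>" if "a \<in> ?A" for a
    proof -
      have "(INF b\<in>?B. ?d a b) \<le> ?D" unfolding hausdorff_def using that by (intro max.coboundedI1 SUP_upper)
      then show ?thesis using less by (simp only: INF_less_iff[symmetric] order_le_less_trans)
    qed
    have B: "\<exists>a\<in>?A. ?d a b < ennreal \<epsilon>" if "b \<in> ?B" for b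
    proof -
      have "(INF a\<in>?A. ?d a b) \<le> ?D" unfolding hausdorff_def using that by (intro max.coboundedI2 SUP_upper)
      then show ?thesis using less by (simp only: INF_less_iff[symmetric] order_le_less_trans)
    qed
    have le: "a \<le> \<epsilon>" if "ennreal a < ennreal \<epsilon>" for a
      using ennreal_leI[of \<epsilon> a] that by (cases "a \<le> \<epsilon>") auto
    have "joint_embedding X Y V hX hY LX LY \<epsilon>"
    proof (intro joint_embedding.intro order_embedding.intro order_embedding_axioms.intro joint_embedding_axioms.intro)
      show "\<exists>y\<in>lip_ball Y LY. os_norm V (hX x - hY y) \<le> \<epsilon>" if "x \<in> lip_ball X LX" for x
        using A[of "hX x"] that le by blast
      show "\<exists>x\<in>lip_ball X LX. os_norm V (hX x - hY y) \<le> \<epsilon>" if "y \<in> lip_ball Y LY" for y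
        using B[of "hY y"] that le by blast
    qed (use X Y V hX hY \<epsilon> in \<open>auto simp: lip_normed_op_system_def\<close>)
    then show "dist_s X LX Y LY \<le> ?D + ennreal e"
      unfolding D by (rule joint_embedding.dist_s_le)
  qed
qed

section \<open>A joint embedding from close matrix state spaces\<close>

text \<open>Isometry is automatic, because the norm is determined by the unit, the involution and
  the cone of 2 by 2 matrices. Complete positivity of the inverse is one direction of
  \<open>pos\<close>.\<close>

lemma complete_order_embeddingI:
  assumes "operator_system X" "operator_system V"
    and space: "\<And>x. x \<in> os_space X \<Longrightarrow> h x \<in> os_space V"
    and add: "\<And>x y. x \<in> os_space X \<Longrightarrow> y \<in> os_space X \<Longrightarrow> h (x + y) = h x + h y"
    and scale: "\<And>c x. x \<in> os_space X \<Longrightarrow> h (c *\<^sub>C x) = c *\<^sub>C h x"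
    and unit: "h (os_unit X) = os_unit V"
    and star: "\<And>x. x \<in> os_space X \<Longrightarrow> h (os_star X x) = os_star V (h x)"
    and inj: "inj_on h (os_space X)"
    and pos: "\<And>n f. (\<And>i j. i < n \<Longrightarrow> j < n \<Longrightarrow> f (i, j) \<in> os_space X) \<Longrightarrow>
      mpos V n (\<lambda>z. h (f z)) \<longleftrightarrow> mpos X n f"
  shows "complete_order_embedding X V h"
proof -
  interpret X: operator_system X by fact
  interpret V: operator_system V by fact
  let ?g = "inv_into (os_space X) h"
  have g: "?g (h x) = x" if "x \<in> os_space X" for x using inj that by (rule inv_into_f_f)
  have cone: "map_mat h A \<in> os_cone V n" if A: "A \<in> os_cone X n" for n A
  proof -
    have A': "A = Matrix.mat n n (\<lambda>z. A $$ z)"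
      using A X.cone_sa[of n] by (intro mat_fun_eq[symmetric]) (auto simp: os_mats_sa_def os_mats_def)
    then have m: "mpos X n (\<lambda>z. A $$ z)" using A by (simp add: mpos_def)
    have "mpos V n (\<lambda>z. h (A $$ z))" using pos[of n "\<lambda>z. A $$ z"] m X.mpos_msa[OF m] by (simp add: msa_def)
    then show ?thesis by (subst A') (simp add: map_mat_fun mpos_def)
  qed
  have norm: "os_norm V (h x) = os_norm X x" if x: "x \<in> os_space X" for x
  proof -
    have "mat_of_rows_list 2 [[t *\<^sub>R os_unit V, h x], [os_star V (h x), t *\<^sub>R os_unit V]] \<in> os_cone V 2
      \<longleftrightarrow> mat_of_rows_list 2 [[t *\<^sub>R os_unit X, x], [os_star X x, t *\<^sub>R os_unit X]] \<in> os_cone X 2" for t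
    proof -
      define f where "f = (\<lambda>(i::nat, j::nat). if i = j then t *\<^sub>R os_unit X else if i = 0 then x else os_star X x)"
      have "mat_of_rows_list 2 [[t *\<^sub>R os_unit X, x], [os_star X x, t *\<^sub>R os_unit X]] = Matrix.mat 2 2 f"
        by (rule eq_matI) (auto simp: mat_of_rows_list_def f_def less_2_cases_iff)
      moreover have "mat_of_rows_list 2 [[t *\<^sub>R os_unit V, h x], [os_star V (h x), t *\<^sub>R os_unit V]]
          = Matrix.mat 2 2 (\<lambda>z. h (f z))"
        using x by (intro eq_matI) (auto simp: mat_of_rows_list_def f_def less_2_cases_iff star scaleR_scaleC
            scale X.unit_closed unit)
      moreover have "f (i, j) \<in> os_space X" for i j
        using x by (simp add: f_def X.space_scaleR X.unit_closed X.star_closed)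
      ultimately show ?thesis using pos[of 2 f] by (simp add: mpos_def)
    qed
    then show ?thesis by (simp add: os_norm_def)
  qed
  have "completely_positive (os_sub V (h ` os_space X)) X ?g"
    unfolding completely_positive_def
  proof (intro conjI ballI allI)
    show "?g ` os_space (os_sub V (h ` os_space X)) \<subseteq> os_space X"
      by (auto simp: os_sub_def g)
    show "?g (u + v) = ?g u + ?g v"
      if uv: "u \<in> os_space (os_sub V (h ` os_space X))" "v \<in> os_space (os_sub V (h ` os_space X))" for u v
    proof -
      obtain x y where "u = h x" "v = h y" "x \<in> os_space X" "y \<in> os_space X"
        using uv by (auto simp: os_sub_def)
      then show ?thesis using g[OF X.space_add[of x y]] by (simp add: add g)
    qed
    show "?g (c *\<^sub>C u) = c *\<^sub>C ?g u" if u: "u \<in> os_space (os_sub V (h ` os_space X))" for c u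
    proof -
      obtain x where "u = h x" "x \<in> os_space X" using u by (auto simp: os_sub_def)
      then show ?thesis using g[OF X.space_scaleC[of x c]] by (simp add: scale g)
    qed
    show "map_mat ?g A \<in> os_cone X n" if A: "A \<in> os_cone (os_sub V (h ` os_space X)) n" for n A
    proof -
      have c: "A \<in> os_cone V n" "A \<in> carrier_mat n n" and e: "elements_mat A \<subseteq> h ` os_space X"
        using A V.cone_sa[of n] by (auto simp: os_sub_def os_mats_sa_def os_mats_def)
      have im: "A $$ (i, j) \<in> h ` os_space X" if "i < n" "j < n" for i j
        using e elements_matI[OF c(2) that refl] by blast
      have hg: "h (?g (A $$ (i, j))) = A $$ (i, j)" and gs: "?g (A $$ (i, j)) \<in> os_space X"
        if "i < n" "j < n" for i j
        using im[OF that] by (auto simp: f_inv_into_f inv_into_into)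
      have A': "A = Matrix.mat n n (\<lambda>z. A $$ z)" by (rule mat_fun_eq[symmetric, OF c(2)])
      then have "mpos V n (\<lambda>z. A $$ z)" using c(1) by (simp add: mpos_def)
      then have "mpos V n (\<lambda>z. h (?g (A $$ z)))" by (rule mpos_cong) (simp add: hg)
      then have "mpos X n (\<lambda>z. ?g (A $$ z))" using pos[of n "\<lambda>z. ?g (A $$ z)"] gs by simp
      then show ?thesis by (subst A') (simp add: map_mat_fun mpos_def)
    qed
  qed
  moreover have "completely_positive X V h"
    unfolding completely_positive_def using space add scale cone by blast
  ultimately show ?thesis
    unfolding complete_order_embedding_def using unit norm inj by blast
qed

lemma sform_zero:
  assumes "\<And>u. sform n M u u = 0" "i < n" "j < n" shows "M i j = 0"
proof -
  have "sform n M (std i) (std j) + sform n M (std j) (std i) = 0"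
    using assms(1)[of "\<lambda>k. std i k + std j k"] assms(1)[of "std i"] assms(1)[of "std j"]
    by (simp add: sform_add_left sform_add_right)
  moreover have "\<i> * sform n M (std i) (std j) - \<i> * sform n M (std j) (std i) = 0"
    using assms(1)[of "\<lambda>k. std i k + \<i> * std j k"] assms(1)[of "std i"] assms(1)[of "std j"]
    by (simp add: sform_add_left sform_add_right sform_scale_left sform_scale_right)
  ultimately have "M i j + M j i = 0" "M i j = M j i"
    using assms(2,3) by (simp_all add: sform_std flip: right_diff_distrib)
  then show ?thesis by simp
qed

context operator_system
begin

lemma state_star:
  assumes \<sigma>: "\<sigma> \<in> state_space X" and x: "x \<in> os_space X"
  shows "\<sigma> (os_star X x) = cnj (\<sigma> x)"
proof -
  obtain a b where ab: "a \<in> os_sa X" "b \<in> os_sa X" "x = a + \<i> *\<^sub>C b"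
    using cartesian_decomposition[OF x] .
  have "os_star X x = a + (- \<i>) *\<^sub>C b"
    using ab by (simp add: star_add star_scaleC sa_space sa_star space_scaleC)
  then have "\<sigma> (os_star X x) = \<sigma> a + (- \<i>) * \<sigma> b"
    using ab \<sigma> by (simp only: state_add state_scaleC sa_space space_scaleC)
  moreover have "\<sigma> x = \<sigma> a + \<i> * \<sigma> b"
    using ab \<sigma> by (simp add: state_add state_scaleC sa_space space_scaleC)
  moreover have "Im (\<sigma> a) = 0" "Im (\<sigma> b) = 0" using state_real[OF \<sigma>] ab by auto
  ultimately show ?thesis by (simp add: complex_eq_iff)
qed

lemma zero_by_states:
  assumes x: "x \<in> os_space X" and \<sigma>: "\<And>\<sigma>. \<sigma> \<in> state_space X \<Longrightarrow> \<sigma> x = 0"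
  shows "x = 0"
proof -
  obtain a b where ab: "a \<in> os_sa X" "b \<in> os_sa X" "x = a + \<i> *\<^sub>C b"
    using cartesian_decomposition[OF x] .
  have "\<sigma> a = 0 \<and> \<sigma> b = 0" if s: "\<sigma> \<in> state_space X" for \<sigma>
  proof -
    have "\<sigma> x = \<sigma> a + \<i> * \<sigma> b"
      using ab s by (simp add: state_add state_scaleC sa_space space_scaleC)
    then show ?thesis using \<sigma>[OF s] state_real[OF s ab(1)] state_real[OF s ab(2)]
      by (simp add: complex_eq_iff)
  qed
  then show ?thesis using ab scalar_by_states[OF ab(1), of 0] scalar_by_states[OF ab(2), of 0] by simp
qed

lemma convex_state:
  assumes s: "0 \<le> s" "s \<le> 1" and \<sigma>: "\<sigma> \<in> state_space X" and \<tau>: "\<tau> \<in> state_space X"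
  shows "restrict (\<lambda>a. of_real (1 - s) * \<sigma> a + of_real s * \<tau> a) (os_space X) \<in> state_space X"
proof -
  let ?\<rho> = "\<lambda>a. of_real (1 - s) * \<sigma> a + of_real s * \<tau> a"
  have "?\<rho> (x + y) = ?\<rho> x + ?\<rho> y" "?\<rho> (c *\<^sub>C x) = c * ?\<rho> x" if "x \<in> os_space X" "y \<in> os_space X" for x y c
    using that by (simp_all add: state_add[OF \<sigma>] state_add[OF \<tau>] state_scaleC[OF \<sigma>] state_scaleC[OF \<tau>]
        algebra_simps)
  moreover have "?\<rho> (os_unit X) = 1" by (simp add: state_unit[OF \<sigma>] state_unit[OF \<tau>])
  moreover have "0 \<le> ?\<rho> x" if "x \<in> os_pos X" for x
    using state_pos[OF \<sigma> that] state_pos[OF \<tau> that] s by (simp add: less_eq_complex_def)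
  ultimately show ?thesis
    using pos_sa[THEN sa_space] by (auto simp: state_space_def space_add space_scaleC unit_closed)
qed

lemma msa_mcompress:
  assumes f: "msa X n f" shows "msa X m (mcompress n a f)"
  unfolding msa_def
proof (intro allI impI conjI)
  fix i j assume "i < m" "j < m"
  have fs: "f (k, l) \<in> os_space X" and st: "os_star X (f (l, k)) = f (k, l)" if "k < n" "l < n" for k l
    using f that by (auto simp: msa_def)
  show "mcompress n a f (i, j) \<in> os_space X"
    using fs by (auto simp: mcompress_def intro!: space_sum space_scaleC)
  have star_sum: "os_star X (\<Sum>i\<in>A. F i) = (\<Sum>i\<in>A. os_star X (F i))" if "\<And>i. i \<in> A \<Longrightarrow> F i \<in> os_space X"
    for F and A :: "nat set"
    using that by (induction A rule: infinite_finite_induct) (simp_all add: star_zero star_add space_sum)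
  have "os_star X (mcompress n a f (j, i)) = (\<Sum>k<n. os_star X (\<Sum>l<n. (cnj (a k j) * a l i) *\<^sub>C f (k, l)))"
    unfolding mcompress_def prod.case using fs by (intro star_sum) (auto intro!: space_sum space_scaleC)
  also have "\<dots> = (\<Sum>k<n. \<Sum>l<n. os_star X ((cnj (a k j) * a l i) *\<^sub>C f (k, l)))"
    using fs by (intro sum.cong refl star_sum) (auto intro!: space_scaleC)
  also have "\<dots> = (\<Sum>k<n. \<Sum>l<n. (cnj (a l i) * a k j) *\<^sub>C f (l, k))"
    using fs st by (intro sum.cong refl) (simp add: star_scaleC mult.commute)
  also have "\<dots> = mcompress n a f (i, j)"
    unfolding mcompress_def prod.case by (rule sum.swap)
  finally show "os_star X (mcompress n a f (j, i)) = mcompress n a f (i, j)" .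
qed

text \<open>Two successive congruences amount to the congruence by the product of the scalar
  matrices.\<close>

lemma mform_mcompress:
  assumes \<phi>: "entrywise_linear X m \<phi>" and f: "msa X n f"
  shows "mform k m \<phi> (mcompress n a f) v = mform n m \<phi> f (\<lambda>p i. \<Sum>q<k. a p q * v q i)"
proof -
  have "mcompress k v (mcompress n a f) z = mcompress n (\<lambda>p i. \<Sum>q<k. a p q * v q i) f z" for z
  proof -
    obtain i j where z: "z = (i, j)" by (cases z)
    have "mcompress k v (mcompress n a f) (i, j)
        = (\<Sum>q<k. \<Sum>q'<k. \<Sum>p<n. \<Sum>p'<n. (cnj (v q i) * v q' j * (cnj (a p q) * a p' q')) *\<^sub>C f (p, p'))"
      by (simp add: mcompress_def cv.scale_sum_right scaleC_scaleC)
    also have "\<dots> = (\<Sum>p<n. \<Sum>p'<n. \<Sum>q<k. \<Sum>q'<k. (cnj (v q i) * v q' j * (cnj (a p q) * a p' q')) *\<^sub>C f (p, p'))"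
    proof -
      have "(\<Sum>q<k. \<Sum>q'<k. \<Sum>p<n. \<Sum>p'<n. F q q' p p') = (\<Sum>p<n. \<Sum>p'<n. \<Sum>q<k. \<Sum>q'<k. F q q' p p')"
        for F :: "nat \<Rightarrow> nat \<Rightarrow> nat \<Rightarrow> nat \<Rightarrow> 'a"
      proof -
        have "(\<Sum>q<k. \<Sum>q'<k. \<Sum>p<n. \<Sum>p'<n. F q q' p p') = (\<Sum>q<k. \<Sum>p<n. \<Sum>q'<k. \<Sum>p'<n. F q q' p p')"
          by (rule sum.cong[OF refl], rule sum.swap)
        also have "\<dots> = (\<Sum>p<n. \<Sum>q<k. \<Sum>q'<k. \<Sum>p'<n. F q q' p p')" by (rule sum.swap)
        also have "\<dots> = (\<Sum>p<n. \<Sum>q<k. \<Sum>p'<n. \<Sum>q'<k. F q q' p p')"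
          by (rule sum.cong[OF refl], rule sum.cong[OF refl], rule sum.swap)
        also have "\<dots> = (\<Sum>p<n. \<Sum>p'<n. \<Sum>q<k. \<Sum>q'<k. F q q' p p')"
          by (rule sum.cong[OF refl], rule sum.swap)
        finally show ?thesis .
      qed
      then show ?thesis .
    qed
    also have "\<dots> = (\<Sum>p<n. \<Sum>p'<n. (cnj (\<Sum>q<k. a p q * v q i) * (\<Sum>q'<k. a p' q' * v q' j)) *\<^sub>C f (p, p'))"
      by (simp only: cnj_sum complex_cnj_mult sum_product cv.scale_sum_left)
        (simp add: mult_ac)
    finally show ?thesis by (simp add: z mcompress_def)
  qed
  then have "tform m \<phi> (mcompress k v (mcompress n a f)) = tform m \<phi> (mcompress n (\<lambda>p i. \<Sum>q<k. a p q * v q i) f)"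
    by (simp add: tform_def)
  then show ?thesis
    by (simp add: mform_compress[OF \<phi> msa_mcompress[OF f]] mform_compress[OF \<phi> f])
qed

lemma mform_add:
  assumes "entrywise_linear X m \<phi>" "msa X n f" "msa X n g"
  shows "mform n m \<phi> (\<lambda>z. f z + g z) v = mform n m \<phi> f v + mform n m \<phi> g v"
proof -
  have "mform n m \<phi> (\<lambda>z. f z + g z) v = (\<Sum>p<n. \<Sum>q<n. \<Sum>i<m. \<Sum>j<m.
      cnj (v p i) * v q j * \<phi> (f (p, q)) $$ (i, j) + cnj (v p i) * v q j * \<phi> (g (p, q)) $$ (i, j))"
    unfolding mform_def
    by (intro sum.cong refl) (use assms in \<open>simp add: entrywise_linear_def msa_def distrib_left\<close>)
  then show ?thesis by (simp add: mform_def sum.distrib)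
qed

lemma mform_scaleR:
  assumes "entrywise_linear X m \<phi>" "msa X n f"
  shows "mform n m \<phi> (\<lambda>z. r *\<^sub>R f z) v = of_real r * mform n m \<phi> f v"
  unfolding mform_def sum_distrib_left
  by (intro sum.cong refl) (use assms in \<open>simp add: entrywise_linear_def msa_def scaleR_scaleC mult_ac\<close>)

lemma mform_munit:
  assumes \<phi>: "\<phi> \<in> matrix_states X m"
  shows "mform n m \<phi> (munit X) v = of_real (\<Sum>p<n. sqsum m (v p))"
proof -
  have lin: "entrywise_linear X m \<phi>" using \<phi> cp_map_linear by (simp add: matrix_states_iff)
  have "sform m (\<lambda>i j. \<phi> (munit X (p, q)) $$ (i, j)) (v p) (v q) = (if q = p then of_real (sqsum m (v p)) else 0)" for p q
  proof (cases "q = p")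
    case True
    have "sform m (\<lambda>i j. \<phi> (munit X (p, q)) $$ (i, j)) (v p) (v q)
        = sform m (\<lambda>i j. 0 + (if i = j then 1 else 0)) (v p) (v p)"
      unfolding sform_def
      by (intro sum.cong refl) (use True in \<open>simp add: munit_def matrix_state_index(5)[OF \<phi>]\<close>)
    also have "\<dots> = of_real (sqsum m (v p))" unfolding sform_scalar by (simp add: sqsum_def sform_def)
    finally show ?thesis using True by simp
  next
    case False
    then show ?thesis by (simp add: sform_def munit_def entrywise_linear_zero[OF lin])
  qed
  then show ?thesis by (simp add: mform_sform)
qed

end

text \<open>The operator system \<open>V\<close> is the amalgam of \<open>X\<close> and \<open>Y\<close> over the scalars: the unit is shared, and
  a fixed state \<open>\<sigma>\<^sub>0\<close> of \<open>Y\<close> is used to split the scalars off \<open>Y\<close>, so that the underlying space is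
  \<open>X \<oplus> ker \<sigma>\<^sub>0\<close>. Its order is given by the pairs of matrix states at distance at most \<open>\<epsilon>\<close>. The margin
  between \<open>\<epsilon>\<^sub>0\<close> and \<open>\<epsilon>\<close> leaves so many such pairs that the cones are proper.\<close>

locale close_systems = X: operator_system X + Y: operator_system Y
  for X :: "'x::complex_vector op_system" and Y :: "'y::complex_vector op_system" +
  fixes LX :: "'x \<Rightarrow> ennreal" and LY :: "'y \<Rightarrow> ennreal" and L :: "'x \<times> 'y \<Rightarrow> ennreal"
    and \<epsilon>0 \<epsilon> :: real and \<sigma>0 :: "'y \<Rightarrow> complex" and V :: "('x \<times> 'y \<times> 'v::complex_vector) op_system"
    and T :: "nat \<Rightarrow> ('x \<Rightarrow> complex mat) \<Rightarrow> ('y \<Rightarrow> complex mat) \<Rightarrow> bool"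
  assumes adm: "admissible X LX Y LY L"
    and eps: "0 \<le> \<epsilon>0" "\<epsilon>0 < \<epsilon>"
    and \<sigma>0: "\<sigma>0 \<in> state_space Y"
    and closeX: "\<And>n \<phi>. 1 \<le> n \<Longrightarrow> \<phi> \<in> matrix_states X n \<Longrightarrow> \<exists>\<psi>\<in>matrix_states Y n.
      \<forall>z\<in>lip_ball (os_sum X Y) L. op_norm (\<phi> (fst z) - \<psi> (snd z)) \<le> \<epsilon>0"
    and closeY: "\<And>n \<psi>. 1 \<le> n \<Longrightarrow> \<psi> \<in> matrix_states Y n \<Longrightarrow> \<exists>\<phi>\<in>matrix_states X n.
      \<forall>z\<in>lip_ball (os_sum X Y) L. op_norm (\<phi> (fst z) - \<psi> (snd z)) \<le> \<epsilon>0"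
    and T_def: "T n \<phi> \<psi> \<longleftrightarrow> 1 \<le> n \<and> \<phi> \<in> matrix_states X n \<and> \<psi> \<in> matrix_states Y n \<and>
      (\<forall>z\<in>lip_ball (os_sum X Y) L. op_norm (\<phi> (fst z) - \<psi> (snd z)) \<le> \<epsilon>)"
    and V_def: "V =
      \<lparr>os_space = {v. fst v \<in> os_space X \<and> fst (snd v) \<in> os_space Y \<and> \<sigma>0 (fst (snd v)) = 0 \<and> snd (snd v) = 0},
       os_star = (\<lambda>v. (os_star X (fst v), os_star Y (fst (snd v)), 0)),
       os_unit = (os_unit X, 0, 0),
       os_cone = (\<lambda>n. {A \<in> carrier_mat n n.
         msa X n (\<lambda>z. fst (A $$ z)) \<and> msa Y n (\<lambda>z. fst (snd (A $$ z))) \<and>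
         (\<forall>i<n. \<forall>j<n. \<sigma>0 (fst (snd (A $$ (i, j)))) = 0 \<and> snd (snd (A $$ (i, j))) = 0) \<and>
         (\<forall>m \<phi> \<psi> v. T m \<phi> \<psi> \<longrightarrow>
           0 \<le> mform n m \<phi> (\<lambda>z. fst (A $$ z)) v + mform n m \<psi> (\<lambda>z. fst (snd (A $$ z))) v)})\<rparr>"
begin

abbreviation "Z \<equiv> os_sum X Y"

sublocale Z: operator_system Z
  by (rule operator_system_sum) unfold_locales

lemma msa_V: "msa V n f \<longleftrightarrow> msa X n (\<lambda>z. fst (f z)) \<and> msa Y n (\<lambda>z. fst (snd (f z))) \<and>
    (\<forall>i<n. \<forall>j<n. \<sigma>0 (fst (snd (f (i, j)))) = 0 \<and> snd (snd (f (i, j))) = 0)"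
  unfolding msa_def V_def by (simp add: prod_eq_iff) blast

lemma mpos_V: "mpos V n f \<longleftrightarrow> msa V n f \<and> (\<forall>m \<phi> \<psi> v. T m \<phi> \<psi> \<longrightarrow>
    0 \<le> mform n m \<phi> (\<lambda>z. fst (f z)) v + mform n m \<psi> (\<lambda>z. fst (snd (f z))) v)"
proof -
  let ?A = "Matrix.mat n n f"
  have m: "mform n m \<phi> (\<lambda>z. p (?A $$ z)) v = mform n m \<phi> (\<lambda>z. p (f z)) v" for m \<phi> v and p :: "_ \<Rightarrow> 'c"
    by (simp add: mform_def)
  have s: "msa W n (\<lambda>z. p (?A $$ z)) \<longleftrightarrow> msa W n (\<lambda>z. p (f z))" for W and p :: "_ \<Rightarrow> 'c"
    by (simp add: msa_def)
  show ?thesis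
    unfolding mpos_def msa_V by (simp add: V_def m[of _ _ fst] m[of _ _ "\<lambda>z. fst (snd z)"] s[of _ fst] s[of _ "\<lambda>z. fst (snd z)"])
qed

lemma T_linear:
  assumes "T m \<phi> \<psi>"
  shows "entrywise_linear X m \<phi>" "entrywise_linear Y m \<psi>"
  using assms X.cp_map_linear Y.cp_map_linear by (auto simp: T_def X.matrix_states_iff Y.matrix_states_iff)

text \<open>Mix a proportion s of an arbitrary pair of states with an
  \<open>\<epsilon>0\<close>-close pair: for small s the result is \<epsilon>-close. The sum of
  values vanishes at the close pair and at the mixture, hence at the arbitrary pair, so the two
  states can be varied independently.\<close>

lemma close_states_vanish:
  assumes x: "x \<in> os_space X" and y: "y \<in> os_space Y" and \<sigma>0y: "\<sigma>0 y = 0"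
    and van: "\<And>\<phi> \<psi>. T 1 \<phi> \<psi> \<Longrightarrow> \<phi> x $$ (0, 0) + \<psi> y $$ (0, 0) = 0"
  shows "x = 0 \<and> y = 0"
proof -
  have lip: "lip_norm Z L" using adm by (simp add: admissible_def)
  have all: "\<sigma> x + \<omega> y = 0" if \<sigma>: "\<sigma> \<in> state_space X" and \<omega>: "\<omega> \<in> state_space Y" for \<sigma> \<omega>
  proof -
    obtain \<phi>1 where "\<phi>1 \<in> matrix_states X 1"
      using X.state_matrix_state[OF \<sigma>] by blast
    then obtain \<psi>1 where st: "\<phi>1 \<in> matrix_states X 1" "\<psi>1 \<in> matrix_states Y 1"
      and cl: "\<And>z. z \<in> lip_ball Z L \<Longrightarrow> op_norm (\<phi>1 (fst z) - \<psi>1 (snd z)) \<le> \<epsilon>0"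
      using closeX[of 1] by blast
    have zs: "fst z \<in> os_space X" "snd z \<in> os_space Y" "z \<in> os_space Z" if "z \<in> lip_ball Z L" for z
      using that by (auto simp: lip_ball_def sa_sum_iff intro: X.sa_space Y.sa_space Z.sa_space)
    define \<sigma>' where "\<sigma>' = restrict (\<sigma> \<circ> fst) (os_space Z)"
    define \<omega>' where "\<omega>' = restrict (\<omega> \<circ> snd) (os_space Z)"
    have "\<sigma>' \<in> state_space Z"
      using \<sigma> Z.pos_sa[THEN Z.sa_space] unfolding \<sigma>'_def state_space_def
      by (auto simp: sum_simps X.space_add Y.space_add X.space_scaleC Y.space_scaleC X.unit_closed
          Y.unit_closed fst_scaleC snd_scaleC mem_Times_iff pos_sum_iff)
    moreover have "\<omega>' \<in> state_space Z"
      using \<omega> Z.pos_sa[THEN Z.sa_space] unfolding \<omega>'_def state_space_def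
      by (auto simp: sum_simps X.space_add Y.space_add X.space_scaleC Y.space_scaleC X.unit_closed
          Y.unit_closed fst_scaleC snd_scaleC mem_Times_iff pos_sum_iff)
    ultimately have fin: "lip_dist Z L \<sigma>' \<omega>' < \<infinity>" using lip by (simp add: lip_norm_def)
    define C where "C = enn2real (lip_dist Z L \<sigma>' \<omega>')"
    have C0: "C \<ge> 0" by (simp add: C_def)
    have C: "cmod (\<sigma> (fst z) - \<omega> (snd z)) \<le> C" if z: "z \<in> lip_ball Z L" for z
    proof -
      have "ennreal (cmod (\<sigma>' z - \<omega>' z)) \<le> ennreal C"
        using lip_dist_upper[OF z, of \<sigma>' \<omega>'] fin by (simp add: C_def)
      then show ?thesis using zs(3)[OF z] C0 by (simp add: \<sigma>'_def \<omega>'_def ennreal_le_iff)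
    qed
    \<comment> \<open>The mixture is at distance at most \<epsilon>0 + s C, and this proportion
      keeps s C within the margin.\<close>
    define s where "s = (\<epsilon> - \<epsilon>0) / (\<epsilon> - \<epsilon>0 + C)"
    have s: "0 < s" "s \<le> 1" using eps C0 by (simp_all add: s_def)
    have sC: "s * C \<le> \<epsilon> - \<epsilon>0"
    proof -
      have "s * C \<le> s * (\<epsilon> - \<epsilon>0 + C)" using s eps by (intro mult_left_mono) auto
      also have "\<dots> = \<epsilon> - \<epsilon>0" using eps C0 by (simp add: s_def)
      finally show ?thesis .
    qed
    define \<tau>1 where "\<tau>1 = restrict (\<lambda>a. \<phi>1 a $$ (0, 0)) (os_space X)"
    define \<tau>2 where "\<tau>2 = restrict (\<lambda>a. \<psi>1 a $$ (0, 0)) (os_space Y)"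
    define \<sigma>2 where "\<sigma>2 = restrict (\<lambda>a. of_real (1 - s) * \<tau>1 a + of_real s * \<sigma> a) (os_space X)"
    define \<omega>2 where "\<omega>2 = restrict (\<lambda>a. of_real (1 - s) * \<tau>2 a + of_real s * \<omega> a) (os_space Y)"
    have s0: "0 \<le> s" using s by simp
    have \<phi>2: "restrict (\<lambda>a. Matrix.mat 1 1 (\<lambda>_. \<sigma>2 a)) (os_space X) \<in> matrix_states X 1"
      unfolding \<sigma>2_def \<tau>1_def
      by (intro X.state_matrix_state X.convex_state X.matrix_state_1 s0 s(2) st(1) \<sigma>)
    have \<psi>2: "restrict (\<lambda>a. Matrix.mat 1 1 (\<lambda>_. \<omega>2 a)) (os_space Y) \<in> matrix_states Y 1"
      unfolding \<omega>2_def \<tau>2_def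
      by (intro Y.state_matrix_state Y.convex_state Y.matrix_state_1 s0 s(2) st(2) \<omega>)
    have "T 1 (restrict (\<lambda>a. Matrix.mat 1 1 (\<lambda>_. \<sigma>2 a)) (os_space X)) (restrict (\<lambda>a. Matrix.mat 1 1 (\<lambda>_. \<omega>2 a)) (os_space Y))"
      unfolding T_def
    proof (intro conjI \<phi>2 \<psi>2 ballI)
      fix z assume z: "z \<in> lip_ball Z L"
      have c1: "\<phi>1 (fst z) \<in> carrier_mat 1 1" "\<psi>1 (snd z) \<in> carrier_mat 1 1"
        using X.matrix_state_carrier[OF st(1) zs(1)[OF z]] Y.matrix_state_carrier[OF st(2) zs(2)[OF z]] by auto
      have d1: "cmod (\<phi>1 (fst z) $$ (0, 0) - \<psi>1 (snd z) $$ (0, 0)) \<le> \<epsilon>0"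
        using cl[OF z] op_norm_1[OF minus_carrier_mat[OF c1(2)], of "\<phi>1 (fst z)"] c1 by simp
      have "op_norm (Matrix.mat 1 1 (\<lambda>_. \<sigma>2 (fst z)) - Matrix.mat 1 1 (\<lambda>_. \<omega>2 (snd z)))
          = cmod (\<sigma>2 (fst z) - \<omega>2 (snd z))"
        by (subst op_norm_1) auto
      also have "\<sigma>2 (fst z) - \<omega>2 (snd z) = of_real (1 - s) * (\<phi>1 (fst z) $$ (0, 0) - \<psi>1 (snd z) $$ (0, 0))
          + of_real s * (\<sigma> (fst z) - \<omega> (snd z))"
        using zs[OF z] by (simp add: \<sigma>2_def \<omega>2_def \<tau>1_def \<tau>2_def algebra_simps)
      also have "cmod (of_real (1 - s) * (\<phi>1 (fst z) $$ (0, 0) - \<psi>1 (snd z) $$ (0, 0))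
          + of_real s * (\<sigma> (fst z) - \<omega> (snd z))) \<le> (1 - s) * cmod (\<phi>1 (fst z) $$ (0, 0) - \<psi>1 (snd z) $$ (0, 0))
          + s * cmod (\<sigma> (fst z) - \<omega> (snd z))"
        by (rule order_trans[OF norm_triangle_ineq]) (use s in \<open>simp add: norm_mult del: of_real_diff\<close>)
      also have "\<dots> \<le> 1 * \<epsilon>0 + s * C"
        by (rule add_mono; rule mult_mono) (use d1 C[OF z] s in auto)
      also have "\<dots> \<le> \<epsilon>" using sC by simp
      finally show "op_norm (restrict (\<lambda>a. Matrix.mat 1 1 (\<lambda>_. \<sigma>2 a)) (os_space X) (fst z)
          - restrict (\<lambda>a. Matrix.mat 1 1 (\<lambda>_. \<omega>2 a)) (os_space Y) (snd z)) \<le> \<epsilon>"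
        using zs[OF z] by simp
    qed simp
    from van[OF this] have "\<sigma>2 x + \<omega>2 y = 0" using x y by simp
    then have "of_real (1 - s) * (\<phi>1 x $$ (0, 0) + \<psi>1 y $$ (0, 0)) + of_real s * (\<sigma> x + \<omega> y) = 0"
      using x y by (simp add: \<sigma>2_def \<omega>2_def \<tau>1_def \<tau>2_def algebra_simps)
    moreover have "T 1 \<phi>1 \<psi>1" unfolding T_def using st cl eps by force
    ultimately show ?thesis using van s by simp
  qed
  \<comment> \<open>A state of X exists as a partner of \<open>\<sigma>0\<close>. Pairing any state
    of X with \<open>\<sigma>0\<close>, which kills y, isolates x; the vanishing of x then isolates
    y.\<close>
  obtain \<sigma> where \<sigma>: "\<sigma> \<in> state_space X"
    using closeY[OF order_refl Y.state_matrix_state[OF \<sigma>0]] X.matrix_state_1 by blast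
  have zx: "\<sigma> x = 0" if "\<sigma> \<in> state_space X" for \<sigma> using all[OF that \<sigma>0] \<sigma>0y by simp
  have zy: "\<omega> y = 0" if "\<omega> \<in> state_space Y" for \<omega> using all[OF \<sigma> that] zx[OF \<sigma>] by simp
  have "x = 0" by (rule X.zero_by_states[OF x]) (rule zx)
  moreover have "y = 0" by (rule Y.zero_by_states[OF y]) (rule zy)
  ultimately show ?thesis by blast
qed

end

section \<open>The amalgam as an operator system\<close>

context close_systems
begin

lemma munit_V: "munit V z = (munit X z, 0, 0)"
  by (cases z) (simp add: munit_def V_def zero_prod_def)

lemma V_simps:
  "os_space V = {v. fst v \<in> os_space X \<and> fst (snd v) \<in> os_space Y \<and> \<sigma>0 (fst (snd v)) = 0 \<and> snd (snd v) = 0}"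
  "os_star V v = (os_star X (fst v), os_star Y (fst (snd v)), 0)"
  "os_unit V = (os_unit X, 0, 0)"
  by (simp_all add: V_def)

text \<open>The unit is stored in the X coordinate only, so it enters once, through \<phi>.\<close>

lemma mform_order_unit:
  assumes T: "T m \<phi> \<psi>" and f: "msa V n f"
  shows "mform n m \<phi> (\<lambda>z. fst (r *\<^sub>R munit V z + f z)) v + mform n m \<psi> (\<lambda>z. fst (snd (r *\<^sub>R munit V z + f z))) v
    = of_real (r * (\<Sum>p<n. sqsum m (v p))) + (mform n m \<phi> (\<lambda>z. fst (f z)) v + mform n m \<psi> (\<lambda>z. fst (snd (f z))) v)"
proof -
  have "\<phi> \<in> matrix_states X m" using T by (simp add: T_def)
  then show ?thesis
    using f X.mform_add[OF T_linear(1)[OF T] X.msa_scaleR[OF X.msa_munit]] X.mform_munit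
    by (simp add: munit_V msa_V X.mform_scaleR[OF T_linear(1)[OF T] X.msa_munit])
qed

text \<open>Each pair in \<open>T\<close> imposes the condition that a form, additive and
  homogeneous in the matrix, be nonnegative. These conditions survive sums, scaling, compression and
  limits along the unit. Properness alone depends on which pairs are present.\<close>

lemma operator_system_V: "operator_system V"
proof (rule operator_systemI)
  show "module.subspace scaleC (os_space V)"
    by (rule cv.subspaceI) (auto simp: V_simps zero_prod_def scaleC_prod_def X.space_zero Y.space_zero
        X.space_add Y.space_add X.space_scaleC Y.space_scaleC Y.state_zero[OF \<sigma>0] Y.state_add[OF \<sigma>0]
        Y.state_scaleC[OF \<sigma>0])
  show "os_star V v \<in> os_space V" "os_star V (os_star V v) = v" if "v \<in> os_space V" for v
    using that by (auto simp: V_simps X.star_closed Y.star_closed X.star_star Y.star_star Y.state_star[OF \<sigma>0]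
        prod_eq_iff)
  show "os_star V (v + w) = os_star V v + os_star V w" if "v \<in> os_space V" "w \<in> os_space V" for v w
    using that by (auto simp: V_simps X.star_add Y.star_add)
  show "os_star V (c *\<^sub>C v) = cnj c *\<^sub>C os_star V v" if "v \<in> os_space V" for c v
    using that by (auto simp: V_simps X.star_scaleC Y.star_scaleC scaleC_prod_def)
  show "os_unit V \<in> os_space V" "os_star V (os_unit V) = os_unit V"
    by (auto simp: V_simps X.unit_closed Y.space_zero X.star_unit Y.star_zero Y.state_zero[OF \<sigma>0])
  show "os_cone V n \<subseteq> carrier_mat n n" for n by (auto simp: V_def)
  show "msa V n f" if "mpos V n f" for n f using that mpos_V by blast
  show "mpos V n (\<lambda>z. f z + g z)" if "mpos V n f" "mpos V n g" for n f g
    unfolding mpos_V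
  proof (intro conjI allI impI)
    have s: "msa V n f" "msa V n g" using that mpos_V by blast+
    then show "msa V n (\<lambda>z. f z + g z)"
      by (simp add: msa_V X.msa_add Y.msa_add) (simp add: msa_def Y.state_add[OF \<sigma>0])
    fix m \<phi> \<psi> v assume T: "T m \<phi> \<psi>"
    have "0 \<le> (mform n m \<phi> (\<lambda>z. fst (f z)) v + mform n m \<psi> (\<lambda>z. fst (snd (f z))) v)
      + (mform n m \<phi> (\<lambda>z. fst (g z)) v + mform n m \<psi> (\<lambda>z. fst (snd (g z))) v)"
      using that T unfolding mpos_V by (intro add_nonneg_nonneg[of "_ + _"]) blast+
    then show "0 \<le> mform n m \<phi> (\<lambda>z. fst (f z + g z)) v + mform n m \<psi> (\<lambda>z. fst (snd (f z + g z))) v"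
      using s by (simp add: msa_V X.mform_add[OF T_linear(1)[OF T]] Y.mform_add[OF T_linear(2)[OF T]] add_ac)
  qed
  show "mpos V n (\<lambda>z. r *\<^sub>R f z)" if "mpos V n f" "0 \<le> r" for n f r
    unfolding mpos_V
  proof (intro conjI allI impI)
    have s: "msa V n f" using that mpos_V by blast
    then show "msa V n (\<lambda>z. r *\<^sub>R f z)"
      by (simp add: msa_V X.msa_scaleR Y.msa_scaleR) (simp add: msa_def Y.state_scaleR[OF \<sigma>0])
    fix m \<phi> \<psi> v assume T: "T m \<phi> \<psi>"
    have "0 \<le> mform n m \<phi> (\<lambda>z. fst (f z)) v + mform n m \<psi> (\<lambda>z. fst (snd (f z))) v"
      using that T unfolding mpos_V by blast
    then have "0 \<le> of_real r * (mform n m \<phi> (\<lambda>z. fst (f z)) v + mform n m \<psi> (\<lambda>z. fst (snd (f z))) v)"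
      using \<open>0 \<le> r\<close> by (simp add: less_eq_complex_def)
    then show "0 \<le> mform n m \<phi> (\<lambda>z. fst (r *\<^sub>R f z)) v + mform n m \<psi> (\<lambda>z. fst (snd (r *\<^sub>R f z))) v"
      using s by (simp add: msa_V X.mform_scaleR[OF T_linear(1)[OF T]] Y.mform_scaleR[OF T_linear(2)[OF T]]
          distrib_left)
  qed
  show "f (i, j) = 0" if f: "mpos V n f" "mpos V n (\<lambda>z. - f z)" and ij: "i < n" "j < n" for n f i j
  proof -
    have s: "msa V n f" using f mpos_V by blast
    then have sp: "fst (f (i, j)) \<in> os_space X" "fst (snd (f (i, j))) \<in> os_space Y"
      "\<sigma>0 (fst (snd (f (i, j)))) = 0" "snd (snd (f (i, j))) = 0"
      using ij by (auto simp: msa_V) (auto simp: msa_def)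
    have van: "\<phi> (fst (f (i, j))) $$ (0, 0) + \<psi> (fst (snd (f (i, j)))) $$ (0, 0) = 0" if T: "T 1 \<phi> \<psi>" for \<phi> \<psi>
    proof -
      \<comment> \<open>For pairs of size 1 the condition is a scalar form in \<open>u\<close>. It
        is nonnegative and nonpositive, hence 0, and polarisation kills every entry.\<close>
      define M where "M p q = \<phi> (fst (f (p, q))) $$ (0, 0) + \<psi> (fst (snd (f (p, q)))) $$ (0, 0)" for p q
      have M: "mform n 1 \<phi> (\<lambda>z. fst (f z)) (\<lambda>p _. u p) + mform n 1 \<psi> (\<lambda>z. fst (snd (f z))) (\<lambda>p _. u p) = sform n M u u" for u
        by (simp add: mform_def sform_def M_def distrib_left sum.distrib)
      have "mform n 1 \<phi> (\<lambda>z. fst (- f z)) v + mform n 1 \<psi> (\<lambda>z. fst (snd (- f z))) v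
        = - (mform n 1 \<phi> (\<lambda>z. fst (f z)) v + mform n 1 \<psi> (\<lambda>z. fst (snd (f z))) v)" for v
        using s X.mform_scaleR[OF T_linear(1)[OF T], of n "\<lambda>z. fst (f z)" "-1"]
          Y.mform_scaleR[OF T_linear(2)[OF T], of n "\<lambda>z. fst (snd (f z))" "-1"]
        by (simp add: msa_V)
      then have "0 \<le> sform n M u u" "0 \<le> - sform n M u u" for u
        using f T unfolding mpos_V M[symmetric] by metis+
      then have "sform n M u u = 0" for u by (metis neg_0_le_iff_le order_antisym)
      from sform_zero[OF this ij] show ?thesis by (simp add: M_def)
    qed
    have "fst (f (i, j)) = 0 \<and> fst (snd (f (i, j))) = 0"
      by (rule close_states_vanish[OF sp(1,2,3)]) (rule van)
    then show ?thesis using sp(4) by (simp add: prod_eq_iff)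
  qed
  show "mpos V k (mcompress n a f)" if f: "mpos V n f" for n k f a
    unfolding mpos_V
  proof (intro conjI allI impI)
    have s: "msa V n f" using f mpos_V by blast
    then have sX: "msa X n (\<lambda>z. fst (f z))" and sY: "msa Y n (\<lambda>z. fst (snd (f z)))" by (auto simp: msa_V)
    have \<sigma>0_sum: "\<sigma>0 (\<Sum>i\<in>A. F i) = 0" if "\<And>i. i \<in> A \<Longrightarrow> F i \<in> os_space Y \<and> \<sigma>0 (F i) = 0"
      for F and A :: "nat set"
      using that by (induction A rule: infinite_finite_induct)
        (simp_all add: Y.state_zero[OF \<sigma>0] Y.state_add[OF \<sigma>0] Y.space_sum)
    have "\<sigma>0 (fst (snd (f (p, q)))) = 0" "fst (snd (f (p, q))) \<in> os_space Y" if "p < n" "q < n" for p q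
      using s sY that by (simp add: msa_V, simp add: msa_def)
    then have "\<sigma>0 (mcompress n a (\<lambda>z. fst (snd (f z))) (i, j)) = 0" for i j
      unfolding mcompress_def prod.case
      by (intro \<sigma>0_sum conjI Y.space_sum Y.space_scaleC)
        (auto simp: Y.state_scaleC[OF \<sigma>0] intro: Y.space_scaleC)
    moreover have "snd (snd (mcompress n a f (i, j))) = 0" for i j
      using s by (simp add: snd_mcompress) (simp add: mcompress_def msa_V)
    ultimately show "msa V k (mcompress n a f)"
      using X.msa_mcompress[OF sX] Y.msa_mcompress[OF sY]
      by (simp add: msa_V fst_mcompress snd_mcompress)
    fix m \<phi> \<psi> v assume T: "T m \<phi> \<psi>"
    show "0 \<le> mform k m \<phi> (\<lambda>z. fst (mcompress n a f z)) v + mform k m \<psi> (\<lambda>z. fst (snd (mcompress n a f z))) v"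
      using f T unfolding mpos_V fst_mcompress snd_mcompress
      by (simp add: X.mform_mcompress[OF T_linear(1)[OF T] sX] Y.mform_mcompress[OF T_linear(2)[OF T] sY])
  qed
  show "\<exists>r>0. mpos V n (\<lambda>z. r *\<^sub>R munit V z + f z)" if f: "msa V n f" for n f
  proof -
    have sX: "msa X n (\<lambda>z. fst (f z))" and sY: "msa Y n (\<lambda>z. fst (snd (f z)))" using f by (auto simp: msa_V)
    obtain r where r: "r > 0" "mpos X n (\<lambda>z. r *\<^sub>R munit X z + fst (f z))" using X.mpos_order_unit[OF sX] by blast
    obtain s where s: "s > 0" "mpos Y n (\<lambda>z. s *\<^sub>R munit Y z + fst (snd (f z)))" using Y.mpos_order_unit[OF sY] by blast
    \<comment> \<open>One unit serves both coordinates: \<phi> and \<psi> are unital, so the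
      multiples sufficient for the X part and for the Y part add up.\<close>
    have "mpos V n (\<lambda>z. (r + s) *\<^sub>R munit V z + f z)"
      unfolding mpos_V
    proof (intro conjI allI impI)
      show "msa V n (\<lambda>z. (r + s) *\<^sub>R munit V z + f z)"
        using f X.msa_add[OF X.msa_scaleR[OF X.msa_munit, of n "r + s"] sX] by (simp add: msa_V munit_V)
      fix m \<phi> \<psi> v assume T: "T m \<phi> \<psi>"
      have st: "\<phi> \<in> matrix_states X m" "\<psi> \<in> matrix_states Y m" using T by (auto simp: T_def)
      have "0 \<le> mform n m \<phi> (\<lambda>z. r *\<^sub>R munit X z + fst (f z)) v"
        using st(1) r(2) by (simp add: X.matrix_states_iff cp_map_def)
      then have "0 \<le> of_real (r * (\<Sum>p<n. sqsum m (v p))) + mform n m \<phi> (\<lambda>z. fst (f z)) v"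
        using X.mform_munit[OF st(1)]
        by (simp add: X.mform_add[OF T_linear(1)[OF T] X.msa_scaleR[OF X.msa_munit] sX]
            X.mform_scaleR[OF T_linear(1)[OF T] X.msa_munit])
      moreover have "0 \<le> mform n m \<psi> (\<lambda>z. s *\<^sub>R munit Y z + fst (snd (f z))) v"
        using st(2) s(2) by (simp add: Y.matrix_states_iff cp_map_def)
      then have "0 \<le> of_real (s * (\<Sum>p<n. sqsum m (v p))) + mform n m \<psi> (\<lambda>z. fst (snd (f z))) v"
        using Y.mform_munit[OF st(2)]
        by (simp add: Y.mform_add[OF T_linear(2)[OF T] Y.msa_scaleR[OF Y.msa_munit] sY]
            Y.mform_scaleR[OF T_linear(2)[OF T] Y.msa_munit])
      ultimately show "0 \<le> mform n m \<phi> (\<lambda>z. fst ((r + s) *\<^sub>R munit V z + f z)) v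
          + mform n m \<psi> (\<lambda>z. fst (snd ((r + s) *\<^sub>R munit V z + f z))) v"
        unfolding mform_order_unit[OF T f] by (simp add: less_eq_complex_def distrib_right)
    qed
    then show ?thesis using r s by (intro exI[of _ "r + s"]) auto
  qed
  show "mpos V n f" if f: "msa V n f" and r: "\<And>r. r > 0 \<Longrightarrow> mpos V n (\<lambda>z. r *\<^sub>R munit V z + f z)" for n f
    unfolding mpos_V
  proof (intro conjI allI impI f)
    fix m \<phi> \<psi> v assume T: "T m \<phi> \<psi>"
    define N where "N = (\<Sum>p<n. sqsum m (v p))"
    have N: "0 \<le> N" by (simp add: N_def sum_nonneg sqsum_nonneg)
    let ?Q = "mform n m \<phi> (\<lambda>z. fst (f z)) v + mform n m \<psi> (\<lambda>z. fst (snd (f z))) v"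
    have Q: "0 \<le> of_real (r * N) + ?Q" if "r > 0" for r
      using r[OF that] T unfolding mpos_V N_def mform_order_unit[OF T f, symmetric] by blast
    have "0 \<le> Re ?Q"
    proof (rule field_le_epsilon)
      fix e :: real assume e: "e > 0"
      have "e / (N + 1) * N \<le> e" using N e by (simp add: field_simps)
      then show "0 \<le> Re ?Q + e" using Q[of "e / (N + 1)"] N e by (simp add: less_eq_complex_def)
    qed
    moreover have "Im ?Q = 0" using Q[of 1] by (simp add: less_eq_complex_def)
    ultimately show "0 \<le> ?Q" by (simp add: less_eq_complex_def)
  qed
qed

sublocale V: operator_system V by (rule operator_system_V)

section \<open>The two embeddings into the amalgam\<close>

definition hX :: "'x \<Rightarrow> 'x \<times> 'y \<times> 'v" where "hX x = (x, 0, 0)"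

text \<open>The scalar part \<open>\<sigma>0 y\<close> is sent to the shared unit, which is stored
  in the X coordinate; the remainder lies in the kernel of \<open>\<sigma>0\<close>.\<close>

definition hY :: "'y \<Rightarrow> 'x \<times> 'y \<times> 'v" where
  "hY y = (\<sigma>0 y *\<^sub>C os_unit X, y - \<sigma>0 y *\<^sub>C os_unit Y, 0)"

lemma hX_form:
  assumes T: "T m \<phi> \<psi>"
  shows "mform n m \<phi> (\<lambda>z. fst (hX (f z))) v + mform n m \<psi> (\<lambda>z. fst (snd (hX (f z)))) v = mform n m \<phi> f v"
  by (simp add: hX_def mform_def Y.entrywise_linear_zero[OF T_linear(2)[OF T]])

text \<open>Evaluating a pair on the image of y returns \<psi>(y), because moving a scalar from one
  unit to the other does not affect a pair of unital maps.\<close>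

lemma hY_form:
  assumes T: "T m \<phi> \<psi>" and f: "\<And>i j. i < n \<Longrightarrow> j < n \<Longrightarrow> f (i, j) \<in> os_space Y"
  shows "mform n m \<phi> (\<lambda>z. fst (hY (f z))) v + mform n m \<psi> (\<lambda>z. fst (snd (hY (f z)))) v = mform n m \<psi> f v"
proof -
  have st: "\<phi> \<in> matrix_states X m" "\<psi> \<in> matrix_states Y m" using T by (auto simp: T_def)
  have e: "\<phi> (fst (hY y)) $$ (i, j) + \<psi> (fst (snd (hY y))) $$ (i, j) = \<psi> y $$ (i, j)"
    if "i < m" "j < m" "y \<in> os_space Y" for i j y
    using that X.matrix_state_index[OF st(1) that(1,2)] Y.matrix_state_index[OF st(2) that(1,2)]
    by (simp add: hY_def X.unit_closed Y.unit_closed Y.space_scaleC)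
  have "mform n m \<phi> (\<lambda>z. fst (hY (f z))) v + mform n m \<psi> (\<lambda>z. fst (snd (hY (f z)))) v =
    (\<Sum>p<n. \<Sum>q<n. \<Sum>i<m. \<Sum>j<m. cnj (v p i) * v q j *
      (\<phi> (fst (hY (f (p, q)))) $$ (i, j) + \<psi> (fst (snd (hY (f (p, q))))) $$ (i, j)))"
    by (simp add: mform_def distrib_left sum.distrib)
  also have "\<dots> = mform n m \<psi> f v"
    unfolding mform_def by (intro sum.cong refl) (simp add: e f)
  finally show ?thesis .
qed

lemma T_X: assumes "1 \<le> n" "\<phi> \<in> matrix_states X n" shows "\<exists>\<psi>. T n \<phi> \<psi>"
  using closeX[OF assms] assms eps unfolding T_def by (meson less_imp_le order_trans)

lemma T_Y: assumes "1 \<le> n" "\<psi> \<in> matrix_states Y n" shows "\<exists>\<phi>. T n \<phi> \<psi>"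
  using closeY[OF assms] assms eps unfolding T_def by (meson less_imp_le order_trans)

lemma embedding_X: "complete_order_embedding X V hX"
proof (rule complete_order_embeddingI)
  show "mpos V n (\<lambda>z. hX (f z)) \<longleftrightarrow> mpos X n f"
    if f: "\<And>i j. i < n \<Longrightarrow> j < n \<Longrightarrow> f (i, j) \<in> os_space X" for n f
  proof
    assume m: "mpos V n (\<lambda>z. hX (f z))"
    then have s: "msa X n f" by (auto simp: mpos_V msa_V hX_def)
    show "mpos X n f"
    proof (rule ccontr)
      assume "\<not> mpos X n f"
      then obtain \<phi> v where \<phi>: "\<phi> \<in> matrix_states X n" "\<not> 0 \<le> mform n n \<phi> f v"
        using X.separating_matrix_state[OF s] by blast
      \<comment> \<open>Partners exist only for positive sizes. For n = 0 the form is an empty sum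
        and could not fail to be nonnegative.\<close>
      have "1 \<le> n" using \<phi>(2) by (cases n) (auto simp: mform_def)
      then obtain \<psi> where T: "T n \<phi> \<psi>" using T_X \<phi>(1) by blast
      show False using m T hX_form[OF T, of n f v] \<phi>(2) unfolding mpos_V by metis
    qed
  next
    assume m: "mpos X n f"
    show "mpos V n (\<lambda>z. hX (f z))"
      unfolding mpos_V
    proof (intro conjI allI impI)
      show "msa V n (\<lambda>z. hX (f z))"
        using X.mpos_msa[OF m] Y.msa_zero by (simp add: msa_V hX_def Y.state_zero[OF \<sigma>0])
      fix k \<phi> \<psi> v assume T: "T k \<phi> \<psi>"
      show "0 \<le> mform n k \<phi> (\<lambda>z. fst (hX (f z))) v + mform n k \<psi> (\<lambda>z. fst (snd (hX (f z)))) v"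
        unfolding hX_form[OF T] using T m by (simp add: T_def X.matrix_states_iff cp_map_def)
    qed
  qed
qed (auto simp: X.operator_system_axioms V.operator_system_axioms hX_def V_simps Y.space_zero Y.star_zero
    Y.state_zero[OF \<sigma>0] scaleC_prod_def inj_on_def)

lemma hY_space: "y \<in> os_space Y \<Longrightarrow> hY y \<in> os_space V"
  by (simp add: hY_def V_simps X.space_scaleC X.unit_closed Y.space_diff Y.space_scaleC Y.unit_closed
      Y.state_diff[OF \<sigma>0] Y.state_scaleC[OF \<sigma>0] Y.state_unit[OF \<sigma>0])

lemma hY_star: "y \<in> os_space Y \<Longrightarrow> os_star V (hY y) = hY (os_star Y y)"
  by (simp add: hY_def V_simps Y.state_star[OF \<sigma>0] X.star_scaleC X.unit_closed X.star_unit Y.star_diff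
      Y.star_scaleC Y.star_unit Y.unit_closed Y.space_scaleC)

lemma embedding_Y: "complete_order_embedding Y V hY"
proof (rule complete_order_embeddingI)
  show "mpos V n (\<lambda>z. hY (f z)) \<longleftrightarrow> mpos Y n f"
    if f: "\<And>i j. i < n \<Longrightarrow> j < n \<Longrightarrow> f (i, j) \<in> os_space Y" for n f
  proof
    assume m: "mpos V n (\<lambda>z. hY (f z))"
    have s: "msa Y n f"
      unfolding msa_def
    proof (intro allI impI conjI f)
      fix i j assume ij: "i < n" "j < n"
      \<comment> \<open>Self-adjointness in \<open>V\<close> is known by coordinates only. The X
        coordinate, whose unit is not 0, yields the symmetry of the scalars
        \<open>\<sigma>0 (f (i, j))\<close>, and with it the Y coordinate yields that of
        \<open>f\<close>.\<close>
      have "os_star X (\<sigma>0 (f (j, i)) *\<^sub>C os_unit X) = \<sigma>0 (f (i, j)) *\<^sub>C os_unit X"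
        and Y: "os_star Y (f (j, i) - \<sigma>0 (f (j, i)) *\<^sub>C os_unit Y) = f (i, j) - \<sigma>0 (f (i, j)) *\<^sub>C os_unit Y"
        using m ij unfolding mpos_V msa_V by (auto simp: hY_def msa_def)
      then have "cnj (\<sigma>0 (f (j, i))) *\<^sub>C os_unit X = \<sigma>0 (f (i, j)) *\<^sub>C os_unit X"
        by (simp add: X.star_scaleC X.unit_closed X.star_unit)
      moreover have "os_unit X \<noteq> 0"
      proof -
        obtain \<phi> where "\<phi> \<in> matrix_states X 1"
          using T_Y[OF order_refl Y.state_matrix_state[OF \<sigma>0]] by (auto simp: T_def)
        from X.matrix_state_index(5)[OF this, of 0 0] X.entrywise_linear_zero[OF X.cp_map_linear, of 1 \<phi> 0 0] this
        show ?thesis by (auto simp: X.matrix_states_iff)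
      qed
      ultimately have "cnj (\<sigma>0 (f (j, i))) = \<sigma>0 (f (i, j))" by (simp add: cv.scale_right_imp_eq)
      with Y show "os_star Y (f (j, i)) = f (i, j)"
        using f[OF ij] f[OF ij(2,1)]
        by (simp add: Y.star_diff Y.star_scaleC Y.unit_closed Y.star_unit Y.space_scaleC)
    qed
    show "mpos Y n f"
    proof (rule ccontr)
      assume "\<not> mpos Y n f"
      then obtain \<psi> v where \<psi>: "\<psi> \<in> matrix_states Y n" "\<not> 0 \<le> mform n n \<psi> f v"
        using Y.separating_matrix_state[OF s] by blast
      have "1 \<le> n" using \<psi>(2) by (cases n) (auto simp: mform_def)
      then obtain \<phi> where T: "T n \<phi> \<psi>" using T_Y \<psi>(1) by blast
      have "mform n n \<phi> (\<lambda>z. fst (hY (f z))) v + mform n n \<psi> (\<lambda>z. fst (snd (hY (f z)))) v = mform n n \<psi> f v"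
        by (rule hY_form[OF T]) (rule f)
      then show False using m T \<psi>(2) unfolding mpos_V by metis
    qed
  next
    assume m: "mpos Y n f"
    note s = Y.mpos_msa[OF m]
    show "mpos V n (\<lambda>z. hY (f z))"
      unfolding mpos_V
    proof (intro conjI allI impI)
      show "msa V n (\<lambda>z. hY (f z))"
        unfolding msa_def
      proof (intro allI impI conjI)
        fix i j assume ij: "i < n" "j < n"
        then show "hY (f (i, j)) \<in> os_space V" by (intro hY_space f)
        show "os_star V (hY (f (j, i))) = hY (f (i, j))"
          using s ij hY_star[OF f[OF ij(2,1)]] by (simp add: msa_def)
      qed
      fix k \<phi> \<psi> v assume T: "T k \<phi> \<psi>"
      show "0 \<le> mform n k \<phi> (\<lambda>z. fst (hY (f z))) v + mform n k \<psi> (\<lambda>z. fst (snd (hY (f z)))) v"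
        by (subst hY_form[OF T]) (use f T m in \<open>auto simp: T_def Y.matrix_states_iff cp_map_def\<close>)
    qed
  qed
  show "inj_on hY (os_space Y)"
  proof (rule inj_onI)
    fix y y' assume y: "y \<in> os_space Y" "y' \<in> os_space Y" and e: "hY y = hY y'"
    obtain \<phi> where "\<phi> \<in> matrix_states X 1"
      using T_Y[OF order_refl Y.state_matrix_state[OF \<sigma>0]] by (auto simp: T_def)
    from X.matrix_state_index(5)[OF this, of 0 0] X.entrywise_linear_zero[OF X.cp_map_linear, of 1 \<phi> 0 0] this
    have "os_unit X \<noteq> 0" by (auto simp: X.matrix_states_iff)
    then have "\<sigma>0 y = \<sigma>0 y'" using e by (simp add: hY_def)
    then show "y = y'" using e by (simp add: hY_def)
  qed
  show "hY y \<in> os_space V" if "y \<in> os_space Y" for y by (rule hY_space[OF that])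
  show "hY (os_star Y y) = os_star V (hY y)" if "y \<in> os_space Y" for y using hY_star[OF that] by simp
qed (auto simp: Y.operator_system_axioms V.operator_system_axioms hY_def V_simps
    Y.space_scaleC Y.unit_closed Y.state_scaleC[OF \<sigma>0] Y.state_unit[OF \<sigma>0]
    Y.state_add[OF \<sigma>0] scaleC_add_left scaleC_prod_def scaleC_scaleC cv.scale_right_diff_distrib scaleC_one)

section \<open>Norm and Hausdorff distance in the amalgam\<close>

sublocale EX: order_embedding X V hX
  by unfold_locales (rule embedding_X)

sublocale EY: order_embedding Y V hY
  by unfold_locales (rule embedding_Y)

text \<open>On \<epsilon>1 plus or minus \<open>hX x - hY y\<close> a pair takes the value
  \<epsilon> plus or minus (\<phi>(x) - \<psi>(y)). This is positive because the hermitian matrix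
  \<phi>(x) - \<psi>(y) has norm at most \<epsilon>.\<close>

lemma norm_V_le:
  assumes z: "z \<in> lip_ball Z L" shows "os_norm V (hX (fst z) - hY (snd z)) \<le> \<epsilon>"
proof -
  have sa: "fst z \<in> os_sa X" "snd z \<in> os_sa Y" using z by (auto simp: lip_ball_def sa_sum_iff)
  let ?d = "hX (fst z) - hY (snd z)"
  have dsa: "?d \<in> os_sa V" using sa EX.map_sa EY.map_sa V.sa_diff by blast
  have "\<epsilon> *\<^sub>R os_unit V + c *\<^sub>R ?d \<in> os_pos V" if c: "\<bar>c\<bar> = 1" for c
    unfolding V.pos_iff mpos_V
  proof (intro conjI allI impI)
    have s1: "msa V 1 (\<lambda>_. c *\<^sub>R ?d)" using V.sa_scaleR[OF dsa, of c] by (simp add: msa_def os_sa_def)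
    have "\<epsilon> *\<^sub>R os_unit V + c *\<^sub>R ?d \<in> os_sa V" using dsa by (intro V.sa_add V.sa_scaleR V.sa_unit)
    then show "msa V 1 (\<lambda>_. \<epsilon> *\<^sub>R os_unit V + c *\<^sub>R ?d)" by (simp add: msa_def os_sa_def)
    fix m \<phi> \<psi> and v :: "nat \<Rightarrow> nat \<Rightarrow> complex" assume T: "T m \<phi> \<psi>"
    have st: "\<phi> \<in> matrix_states X m" "\<psi> \<in> matrix_states Y m"
      and le: "op_norm (\<phi> (fst z) - \<psi> (snd z)) \<le> \<epsilon>" using T z by (auto simp: T_def)
    have car: "\<phi> (fst z) \<in> carrier_mat m m" "\<psi> (snd z) \<in> carrier_mat m m"
      using X.matrix_state_carrier[OF st(1) X.sa_space[OF sa(1)]] Y.matrix_state_carrier[OF st(2) Y.sa_space[OF sa(2)]] .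
    define B where "B = \<phi> (fst z) - \<psi> (snd z)"
    have B: "B \<in> carrier_mat m m" using car by (simp add: B_def minus_carrier_mat)
    let ?F = "sform m (\<lambda>i j. B $$ (i, j)) (v 0) (v 0)"
    have "mform 1 m \<phi> (\<lambda>_. fst (\<epsilon> *\<^sub>R os_unit V + c *\<^sub>R ?d)) v + mform 1 m \<psi> (\<lambda>_. fst (snd (\<epsilon> *\<^sub>R os_unit V + c *\<^sub>R ?d))) v
      = of_real (\<epsilon> * sqsum m (v 0)) + of_real c * ?F"
    proof -
      have fs: "fst ?d = fst z - \<sigma>0 (snd z) *\<^sub>C os_unit X" "fst (snd ?d) = \<sigma>0 (snd z) *\<^sub>C os_unit Y - snd z"
        by (simp_all add: hX_def hY_def)
      have "\<phi> (fst (\<epsilon> *\<^sub>R os_unit V + c *\<^sub>R ?d)) $$ (i, j) + \<psi> (fst (snd (\<epsilon> *\<^sub>R os_unit V + c *\<^sub>R ?d))) $$ (i, j)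
          = of_real c * B $$ (i, j) + (if i = j then of_real \<epsilon> else 0)" if ij: "i < m" "j < m" for i j
      proof -
        note iX = X.matrix_state_index[OF st(1) ij] and iY = Y.matrix_state_index[OF st(2) ij]
        \<comment> \<open>The multiples of \<open>\<sigma>0 (snd z)\<close> in the two coordinates
          cancel, leaving \<open>c\<close> times \<open>B\<close> and \<epsilon> on the
          diagonal.\<close>
        have 1: "\<phi> (fst (\<epsilon> *\<^sub>R os_unit V + c *\<^sub>R ?d)) $$ (i, j) =
            of_real \<epsilon> * (if i = j then 1 else 0) + of_real c * (\<phi> (fst z) $$ (i, j) - \<sigma>0 (snd z) * (if i = j then 1 else 0))"
          using X.sa_space[OF sa(1)]
          by (simp only: fst_add fst_scaleR fs V_simps fst_conv iX X.unit_closed X.space_scaleR X.space_scaleC X.space_diff X.space_add)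
        have 2: "\<psi> (fst (snd (\<epsilon> *\<^sub>R os_unit V + c *\<^sub>R ?d))) $$ (i, j) =
            of_real c * (\<sigma>0 (snd z) * (if i = j then 1 else 0) - \<psi> (snd z) $$ (i, j))"
          using Y.sa_space[OF sa(2)]
          by (simp only: fst_add snd_add fst_scaleR snd_scaleR fs V_simps fst_conv snd_conv iY Y.unit_closed
              Y.space_scaleR Y.space_scaleC Y.space_diff Y.space_add scaleR_zero_right add_0_left)
        show ?thesis unfolding 1 2 using ij car by (simp add: B_def algebra_simps)
      qed
      then have "mform 1 m \<phi> (\<lambda>_. fst (\<epsilon> *\<^sub>R os_unit V + c *\<^sub>R ?d)) v + mform 1 m \<psi> (\<lambda>_. fst (snd (\<epsilon> *\<^sub>R os_unit V + c *\<^sub>R ?d))) v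
        = sform m (\<lambda>i j. of_real c * B $$ (i, j) + (if i = j then of_real \<epsilon> else 0)) (v 0) (v 0)"
        unfolding mform_sform by (simp add: sform_def sum.distrib[symmetric] distrib_left[symmetric] del: fst_add snd_add)
      also have "\<dots> = of_real c * ?F + of_real \<epsilon> * of_real (sqsum m (v 0))"
        unfolding sform_scalar by (simp add: sqsum_def sform_def sum_distrib_left mult_ac)
      finally show ?thesis by simp
    qed
    moreover have "Im ?F = 0"
    proof -
      have herm: "B $$ (i, j) = cnj (B $$ (j, i))" if ij: "i < m" "j < m" for i j
      proof -
        have "\<phi> (fst z) $$ (i, j) = cnj (\<phi> (fst z) $$ (j, i))" "\<psi> (snd z) $$ (i, j) = cnj (\<psi> (snd z) $$ (j, i))"
          using X.cp_map_star[of m \<phi> "fst z" i j] Y.cp_map_star[of m \<psi> "snd z" i j] st sa ij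
          by (auto simp: X.matrix_states_iff Y.matrix_states_iff X.sa_space Y.sa_space X.sa_star Y.sa_star)
        then show ?thesis using car ij by (simp add: B_def)
      qed
      have "cnj ?F = (\<Sum>i<m. \<Sum>j<m. cnj (v 0 j) * v 0 i * B $$ (j, i))"
        unfolding sform_def cnj_sum
      proof (intro sum.cong refl)
        fix i j assume "i \<in> {..<m}" "j \<in> {..<m}"
        then have "B $$ (j, i) = cnj (B $$ (i, j))" using herm[of j i] by simp
        then show "cnj (cnj (v 0 i) * v 0 j * B $$ (i, j)) = cnj (v 0 j) * v 0 i * B $$ (j, i)"
          by simp
      qed
      also have "\<dots> = ?F" unfolding sform_def by (rule sum.swap)
      finally show ?thesis by (simp add: complex_eq_iff)
    qed
    moreover have "\<bar>Re ?F\<bar> \<le> \<epsilon> * sqsum m (v 0)"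
      using abs_Re_le_cmod[of ?F] cmod_sform_le[OF B, of "v 0"] mult_right_mono[OF le sqsum_nonneg[of m "v 0"]]
      by (simp add: B_def)
    ultimately show "0 \<le> mform 1 m \<phi> (\<lambda>_. fst (\<epsilon> *\<^sub>R os_unit V + c *\<^sub>R ?d)) v + mform 1 m \<psi> (\<lambda>_. fst (snd (\<epsilon> *\<^sub>R os_unit V + c *\<^sub>R ?d))) v"
      using c by (cases "c \<ge> 0") (auto simp: less_eq_complex_def abs_le_iff)
  qed
  from this[of 1] this[of "-1"] have "\<epsilon> *\<^sub>R os_unit V + ?d \<in> os_pos V" "\<epsilon> *\<^sub>R os_unit V + - ?d \<in> os_pos V"
    by simp_all
  then have "V.bounded_by \<epsilon> ?d" unfolding V.bounded_by_def by (simp only: diff_conv_add_uminus)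
  then show ?thesis using eps dsa by (intro V.os_norm_le) auto
qed

text \<open>Admissibility lifts a point of the unit ball of one summand only up to a factor \<open>1 + \<delta>\<close>.\<close>

lemma lift_ball:
  assumes N: "N = (INF z\<in>{z \<in> os_sa Z. P z}. L z)" "N \<le> 1" and \<delta>: "\<delta> > 0"
  obtains z where "z \<in> os_sa Z" "P z" "(1 / (1 + \<delta>)) *\<^sub>R z \<in> lip_ball Z L"
proof -
  have "(INF z\<in>{z \<in> os_sa Z. P z}. L z) < ennreal (1 + \<delta>)"
  proof -
    have "(1::ennreal) < ennreal (1 + \<delta>)" using \<delta> by (simp add: ennreal_less_iff flip: ennreal_1)
    with N(2) have "N < ennreal (1 + \<delta>)" by (rule order_le_less_trans)
    then show ?thesis unfolding N(1) .
  qed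
  then obtain z where z: "z \<in> os_sa Z" "P z" "L z < ennreal (1 + \<delta>)" by (auto simp: INF_less_iff)
  have "L ((1 / (1 + \<delta>)) *\<^sub>R z) = ennreal (1 / (1 + \<delta>)) * L z"
    using adm z(1) \<delta> by (simp add: admissible_def lip_norm_def)
  also have "\<dots> \<le> ennreal (1 / (1 + \<delta>)) * ennreal (1 + \<delta>)" using z(3) by (intro mult_left_mono) auto
  also have "\<dots> = ennreal (1 / (1 + \<delta>) * (1 + \<delta>))" using \<delta> by (intro ennreal_mult[symmetric]) auto
  also have "\<dots> = 1" using \<delta> by simp
  finally have "(1 / (1 + \<delta>)) *\<^sub>R z \<in> lip_ball Z L" using z(1) by (simp add: lip_ball_def Z.sa_scaleR)
  then show thesis using that z by blast
qed

lemma lip_ball_parts: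
  assumes "z \<in> lip_ball Z L" shows "fst z \<in> lip_ball X LX" "snd z \<in> lip_ball Y LY"
proof -
  have sa: "z \<in> os_sa Z" "fst z \<in> os_sa X" "snd z \<in> os_sa Y" and L: "L z \<le> 1"
    using assms by (auto simp: lip_ball_def sa_sum_iff)
  have "LX (fst z) \<le> L z" using adm sa by (auto simp: admissible_def intro!: INF_lower2)
  moreover have "LY (snd z) \<le> L z" using adm sa by (auto simp: admissible_def intro!: INF_lower2)
  ultimately show "fst z \<in> lip_ball X LX" "snd z \<in> lip_ball Y LY" using sa L by (auto simp: lip_ball_def)
qed

lemma shrink_norm:
  assumes "x \<in> os_sa V" "\<delta> > 0"
  shows "os_norm V (x - (1 / (1 + \<delta>)) *\<^sub>R x) \<le> \<delta> * os_norm V x"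
proof -
  have "x - (1 / (1 + \<delta>)) *\<^sub>R x = (1 - 1 / (1 + \<delta>)) *\<^sub>R x" by (simp add: scaleR_diff_left)
  then have "os_norm V (x - (1 / (1 + \<delta>)) *\<^sub>R x) = \<bar>1 - 1 / (1 + \<delta>)\<bar> * os_norm V x"
    using V.os_norm_scaleR[OF assms(1)] by simp
  also have "\<dots> \<le> \<delta> * os_norm V x"
    using assms V.os_norm_nonneg[OF assms(1)] by (intro mult_right_mono) (auto simp: abs_if field_simps)
  finally show ?thesis .
qed

text \<open>The error \<delta> r comes from shrinking a fixed element of norm r. The bound need not
  be uniform over the Lip-ball, so \<delta> may be chosen after r.\<close>

lemma le_epsilon_scaled:
  fixes a :: ennreal
  assumes "\<And>\<delta>. \<delta> > 0 \<Longrightarrow> a \<le> ennreal (\<epsilon> + \<delta> * r)" "0 \<le> r"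
  shows "a \<le> ennreal \<epsilon>"
proof (rule ennreal_le_epsilon)
  fix e :: real assume e: "0 < e"
  have "a \<le> ennreal (\<epsilon> + e / (r + 1) * r)" by (rule assms(1)) (use assms(2) e in simp)
  also have "\<dots> \<le> ennreal (\<epsilon> + e)" using assms(2) e by (intro ennreal_leI) (simp add: field_simps)
  also have "\<dots> = ennreal \<epsilon> + ennreal e" using eps e by (intro ennreal_plus) auto
  finally show "a \<le> ennreal \<epsilon> + ennreal e" .
qed

text \<open>For x in the Lip-ball, x / (1 + \<delta>) is a coordinate of an element of the Lip-ball
  of the sum. The other coordinate lies within \<epsilon> of it in \<open>V\<close>, and the
  shrinking costs at most \<delta> times the norm of x.\<close>

lemma hausdorff_V_le:
  "hausdorff (\<lambda>v w. ennreal (os_norm V (v - w))) (hX ` lip_ball X LX) (hY ` lip_ball Y LY) \<le> ennreal \<epsilon>"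
  unfolding hausdorff_def
proof (intro max.boundedI SUP_least)
  fix v assume "v \<in> hX ` lip_ball X LX"
  then obtain x where x: "v = hX x" "x \<in> os_sa X" "LX x \<le> 1" by (auto simp: lip_ball_def)
  show "(INF w\<in>hY ` lip_ball Y LY. ennreal (os_norm V (v - w))) \<le> ennreal \<epsilon>"
  proof (rule le_epsilon_scaled)
    fix \<delta> :: real assume \<delta>: "\<delta> > 0"
    obtain z where z: "z \<in> os_sa Z" "fst z = x" "(1 / (1 + \<delta>)) *\<^sub>R z \<in> lip_ball Z L"
      using lift_ball[of "LX x" "\<lambda>z. fst z = x" \<delta>] adm x \<delta> by (auto simp: admissible_def)
    let ?z = "(1 / (1 + \<delta>)) *\<^sub>R z"
    have y: "snd ?z \<in> lip_ball Y LY" using lip_ball_parts[OF z(3)] by blast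
    have sa: "hX x \<in> os_sa V" "hX (fst ?z) \<in> os_sa V" "hY (snd ?z) \<in> os_sa V"
      using EX.map_sa EY.map_sa x lip_ball_parts[OF z(3)] by (auto simp: lip_ball_def)
    have hz: "hX (fst ?z) = (1 / (1 + \<delta>)) *\<^sub>R hX x" using z(2) x by (simp add: EX.map_scaleR X.sa_space)
    have "hX x - hY (snd ?z) = (hX (fst ?z) - hY (snd ?z)) + (hX x - hX (fst ?z))" by simp
    then have "os_norm V (hX x - hY (snd ?z)) \<le> os_norm V (hX (fst ?z) - hY (snd ?z)) + os_norm V (hX x - hX (fst ?z))"
      using V.os_norm_triangle[OF V.sa_diff[OF sa(2,3)] V.sa_diff[OF sa(1,2)]] by simp
    also have "\<dots> \<le> \<epsilon> + \<delta> * os_norm V (hX x)"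
      using norm_V_le[OF z(3)] shrink_norm[OF sa(1) \<delta>] unfolding hz by simp
    finally show "(INF w\<in>hY ` lip_ball Y LY. ennreal (os_norm V (v - w))) \<le> ennreal (\<epsilon> + \<delta> * os_norm V (hX x))"
      unfolding x(1) using y by (intro INF_lower2[of "hY (snd ?z)"] ennreal_leI) auto
  qed (use x EX.map_sa V.os_norm_nonneg in auto)
next
  fix w assume "w \<in> hY ` lip_ball Y LY"
  then obtain y where y: "w = hY y" "y \<in> os_sa Y" "LY y \<le> 1" by (auto simp: lip_ball_def)
  show "(INF v\<in>hX ` lip_ball X LX. ennreal (os_norm V (v - w))) \<le> ennreal \<epsilon>"
  proof (rule le_epsilon_scaled)
    fix \<delta> :: real assume \<delta>: "\<delta> > 0"
    obtain z where z: "z \<in> os_sa Z" "snd z = y" "(1 / (1 + \<delta>)) *\<^sub>R z \<in> lip_ball Z L"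
      using lift_ball[of "LY y" "\<lambda>z. snd z = y" \<delta>] adm y \<delta> by (auto simp: admissible_def)
    let ?z = "(1 / (1 + \<delta>)) *\<^sub>R z"
    have x: "fst ?z \<in> lip_ball X LX" using lip_ball_parts[OF z(3)] by blast
    have sa: "hY y \<in> os_sa V" "hX (fst ?z) \<in> os_sa V" "hY (snd ?z) \<in> os_sa V"
      using EX.map_sa EY.map_sa y lip_ball_parts[OF z(3)] by (auto simp: lip_ball_def)
    have hz: "hY (snd ?z) = (1 / (1 + \<delta>)) *\<^sub>R hY y" using z(2) y by (simp add: EY.map_scaleR Y.sa_space)
    have "hX (fst ?z) - hY y = (hX (fst ?z) - hY (snd ?z)) + - (hY y - hY (snd ?z))" by simp
    then have "os_norm V (hX (fst ?z) - hY y) \<le> os_norm V (hX (fst ?z) - hY (snd ?z)) + os_norm V (hY y - hY (snd ?z))"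
      using V.os_norm_triangle[OF V.sa_diff[OF sa(2,3)] V.sa_minus[OF V.sa_diff[OF sa(1,3)]]]
        V.os_norm_minus[OF V.sa_diff[OF sa(1,3)]] by simp
    also have "\<dots> \<le> \<epsilon> + \<delta> * os_norm V (hY y)"
      using norm_V_le[OF z(3)] shrink_norm[OF sa(1) \<delta>] unfolding hz by simp
    finally show "(INF v\<in>hX ` lip_ball X LX. ennreal (os_norm V (v - w))) \<le> ennreal (\<epsilon> + \<delta> * os_norm V (hY y))"
      unfolding y(1) using x by (intro INF_lower2[of "hX (fst ?z)"] ennreal_leI) auto
  qed (use y EY.map_sa V.os_norm_nonneg in auto)
qed

lemma dist_op_le: "dist_op TYPE('v) X LX Y LY \<le> ennreal \<epsilon>"
  unfolding dist_op_def
  using hausdorff_V_le embedding_X embedding_Y operator_system_V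
  by (intro INF_lower2[of "(V, hX, hY)"]) auto

end

text \<open>Operator systems with zero unit have no states and are excluded from the construction above.\<close>

lemma dist_op_trivial:
  fixes X :: "'x::complex_vector op_system" and Y :: "'y::complex_vector op_system"
  assumes X: "lip_normed_op_system X LX" and Y: "lip_normed_op_system Y LY"
    and unit: "os_unit X = 0" "os_unit Y = 0"
  shows "dist_op TYPE('v::complex_vector) X LX Y LY = 0"
proof -
  interpret X: operator_system X using X by (simp add: lip_normed_op_system_def)
  interpret Y: operator_system Y using Y by (simp add: lip_normed_op_system_def)
  define V :: "('x \<times> 'y \<times> 'v) op_system" where
    "V = \<lparr>os_space = {0}, os_star = (\<lambda>_. 0), os_unit = 0, os_cone = (\<lambda>n. {0\<^sub>m n n})\<rparr>"
  have mpos: "mpos V n f \<longleftrightarrow> (\<forall>i<n. \<forall>j<n. f (i, j) = 0)" for n f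
  proof -
    have "0\<^sub>m n n = Matrix.mat n n (\<lambda>_. 0 :: 'x \<times> 'y \<times> 'v)" by (rule eq_matI) auto
    then show ?thesis by (simp add: mpos_def V_def mat_fun_eq_iff)
  qed
  have msa: "msa V n f \<longleftrightarrow> (\<forall>i<n. \<forall>j<n. f (i, j) = 0)" for n f
    by (auto simp: msa_def V_def)
  have munit: "munit V = (\<lambda>_. 0)" by (auto simp: munit_def V_def)
  have V: "operator_system V"
  proof (rule operator_systemI)
    show "module.subspace scaleC (os_space V)" by (simp add: V_def cv.subspace_single_0)
    show "mpos V m (mcompress n a f)" if "mpos V n f" for n m f a
      using that by (simp add: mpos mcompress_def)
    show "\<exists>r>0. mpos V n (\<lambda>z. r *\<^sub>R munit V z + f z)" if "msa V n f" for n f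
      using that by (intro exI[of _ 1]) (simp add: mpos msa munit)
  qed (auto simp: V_def[THEN arg_cong[where f = os_space]] V_def[THEN arg_cong[where f = os_star]]
      V_def[THEN arg_cong[where f = os_unit]] V_def[THEN arg_cong[where f = os_cone]] mpos msa)
  have embX: "complete_order_embedding X V (\<lambda>_. 0)"
  proof (rule complete_order_embeddingI[OF X.operator_system_axioms V])
    show "mpos V n (\<lambda>z. 0) \<longleftrightarrow> mpos X n f" if "\<And>i j. i < n \<Longrightarrow> j < n \<Longrightarrow> f (i, j) \<in> os_space X" for n f
      using that mpos_cong[OF X.mpos_zero, of n f] by (simp add: mpos X.trivial_space[OF unit(1)])
  qed (auto simp: V_def X.trivial_space[OF unit(1)])
  have embY: "complete_order_embedding Y V (\<lambda>_. 0)"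
  proof (rule complete_order_embeddingI[OF Y.operator_system_axioms V])
    show "mpos V n (\<lambda>z. 0) \<longleftrightarrow> mpos Y n f" if "\<And>i j. i < n \<Longrightarrow> j < n \<Longrightarrow> f (i, j) \<in> os_space Y" for n f
      using that mpos_cong[OF Y.mpos_zero, of n f] by (simp add: mpos Y.trivial_space[OF unit(2)])
  qed (auto simp: V_def Y.trivial_space[OF unit(2)])
  have "LX (0 *\<^sub>R os_unit X) = 0" "LY (0 *\<^sub>R os_unit Y) = 0"
    using X Y unfolding lip_normed_op_system_def lip_norm_def by blast+
  then have ball: "0 \<in> lip_ball X LX" "0 \<in> lip_ball Y LY"
    by (simp_all add: lip_ball_def X.sa_zero Y.sa_zero)
  have "os_norm V 0 = 0" by (rule operator_system.os_norm_zero[OF V])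
  moreover have "(\<lambda>_. 0 :: 'x \<times> 'y \<times> 'v) ` lip_ball X LX = {0}" "(\<lambda>_. 0 :: 'x \<times> 'y \<times> 'v) ` lip_ball Y LY = {0}"
    using ball by auto
  ultimately have "hausdorff (\<lambda>v w. ennreal (os_norm V (v - w))) ((\<lambda>_. 0) ` lip_ball X LX) ((\<lambda>_. 0) ` lip_ball Y LY) = 0"
    unfolding hausdorff_def by simp
  moreover have "dist_op TYPE('v) X LX Y LY \<le>
      hausdorff (\<lambda>v w. ennreal (os_norm V (v - w))) ((\<lambda>_. 0) ` lip_ball X LX) ((\<lambda>_. 0) ` lip_ball Y LY)"
    unfolding dist_op_def using V embX embY by (intro INF_lower2[of "(V, \<lambda>_. 0, \<lambda>_. 0)"]) auto
  ultimately show ?thesis by simp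
qed

theorem dist_op_le_dist_s:
  fixes X :: "'x::complex_vector op_system" and Y :: "'y::complex_vector op_system"
  assumes X: "lip_normed_op_system X LX" and Y: "lip_normed_op_system Y LY"
  shows "dist_op TYPE('v::complex_vector) X LX Y LY \<le> dist_s X LX Y LY"
  unfolding dist_s_def
proof (rule INF_greatest)
  interpret X: operator_system X using X by (simp add: lip_normed_op_system_def)
  interpret Y: operator_system Y using Y by (simp add: lip_normed_op_system_def)
  let ?Z = "os_sum X Y"
  fix L assume "L \<in> {L. admissible X LX Y LY L}"
  then have adm: "admissible X LX Y LY L" by simp
  let ?d = "lip_mat_dist ?Z L"
  let ?A = "\<lambda>n. (\<lambda>\<phi>. restrict (\<phi> \<circ> fst) (os_space ?Z)) ` matrix_states X n"
  let ?B = "\<lambda>n. (\<lambda>\<psi>. restrict (\<psi> \<circ> snd) (os_space ?Z)) ` matrix_states Y n"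
  let ?S = "SUP n\<in>{1..}. hausdorff ?d (?A n) (?B n)"
  show "dist_op TYPE('v) X LX Y LY \<le> ?S"
  proof (rule ennreal_le_epsilon)
    fix e :: real assume fin: "?S < Orderings.top_class.top" and e: "0 < e"
    \<comment> \<open>Half of the slack makes partners exist at distance at most \<epsilon>0; the
      other half is the margin between \<epsilon>0 and \<epsilon>.\<close>
    define \<epsilon>0 where "\<epsilon>0 = enn2real ?S + e / 2"
    define \<epsilon> where "\<epsilon> = enn2real ?S + e"
    have eps: "0 \<le> \<epsilon>0" "\<epsilon>0 < \<epsilon>" using e by (simp_all add: \<epsilon>0_def \<epsilon>_def)
    have \<epsilon>0_eq: "ennreal \<epsilon>0 = ?S + ennreal (e / 2)" using fin e by (simp add: \<epsilon>0_def)
    have "x < x + ennreal (e / 2)" if "x < Orderings.top_class.top" for x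
      using that e by (simp add: ennreal_add_left_cancel_less)
    from this[OF fin] have less: "?S < ennreal \<epsilon>0" unfolding \<epsilon>0_eq .
    have haus: "hausdorff ?d (?A n) (?B n) < ennreal \<epsilon>0" if "1 \<le> n" for n
      using that by (intro order_le_less_trans[OF SUP_upper less]) auto
    have pair: "\<forall>z\<in>lip_ball ?Z L. op_norm (\<phi> (fst z) - \<psi> (snd z)) \<le> \<epsilon>0"
      if "?d (restrict (\<phi> \<circ> fst) (os_space ?Z)) (restrict (\<psi> \<circ> snd) (os_space ?Z)) < ennreal \<epsilon>0" for \<phi> \<psi>
    proof
      fix z assume z: "z \<in> lip_ball ?Z L"
      then have zs: "z \<in> os_space ?Z" by (simp add: lip_ball_def os_sa_def)
      have "ennreal (op_norm (restrict (\<phi> \<circ> fst) (os_space ?Z) z - restrict (\<psi> \<circ> snd) (os_space ?Z) z))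
          \<le> ?d (restrict (\<phi> \<circ> fst) (os_space ?Z)) (restrict (\<psi> \<circ> snd) (os_space ?Z))"
        unfolding lip_mat_dist_def using z by (rule SUP_upper)
      from order_le_less_trans[OF this that]
      have "ennreal (op_norm (\<phi> (fst z) - \<psi> (snd z))) < ennreal \<epsilon>0" using zs by simp
      then show "op_norm (\<phi> (fst z) - \<psi> (snd z)) \<le> \<epsilon>0"
        using ennreal_leI[of \<epsilon>0 "op_norm (\<phi> (fst z) - \<psi> (snd z))"] by (meson linorder_not_le nle_le)
    qed
    have closeX: "\<exists>\<psi>\<in>matrix_states Y n. \<forall>z\<in>lip_ball ?Z L. op_norm (\<phi> (fst z) - \<psi> (snd z)) \<le> \<epsilon>0"
      if n: "1 \<le> n" and \<phi>: "\<phi> \<in> matrix_states X n" for n \<phi>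
    proof -
      have "(INF b\<in>?B n. ?d (restrict (\<phi> \<circ> fst) (os_space ?Z)) b) \<le> hausdorff ?d (?A n) (?B n)"
        unfolding hausdorff_def by (intro max.coboundedI1 SUP_upper) (use \<phi> in blast)
      then have "(INF b\<in>?B n. ?d (restrict (\<phi> \<circ> fst) (os_space ?Z)) b) < ennreal \<epsilon>0"
        using haus[OF n] by (rule order_le_less_trans)
      then show ?thesis unfolding INF_less_iff using pair by blast
    qed
    have closeY: "\<exists>\<phi>\<in>matrix_states X n. \<forall>z\<in>lip_ball ?Z L. op_norm (\<phi> (fst z) - \<psi> (snd z)) \<le> \<epsilon>0"
      if n: "1 \<le> n" and \<psi>: "\<psi> \<in> matrix_states Y n" for n \<psi>
    proof -
      have "(INF a\<in>?A n. ?d a (restrict (\<psi> \<circ> snd) (os_space ?Z))) \<le> hausdorff ?d (?A n) (?B n)"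
        unfolding hausdorff_def by (intro max.coboundedI2 SUP_upper) (use \<psi> in blast)
      then have "(INF a\<in>?A n. ?d a (restrict (\<psi> \<circ> snd) (os_space ?Z))) < ennreal \<epsilon>0"
        using haus[OF n] by (rule order_le_less_trans)
      then show ?thesis unfolding INF_less_iff using pair by blast
    qed
    show "dist_op TYPE('v) X LX Y LY \<le> ?S + ennreal e"
    proof (cases "state_space Y = {}")
      case True
      \<comment> \<open>A state of X would have a partner on Y. Thus neither system has states, and
        both units are 0.\<close>
      have "matrix_states Y 1 = {}" using Y.matrix_state_1 True by auto
      then have "matrix_states X 1 = {}" using closeX[of 1] by auto
      then have "state_space X = {}" using X.state_matrix_state by auto
      then have "os_unit X = 0" "os_unit Y = 0" using True X.exists_state Y.exists_state by auto
      then show ?thesis using dist_op_trivial[OF X Y, where 'v = 'v] by simp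
    next
      case False
      then obtain \<sigma>0 where \<sigma>0: "\<sigma>0 \<in> state_space Y" by auto
      \<comment> \<open>The two final uses of \<open>refl\<close> instantiate \<open>T\<close> and
        \<open>V\<close> with the right-hand sides of their defining equations.\<close>
      have "dist_op TYPE('v) X LX Y LY \<le> ennreal \<epsilon>"
        by (rule close_systems.dist_op_le, rule close_systems.intro[OF X.operator_system_axioms Y.operator_system_axioms],
            rule close_systems_axioms.intro, rule adm, rule eps(1), rule eps(2), rule \<sigma>0,
            erule (1) closeX, erule (1) closeY, rule refl, rule refl)
      also have "ennreal \<epsilon> = ?S + ennreal e" using fin e by (simp add: \<epsilon>_def)
      finally show ?thesis .
    qed
  qed
qed

theorem theorem3p7:
  fixes X :: "'x::complex_vector op_system" and LX :: "'x \<Rightarrow> ennreal"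
    and Y :: "'y::complex_vector op_system" and LY :: "'y \<Rightarrow> ennreal"
  assumes "lip_normed_op_system X LX"
    and "lip_normed_op_system Y LY"
  shows "dist_op TYPE('v::complex_vector) X LX Y LY = dist_s X LX Y LY"
  using assms by (intro antisym dist_op_le_dist_s dist_s_le_dist_op)

end
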